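(* Let $n\geqslant 2$, let $D\subset\mathbb{R}^n$ be a domain, let $p\in(n-1,n]$, and let $f:D\rightarrow\mathbb{R}^n$ be a sense-preserving mapping. Let $Q:\mathbb{R}^n\rightarrow[0,\infty)$ be a Lebesgue measurable function with $0<Q(y)<\infty$ for $y\in f(D)$ and $Q(y)=0$ for $y\in\mathbb{R}^n\setminus f(D)$. Suppose that $$M_p(\Gamma(y_0,r_1,r_2))\leqslant\int\limits_{f(D)\cap A(r_1,r_2,y_0)}Q(y)\cdot\eta^p(|y-y_0|)\,dm(y)$$ for every $y_0\in f(D)$, every $0<r_1<r_2<\infty$, and every Lebesgue measurable function $\eta:(r_1,r_2)\rightarrow[0,\infty]$ with $\int_{r_1}^{r_2}\eta(r)\,dr\geqslant 1$. Then $f$ is discrete and open whenever $Q$ satisfies at least one of the following conditions: 1) $Q\in FMO(y_0)$ for every $y_0\in f(D)$; 2) $q_{y_0}(r)=O\left(\left[\log\frac1r\right]^{n-1}\right)$ as $r\rightarrow 0$, for every $y_0\in f(D)$; 3) for every $y_0\in f(D)$ there exists $\delta(y_0)>0$ such that for all sufficiently small $\varepsilon>0$ $$\int\limits_{\varepsilon}^{\delta(y_0)}\frac{dt}{t^{\frac{n-1}{p-1}}q_{y_0}^{\frac{1}{p-1}}(t)}<\infty,\qquad\int\limits_{0}^{\delta(y_0)}\frac{dt}{t^{\frac{n-1}{p-1}}q_{y_0}^{\frac{1}{p-1}}(t)}=\infty.$$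
   Context: All mappings $f:D\to\mathbb{R}^n$ are continuous; $m$ is Lebesgue measure in $\mathbb{R}^n$. $f$ is discrete if $f^{-1}(y)$ consists of isolated points for each $y\in\mathbb{R}^n$, and open if it maps open sets onto open sets. $f$ is sense-preserving (orientation preserving) if the topological index (degree) $\mu(y,f,G)>0$ for every domain $G$ with (compact) closure $\overline{G}\subset D$ and every $y\in f(G)\setminus f(\partial G)$; sense-preserving mappings are understood to be nonconstant. For a family $\Gamma$ of curves in $\mathbb{R}^n$, a Borel function $\rho:\mathbb{R}^n\to[0,\infty]$ is admissible, $\rho\in{\rm adm}\,\Gamma$, if $\int_\gamma\rho(x)|dx|\ge1$ for each locally rectifiable $\gamma\in\Gamma$; $M_p(\Gamma)=\inf_{\rho\in{\rm adm}\,\Gamma}\int_{\mathbb{R}^n}\rho^p(x)\,dm(x)$ is the $p$-modulus ($+\infty$ if ${\rm adm}\,\Gamma=\varnothing$). $S(y_0,r)=\{y:|y-y_0|=r\}$, $B(y_0,r)=\{y:|y-y_0|<r\}$, $A(r_1,r_2,y_0)=\{y\in\mathbb{R}^n:r_1<|y-y_0|<r_2\}$. For sets $E,F,G$, $\Gamma(E,F,G)$ is the family of all paths $\gamma:[a,b]\to\overline{\mathbb{R}^n}$ with $\gamma(a)\in E$, $\gamma(b)\in F$ and $\gamma(t)\in G$ for $t\in(a,b)$. $\Gamma(y_0,r_1,r_2)$ is the family of all paths $\gamma$ in $D$ such that $f\circ\gamma\in\Gamma(S(y_0,r_1),S(y_0,r_2),A(r_1,r_2,y_0))$. $q_{y_0}(r)=\frac{1}{\omega_{n-1}r^{n-1}}\int_{|y-y_0|=r}Q(y)\,dS$,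 where $dS$ is the area element of the sphere and $\omega_{n-1}$ is the area of the unit sphere in $\mathbb{R}^n$. $Q\in FMO(y_0)$ (finite mean oscillation at $y_0$) means $\limsup_{\varepsilon\to0}\frac{1}{\Omega_n\varepsilon^n}\int_{B(y_0,\varepsilon)}|Q(y)-\overline{Q}_\varepsilon|\,dm(y)<\infty$, where $\overline{Q}_\varepsilon=\frac{1}{\Omega_n\varepsilon^n}\int_{B(y_0,\varepsilon)}Q(y)\,dm(y)$ and $\Omega_n$ is the volume of the unit ball in $\mathbb{R}^n$. *)

theory Defs
  imports "HOL-Analysis.Analysis" "HOL-Homology.Homology"
begin

section \<open>Topological index and sense-preserving mappings\<close>

text \<open>
  Let \<open>G\<close> be a bounded open set, \<open>f\<close> continuous on its closure and \<open>y \<notin> f(\<partial>G)\<close>, so that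
  \<open>K = G \<inter> f\<^sup>-\<^sup>1(y)\<close> is compact. The index is the homological degree of \<open>f\<close> over \<open>y\<close>: a class \<open>c\<close>
  of \<open>H\<^sub>n(\<real>\<^sup>n, \<real>\<^sup>n - cball 0 r)\<close>, where the ball contains \<open>G\<close> and \<open>y\<close>, restricts on one side to
  \<open>H\<^sub>n(\<real>\<^sup>n, \<real>\<^sup>n - K) \<cong> H\<^sub>n(G, G - K)\<close> (excision), whence it is pushed forward by \<open>f\<close>, and on the other
  side directly to \<open>H\<^sub>n(\<real>\<^sup>n, \<real>\<^sup>n - {y}) \<cong> \<int>\<close>; the former image is \<open>d\<close> times the latter. Since the same
  \<open>c\<close> is used on both sides, no choice of orientation is involved. The groups of the library are
  written multiplicatively, so \<open>d\<close> appears as an exponent.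
\<close>

definition topological_index ::
    "'a::euclidean_space \<Rightarrow> ('a \<Rightarrow> 'a) \<Rightarrow> 'a set \<Rightarrow> int" where
  "topological_index y f G =
    (let n = int DIM('a); K = {x \<in> G. f x = y} in
     THE d::int. \<forall>r. G \<union> {y} \<subseteq> ball 0 r \<longrightarrow>
       (\<forall>c \<in> carrier (relative_homology_group n euclidean (- cball (0::'a) r)).
         \<exists>z \<in> carrier (relative_homology_group n (top_of_set G) (G - K)).
           hom_induced n (top_of_set G) (G - K) euclidean (- K) id z
             = hom_induced n euclidean (- cball 0 r) euclidean (- K) id c \<and>
           hom_induced n (top_of_set G) (G - K) euclidean (- {y}) f z
             = hom_induced n euclidean (- cball 0 r) euclidean (- {y}) id c
                 [^]\<^bsub>relative_homology_group n euclidean (- {y})\<^esub> d))"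

definition is_domain :: "'a::euclidean_space set \<Rightarrow> bool" where
  "is_domain G \<longleftrightarrow> open G \<and> connected G \<and> G \<noteq> {}"

definition sense_preserving :: "'a::euclidean_space set \<Rightarrow> ('a \<Rightarrow> 'a) \<Rightarrow> bool" where
  "sense_preserving D f \<longleftrightarrow>
     continuous_on D f \<and> \<not> f constant_on D \<and>
     (\<forall>G y. is_domain G \<and> compact (closure G) \<and> closure G \<subseteq> D \<and> y \<in> f ` G - f ` frontier G
        \<longrightarrow> topological_index y f G > 0)"

definition discrete_map :: "'a::euclidean_space set \<Rightarrow> ('a \<Rightarrow> 'b) \<Rightarrow> bool" where
  "discrete_map D f \<longleftrightarrow> (\<forall>y. discrete {x \<in> D. f x = y})"


section \<open>Curves and the modulus\<close>

definition curve_length :: "(real \<Rightarrow> 'a::euclidean_space) \<Rightarrow> real \<Rightarrow> real \<Rightarrow> ennreal" where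
  "curve_length \<gamma> a b =
     (SUP (k::nat, t) \<in> {(k, t). mono_on {..k} t \<and> t ` {..k} \<subseteq> {a..b}}.
        \<Sum>i<k. ennreal (dist (\<gamma> (t i)) (\<gamma> (t (Suc i)))))"

text \<open>For a rectifiable path, two parameters with the same length coordinate \<open>u\<close> have the same
  image, so the choice below is immaterial.\<close>

definition arc_length_param ::
    "(real \<Rightarrow> 'a::euclidean_space) \<Rightarrow> real \<Rightarrow> real \<Rightarrow> real \<Rightarrow> 'a" where
  "arc_length_param \<gamma> a b u = \<gamma> (SOME t. t \<in> {a..b} \<and> curve_length \<gamma> a t = ennreal u)"

definition path_line_integral ::
    "('a::euclidean_space \<Rightarrow> ennreal) \<Rightarrow> (real \<Rightarrow> 'a) \<Rightarrow> real \<Rightarrow> real \<Rightarrow> ennreal" where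
  "path_line_integral \<rho> \<gamma> a b =
     (\<integral>\<^sup>+ u \<in> {0..enn2real (curve_length \<gamma> a b)}. \<rho> (arc_length_param \<gamma> a b u) \<partial>lborel)"

text \<open>A curve is given by its parameter interval, which need not be compact, together with a function
  whose values outside that interval are irrelevant.\<close>

type_synonym 'a curve = "real set \<times> (real \<Rightarrow> 'a)"

definition locally_rectifiable :: "'a::euclidean_space curve \<Rightarrow> bool" where
  "locally_rectifiable = (\<lambda>(I, \<gamma>). \<forall>a b. a \<le> b \<and> {a..b} \<subseteq> I \<longrightarrow> curve_length \<gamma> a b < \<infinity>)"

definition line_integral :: "('a::euclidean_space \<Rightarrow> ennreal) \<Rightarrow> 'a curve \<Rightarrow> ennreal" where
  "line_integral \<rho> =
     (\<lambda>(I, \<gamma>). SUP (a, b) \<in> {(a, b). a \<le> b \<and> {a..b} \<subseteq> I}. path_line_integral \<rho> \<gamma> a b)"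

definition admissible :: "'a::euclidean_space curve set \<Rightarrow> ('a \<Rightarrow> ennreal) set" where
  "admissible \<Gamma> = {\<rho> \<in> borel_measurable borel.
     \<forall>\<gamma> \<in> \<Gamma>. locally_rectifiable \<gamma> \<longrightarrow> line_integral \<rho> \<gamma> \<ge> 1}"

text \<open>Power of an extended nonnegative number, used with positive exponents only.\<close>

definition enn_powr :: "ennreal \<Rightarrow> real \<Rightarrow> ennreal" where
  "enn_powr x p = (if x = \<infinity> then \<infinity> else ennreal (enn2real x powr p))"

definition modulus :: "real \<Rightarrow> 'a::euclidean_space curve set \<Rightarrow> ennreal" where
  "modulus p \<Gamma> = (INF \<rho> \<in> admissible \<Gamma>. \<integral>\<^sup>+ x. enn_powr (\<rho> x) p \<partial>lebesgue)"

definition annulus :: "real \<Rightarrow> real \<Rightarrow> 'a::euclidean_space \<Rightarrow> 'a set" where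
  "annulus r1 r2 y0 = {y. r1 < dist y y0 \<and> dist y y0 < r2}"

definition joining_paths ::
    "'a::euclidean_space set \<Rightarrow> 'a set \<Rightarrow> 'a set \<Rightarrow> 'a curve set" where
  "joining_paths E F G = {({a..b}, \<gamma>) | a b \<gamma>. a < b \<and> continuous_on {a..b} \<gamma> \<and>
     \<gamma> a \<in> E \<and> \<gamma> b \<in> F \<and> (\<forall>t \<in> {a<..<b}. \<gamma> t \<in> G)}"

definition lifted_paths ::
    "'a::euclidean_space set \<Rightarrow> ('a \<Rightarrow> 'a) \<Rightarrow> 'a \<Rightarrow> real \<Rightarrow> real \<Rightarrow> 'a curve set" where
  "lifted_paths D f y0 r1 r2 = {(I, \<gamma>). continuous_on I \<gamma> \<and> \<gamma> ` I \<subseteq> D \<and>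
     (I, f \<circ> \<gamma>) \<in> joining_paths (sphere y0 r1) (sphere y0 r2) (annulus r1 r2 y0)}"


section \<open>Spherical means and finite mean oscillation\<close>

text \<open>
  The area measure of the sphere \<open>S(y\<^sub>0, r)\<close>, via cones: the area of a Borel set \<open>A\<close> of the sphere is
  \<open>n r\<^sup>n\<^sup>-\<^sup>1\<close> times the volume of \<open>{x. |x| < 1 \<and> y\<^sub>0 + r x/|x| \<in> A}\<close>.
\<close>

definition sphere_area :: "'a::euclidean_space \<Rightarrow> real \<Rightarrow> 'a measure" where
  "sphere_area y0 r = completion
     (scale_measure (ennreal (real DIM('a) * r ^ (DIM('a) - 1)))
       (distr (restrict_space lborel (ball 0 1)) borel (\<lambda>x. y0 + r *\<^sub>R sgn x)))"

text \<open>With values in \<open>[0, \<infinity>]\<close>, since a measurable \<open>Q\<close> need not be integrable over a sphere.\<close>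

definition sphere_mean :: "('a::euclidean_space \<Rightarrow> real) \<Rightarrow> 'a \<Rightarrow> real \<Rightarrow> ennreal" where
  "sphere_mean Q y0 r =
     (\<integral>\<^sup>+ y \<in> sphere y0 r. ennreal (Q y) \<partial>sphere_area y0 r) /
     (emeasure (sphere_area (0::'a) 1) (sphere 0 1) * ennreal (r ^ (DIM('a) - 1)))"

text \<open>If \<open>Q\<close> is not integrable over \<open>ball y0 \<epsilon>\<close>, then its Bochner mean is \<open>0\<close> by convention and the
  mean oscillation below is \<open>\<infinity>\<close>; hence \<open>fmo\<close> implies integrability near \<open>y0\<close>.\<close>

definition ball_mean :: "('a::euclidean_space \<Rightarrow> real) \<Rightarrow> 'a \<Rightarrow> real \<Rightarrow> real" where
  "ball_mean Q y0 \<epsilon> =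
     (LINT y:ball y0 \<epsilon>|lebesgue. Q y) / (unit_ball_vol (real DIM('a)) * \<epsilon> ^ DIM('a))"

definition fmo :: "('a::euclidean_space \<Rightarrow> real) \<Rightarrow> 'a \<Rightarrow> bool" where
  "fmo Q y0 \<longleftrightarrow>
     Limsup (at_right 0) (\<lambda>\<epsilon>. (\<integral>\<^sup>+ y \<in> ball y0 \<epsilon>. ennreal \<bar>Q y - ball_mean Q y0 \<epsilon>\<bar> \<partial>lebesgue) /
       ennreal (unit_ball_vol (real DIM('a)) * \<epsilon> ^ DIM('a))) < \<infinity>"

end

theory Submission
  imports Defs
begin

text \<open>
  Under each of the three conditions a suitable weight \<open>\<eta>\<close> makes the right-hand side of the modulus
  inequality arbitrarily small as \<open>r\<^sub>1 \<rightarrow> 0\<close>, so the paths leaving a fibre \<open>f\<^sup>-\<^sup>1(y\<^sub>0)\<close> have modulus zero.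
  If a fibre contained a nondegenerate connected set \<open>C\<close>, then in some ball it would lie near a point
  outside the fibre. For a coordinate \<open>i\<close> not constant on \<open>C\<close>, the hyperplanes \<open>x\<^sub>i = t\<close> meet
  \<open>C\<close> for all \<open>t\<close> in some interval; join a point of \<open>C\<close> inside the hyperplane to the points of a small disc and
  translate these off the fibre. Since \<open>p > n - 1\<close> exceeds the dimension of the hyperplane, this family has
  positive \<open>p\<close>-modulus, a contradiction. Hence the fibres are totally disconnected. A point then has
  neighbourhoods whose frontier misses its fibre; there the homological index is positive, locally
  constant and additive, which gives openness, and discreteness by taking a neighbourhood
  of least index.
\<close>

section \<open>The homological index\<close>

text \<open>Nothing is known of the size of C beyond the interval covered by one of its coordinates.
  The lower bound is therefore proved in each hyperplane separately, for the fan of segments issuing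
  from one single point of C, and the bounds are then added up by Fubini. A single point is enough
  because p exceeds the dimension n - 1 of the hyperplane: a power s^(-\<beta>) of the distance
  along the segments can then be chosen with \<beta> < 1 and \<beta> (p - 1) > n - 2, so that both
  integrals that arise converge at s = 0. The translation off the fibre is by one fixed vector and
  only changes the constant.

  Conditions 1 and 2 lead to the same estimate, a bound of order 2^(-kn) k^(n-1) for the integral of
  Q over the shell between the radii 2^(-k-1) and 2^(-k). The weight 1/(t log(1/t)) is then good
  enough, because the harmonic series diverges. Condition 3 is the divergence of the weight that is
  optimal for the given spherical means.\<close>

abbreviation (input) "rel_homology \<equiv> relative_homology_group"

abbreviation (input) restrict_hom ::
    "int \<Rightarrow> 'a::euclidean_space set \<Rightarrow> 'a set \<Rightarrow> 'a chain set \<Rightarrow> 'a chain set" where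
  "restrict_hom p S T \<equiv> hom_induced p euclidean S euclidean T id"

abbreviation (input) push_hom ::
    "int \<Rightarrow> 'a::euclidean_space set \<Rightarrow> 'a set \<Rightarrow> 'a set \<Rightarrow> ('a \<Rightarrow> 'a) \<Rightarrow> 'a chain set \<Rightarrow> 'a chain set" where
  "push_hom p G S T f \<equiv> hom_induced p (top_of_set G) S euclidean T f"

section \<open>Local homology of Euclidean space at balls and points\<close>

text \<open>By the exact sequence of the triple it suffices that the complement of \<open>y\<close>
  modulo the complement of the ball has trivial homology. Pushing points away from \<open>y\<close>
  along their rays deforms the one complement into the other, since a ray from a point of a convex
  set never returns after leaving it. Consequently one class on the complement of a large ball
  serves as a coherent orientation at all points of the ball.\<close>

lemma iso_relative_homology_cball_point:
  fixes a y :: "'a::euclidean_space"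
  assumes y: "y \<in> cball a r"
  shows "restrict_hom p (- cball a r) (- {y})
           \<in> iso (rel_homology p euclidean (- cball a r))
                 (rel_homology p euclidean (- {y}))"
proof (rule very_short_exact_sequence)
  let ?S = "- {y}" and ?T = "- cball a r"
  have TS: "?T \<subseteq> ?S" using y by auto
  show "exact_seq
         ([rel_homology (p - 1) (subtopology euclidean ?S) ?T,
           rel_homology p euclidean ?S, rel_homology p euclidean ?T,
           rel_homology p (subtopology euclidean ?S) ?T],
          [hom_relboundary p euclidean ?S ?T, hom_induced p euclidean ?T euclidean ?S id,
           hom_induced p (subtopology euclidean ?S) ?T euclidean ?T id])"
    using homology_exactness_triple_1 [OF TS] homology_exactness_triple_3 [OF TS] by fastforce
  have r: "r \<ge> 0" using y by (metis cball_eq_empty empty_iff not_le)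
  \<comment> \<open>The ball has diameter \<open>2 * r\<close>, so moving a point by
    \<open>2 * r + 1\<close> away from \<open>y\<close> takes it out of the ball.\<close>
  define g where "g = (\<lambda>x. x + ((2 * r + 1) / norm (x - y)) *\<^sub>R (x - y))"
  have gT: "g x \<in> ?T" if "x \<noteq> y" for x
  proof -
    have "g x - y = (1 + (2 * r + 1) / norm (x - y)) *\<^sub>R (x - y)" by (simp add: g_def algebra_simps)
    then have "norm (g x - y) = (1 + (2 * r + 1) / norm (x - y)) * norm (x - y)" using r by simp
    also have "\<dots> = norm (x - y) + (2 * r + 1)" using that by (simp add: field_simps)
    finally have "dist (g x) y > 2 * r"
      using norm_ge_zero [of "x - y"] by (simp add: dist_norm del: norm_ge_zero)
    moreover have "dist (g x) y \<le> dist a (g x) + dist a y" by (metis dist_commute dist_triangle)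
    ultimately show ?thesis
      using y by auto
  qed
  have cont: "continuous_on S g" if "S \<subseteq> ?S" for S
    unfolding g_def using that by (intro continuous_intros) auto
  have ray_point: "\<exists>s\<ge>0. z = x + s *\<^sub>R (x - y)" if z: "z \<in> closed_segment (g x) x" for x z
  proof -
    obtain u where u: "0 \<le> u" "u \<le> 1" "z = (1 - u) *\<^sub>R g x + u *\<^sub>R x"
      using z by (auto simp: in_segment)
    obtain t where t: "t \<ge> 0" "g x = x + t *\<^sub>R (x - y)"
      by (rule that [of "(2 * r + 1) / norm (x - y)"]) (use r in \<open>simp_all add: g_def\<close>)
    have "z = x + ((1 - u) * t) *\<^sub>R (x - y)" unfolding u t by (simp add: algebra_simps)
    then show ?thesis using u t by (metis diff_ge_0_iff_ge mult_nonneg_nonneg)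
  qed
  have ray: "z \<notin> cball a r" if x: "x \<noteq> y" "x \<notin> cball a r" and z: "z \<in> closed_segment (g x) x" for x z
  proof
    assume zin: "z \<in> cball a r"
    obtain s where s: "s \<ge> 0" "z = x + s *\<^sub>R (x - y)" using ray_point z by blast
    have "x = (1 / (1 + s)) *\<^sub>R z + (s / (1 + s)) *\<^sub>R y"
    proof -
      have "(1 + s) *\<^sub>R x = z + s *\<^sub>R y" using s(2) by (simp add: algebra_simps)
      moreover have "x = (1 / (1 + s)) *\<^sub>R ((1 + s) *\<^sub>R x)" using s(1) by simp
      ultimately have "x = (1 / (1 + s)) *\<^sub>R (z + s *\<^sub>R y)" by simp
      then show ?thesis by (simp add: algebra_simps)
    qed
    moreover have "1 / (1 + s) + s / (1 + s) = 1" using s by (simp add: field_simps)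
    ultimately have "x \<in> cball a r"
      using convex_cball [of a r] zin y s unfolding convex_def
      by (metis add_nonneg_nonneg divide_nonneg_nonneg zero_le_one)
    with x show False by simp
  qed
  have seg: "y \<notin> closed_segment (g x) x" if "x \<noteq> y" for x
  proof
    assume "y \<in> closed_segment (g x) x"
    then obtain s where s: "s \<ge> 0" "y = x + s *\<^sub>R (x - y)" using ray_point by blast
    then have "(1 + s) *\<^sub>R (x - y) = 0"
      by (metis add_diff_cancel_left' add_diff_eq diff_self scaleR_left_distrib scaleR_one add.commute diff_diff_eq2)
    then show False
      using s that by simp
  qed
  have h: "homotopic_with (\<lambda>h. True) (top_of_set U) (top_of_set U) g id"
    if "U = ?S \<or> U = ?T" for U
  proof (rule homotopic_with_linear)
    show "continuous_on U g" using cont that TS by blast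
    fix x assume "x \<in> U"
    then show "closed_segment (g x) (id x) \<subseteq> U" using that ray seg y by fastforce
  qed auto
  have "trivial_group (rel_homology q (subtopology euclidean ?S) ?T)" for q
  proof (rule trivial_relative_homology_group_gen)
    have eq: "subtopology (top_of_set ?S) ?T = top_of_set ?T"
      using TS by (simp add: subtopology_subtopology inf.absorb2)
    show "continuous_map (top_of_set ?S) (subtopology (top_of_set ?S) ?T) g"
      unfolding eq using cont gT by auto
    show "homotopic_with (\<lambda>h. True) (subtopology (top_of_set ?S) ?T) (subtopology (top_of_set ?S) ?T) g id"
      unfolding eq using h by blast
    show "homotopic_with (\<lambda>k. True) (top_of_set ?S) (top_of_set ?S) g id" using h by blast
  qed
  then show "trivial_group (rel_homology p (subtopology euclidean ?S) ?T)"
    "trivial_group (rel_homology (p - 1) (subtopology euclidean ?S) ?T)"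
    by auto
qed

text \<open>The whole space is contractible, so the group is the reduced homology of the punctured
  space one degree lower, and that space is homotopy equivalent to a sphere. Reduced groups make
  dimension 1 no exception.\<close>

lemma relative_homology_punctured_space:
  fixes y :: "'a::euclidean_space"
  shows "rel_homology (int DIM('a)) euclidean (- {y}) \<cong> integer_group"
proof -
  let ?n = "int DIM('a)"
  have "rel_homology ?n euclidean (- {y}) \<cong> reduced_homology_group (?n - 1) (top_of_set (- {y}))"
  proof (rule isomorphic_group_relative_homology_of_contractible)
    show "contractible_space (euclidean :: 'a topology)"
      using contractible_space_top_of_set [of "UNIV :: 'a set"] contractible_UNIV
      by (metis subtopology_UNIV)
    obtain b :: 'a where "b \<in> Basis" using nonempty_Basis by blast
    then have "y + b \<in> - {y}" using nonzero_Basis by simp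
    then show "topspace euclidean \<inter> - {y} \<noteq> {}"
      by (metis Int_iff UNIV_I empty_iff topspace_euclidean)
  qed
  also have "\<dots> \<cong> reduced_homology_group (?n - 1) (top_of_set (sphere 0 1 :: 'a set))"
  proof (rule homotopy_equivalent_space_imp_isomorphic_reduced_homology_groups)
    have "rel_frontier (cball y 1) homotopy_eqv affine hull cball y 1 - {y}"
      by (rule homotopy_eqv_rel_frontier_punctured_affine_hull) (auto simp: rel_interior_nonempty_interior)
    then have "sphere y 1 homotopy_eqv - {y}"
      by (simp add: rel_frontier_cball affine_hull_nonempty_interior Compl_eq_Diff_UNIV)
    moreover have "sphere y 1 homotopy_eqv (sphere 0 1 :: 'a set)"
      by (simp add: homeomorphic_imp_homotopy_eqv homeomorphic_spheres)
    ultimately show "- {y} homotopy_eqv (sphere 0 1 :: 'a set)"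
      using homotopy_equivalent_space_sym homotopy_eqv_trans by blast
  qed
  also have "\<dots> \<cong> reduced_homology_group (?n - 1) (nsphere (DIM('a) - 1))"
  proof (rule homeomorphic_space_imp_isomorphic_reduced_homology_groups)
    obtain f :: "(nat \<Rightarrow> real) \<Rightarrow> 'a" and g where
      "homeomorphic_maps (nsphere (DIM('a) - 1)) (top_of_set (sphere 0 1 \<inter> span (Basis :: 'a set))) f g"
      by (rule homeomorphic_maps_nsphere_euclidean_sphere [where B = "Basis :: 'a set" and n = "DIM('a)"])
        (auto simp: independent_Basis pairwise_def orthogonal_def inner_Basis)
    then show "top_of_set (sphere 0 1 :: 'a set) homeomorphic_space nsphere (DIM('a) - 1)"
      by (metis homeomorphic_space_def homeomorphic_space_sym span_Basis Int_UNIV_right)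
  qed
  also have "\<dots> \<cong> integer_group"
  proof -
    have "?n - 1 = int (DIM('a) - 1)" using DIM_positive [where 'a = 'a] by simp
    then show ?thesis by (metis reduced_homology_group_nsphere(1))
  qed
  finally show ?thesis .
qed

lemma iso_relative_homology_excise_open:
  fixes G :: "'a::euclidean_space set"
  assumes "open G" "closed K" "K \<subseteq> G"
  shows "hom_induced p (top_of_set G) (G - K) euclidean (- K) id
           \<in> iso (rel_homology p (top_of_set G) (G - K))
                 (rel_homology p euclidean (- K))"
proof -
  have "euclidean closure_of (- G) \<subseteq> euclidean interior_of (- K)"
    using assms by (simp add: closed_Compl closure_closed interior_open open_Compl)
  from homology_excision_axiom [OF this, of UNIV p]
  show ?thesis by (simp add: Diff_eq Int_commute)
qed

text \<open>Replaces the abstract isomorphism by a generator of infinite order, from which the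
  exponent in the definition of the index can be read off uniquely.\<close>

lemma integer_group_generator:
  assumes "group G" "G \<cong> integer_group"
  shows "\<exists>u\<in>carrier G. (\<forall>x\<in>carrier G. \<exists>k::int. x = u [^]\<^bsub>G\<^esub> k) \<and>
    (\<forall>k l::int. u [^]\<^bsub>G\<^esub> k = u [^]\<^bsub>G\<^esub> l \<longrightarrow> k = l)"
proof -
  obtain h where h: "h \<in> iso integer_group G" using assms group.iso_sym is_iso_def by blast
  interpret group_hom integer_group G h
    using h assms by (simp add: group_hom_def group_hom_axioms_def iso_imp_homomorphism)
  have pow: "h 1 [^]\<^bsub>G\<^esub> k = h k" for k :: int
    using int_pow_closed hom_int_pow [of 1 k] by (simp add: int_pow_int)
  show ?thesis
  proof (intro bexI [of _ "h 1"] conjI ballI allI impI)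
    show "\<exists>k::int. x = h 1 [^]\<^bsub>G\<^esub> k" if "x \<in> carrier G" for x
      using h that unfolding pow by (auto simp: iso_def bij_betw_def)
    show "k = l" if "h 1 [^]\<^bsub>G\<^esub> k = h 1 [^]\<^bsub>G\<^esub> l" for k l :: int
      using h that unfolding pow by (auto simp: iso_def bij_betw_def inj_on_def)
  qed simp
qed

lemma hom_induced_restrict_compose:
  assumes "A \<subseteq> B" "B \<subseteq> C"
  shows "hom_induced p X B X C id (hom_induced p X A X B id c) = hom_induced p X A X C id c"
  using assms by (subst hom_induced_compose') auto

text \<open>The induced map factors through the homology of a space modulo itself, which is trivial.
  It is used twice: a piece of the domain away from a fibre contributes nothing, and a map that
  omits a value has trivial class at that value.\<close>

lemma hom_induced_into_subspace:
  assumes "continuous_map X Y f" "f \<in> topspace X \<rightarrow> T" "S \<subseteq> topspace X"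
    "c \<in> carrier (rel_homology p X S)"
  shows "hom_induced p X S Y T f c = \<one>\<^bsub>rel_homology p Y T\<^esub>"
proof -
  let ?H = "rel_homology p X (topspace X)"
  have "hom_induced p X S Y T f c
      = hom_induced p X (topspace X) Y T f (hom_induced p X S X (topspace X) id c)"
    using assms by (subst hom_induced_compose') auto
  moreover have "hom_induced p X S X (topspace X) id c = \<one>\<^bsub>?H\<^esub>"
    using trivial_relative_homology_group_topspace [of p X] hom_induced_carrier [of p X S X "topspace X" id c]
    by (simp add: trivial_group_def)
  ultimately show ?thesis
    by (simp add: hom_one [OF hom_induced_hom])
qed

lemma group_hom_hom_induced:
  "group_hom (rel_homology p X S) (rel_homology p Y T) (hom_induced p X S Y T f)"
  by (simp add: group_hom_def group_hom_axioms_def hom_induced_hom)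

lemmas hom_induced_mult = group_hom.hom_mult [OF group_hom_hom_induced]
  and hom_induced_int_pow = group_hom.hom_int_pow [OF group_hom_hom_induced]
  and hom_induced_one = group_hom.hom_one [OF group_hom_hom_induced]
  and hom_induced_inv = group_hom.hom_inv [OF group_hom_hom_induced]

lemma iso_injD: "h \<in> iso G H \<Longrightarrow> h a = h b \<Longrightarrow> a \<in> carrier G \<Longrightarrow> b \<in> carrier G \<Longrightarrow> a = b"
  by (auto simp: iso_def bij_betw_def inj_on_def)

lemma iso_surjE:
  assumes "h \<in> iso G H" "b \<in> carrier H"
  obtains a where "a \<in> carrier G" "h a = b"
proof -
  have "b \<in> h ` carrier G" using assms by (simp add: iso_def bij_betw_def)
  then show ?thesis using that by blast
qed

section \<open>Existence, uniqueness, additivity and local constancy of the index\<close>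

abbreviation (input) index_witness ::
    "int \<Rightarrow> 'a::euclidean_space \<Rightarrow> ('a \<Rightarrow> 'a) \<Rightarrow> 'a set \<Rightarrow> 'a set \<Rightarrow> int \<Rightarrow> real \<Rightarrow> 'a chain set \<Rightarrow> 'a chain set \<Rightarrow> bool" where
  "index_witness n y f G K d r c z \<equiv>
     push_hom n G (G - K) (- K) id z = restrict_hom n (- cball 0 r) (- K) c \<and>
     push_hom n G (G - K) (- {y}) f z
       = restrict_hom n (- cball 0 r) (- {y}) c [^]\<^bsub>rel_homology n euclidean (- {y})\<^esub> d"

text \<open>This is the condition under the definite description in
  \<open>topological_index\<close>. As a predicate it can be transferred between sets and added by
  exhibiting classes; uniqueness enters only where two values are compared.\<close>

definition has_index :: "'a::euclidean_space \<Rightarrow> ('a \<Rightarrow> 'a) \<Rightarrow> 'a set \<Rightarrow> int \<Rightarrow> bool" where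
  "has_index y f G d \<longleftrightarrow>
     (\<forall>r. G \<union> {y} \<subseteq> ball 0 r \<longrightarrow>
       (\<forall>c \<in> carrier (rel_homology (int DIM('a)) euclidean (- cball (0::'a) r)).
         \<exists>z \<in> carrier (rel_homology (int DIM('a)) (top_of_set G) (G - {x \<in> G. f x = y})).
           index_witness (int DIM('a)) y f G {x \<in> G. f x = y} d r c z))"

lemma topological_index_has_index: "topological_index y f G = (THE d. has_index y f G d)"
  by (simp add: topological_index_def has_index_def Let_def)

text \<open>The index quantifies over all large radii, so classes belonging to different balls have
  to be compared. Both are restrictions of one class \<open>e\<close> from a larger ball, because
  restriction to the point \<open>y\<close> is an isomorphism for each of the three radii.\<close>

lemma restrict_class_cong:
  fixes y :: "'a::euclidean_space"
  assumes "insert y K \<subseteq> ball 0 r" "insert y K \<subseteq> ball 0 r'"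
    and c: "c \<in> carrier (rel_homology p euclidean (- cball (0::'a) r))"
    and c': "c' \<in> carrier (rel_homology p euclidean (- cball (0::'a) r'))"
    and eq: "restrict_hom p (- cball 0 r) (- {y}) c = restrict_hom p (- cball 0 r') (- {y}) c'"
  shows "restrict_hom p (- cball 0 r) (- K) c = restrict_hom p (- cball 0 r') (- K) c'"
proof -
  define R where "R = max r r'"
  have iso: "restrict_hom p (- cball 0 s) (- {y})
      \<in> iso (rel_homology p euclidean (- cball 0 s)) (rel_homology p euclidean (- {y}))"
    if "s \<in> {r, r', R}" for s
    using that assms(1,2) by (intro iso_relative_homology_cball_point) (auto simp: R_def)
  obtain e where e: "e \<in> carrier (rel_homology p euclidean (- cball (0::'a) R))"
    "restrict_hom p (- cball 0 R) (- {y}) e = restrict_hom p (- cball 0 r) (- {y}) c"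
    by (rule iso_surjE [OF iso [of R] hom_induced_carrier]) auto
  have *: "restrict_hom p (- cball 0 R) (- K) e = restrict_hom p (- cball 0 s) (- K) b"
    if s: "s = r \<or> s = r'" and b: "b \<in> carrier (rel_homology p euclidean (- cball (0::'a) s))"
      "restrict_hom p (- cball 0 s) (- {y}) b = restrict_hom p (- cball 0 R) (- {y}) e" for s b
  proof -
    have Rs: "- cball 0 R \<subseteq> - cball (0::'a) s" using s by (auto simp: R_def)
    have s': "- cball 0 s \<subseteq> - {y}" "- cball 0 s \<subseteq> - K" using s assms(1,2) by auto
    have "restrict_hom p (- cball 0 R) (- cball 0 s) e = b"
    proof (rule iso_injD [OF iso [of s]])
      show "s \<in> {r, r', R}" using s by auto
    qed (simp_all add: b hom_induced_carrier hom_induced_restrict_compose [OF Rs s'(1)])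
    then show ?thesis using hom_induced_restrict_compose [OF Rs s'(2), of p euclidean e] by simp
  qed
  show ?thesis using *[of r c] *[of r' c'] c c' e(2) eq by simp
qed

text \<open>One class decides: \<open>c0\<close> restricts to a generator \<open>u\<close> at
  \<open>y\<close>, excision gives \<open>z0\<close> with the same image in the complement of the
  fibre, and \<open>d\<close> is the exponent of its push-forward. Every other class, of any radius,
  has the same restrictions as a power of \<open>c0\<close>, so the same \<open>d\<close> serves. No
  other exponent does, because \<open>u\<close> has infinite order.\<close>

lemma has_index_ex1:
  fixes f :: "'a::euclidean_space \<Rightarrow> 'a"
  assumes G: "open G" "bounded G" and K: "compact {x \<in> G. f x = y}" and f: "continuous_on G f"
  shows "\<exists>!d. has_index y f G d"
proof -
  define n where "n = int DIM('a)"
  define K where "K = {x \<in> G. f x = y}"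
  let ?H = "\<lambda>A. rel_homology n euclidean (A :: 'a set)"
  let ?HG = "rel_homology n (top_of_set G) (G - K)"
  let ?J = "push_hom n G (G - K) (- K) id"
  let ?F = "push_hom n G (G - K) (- {y}) f"
  let ?c = "\<lambda>r A c. restrict_hom n (- cball 0 r) A c"
  have excise: "?J \<in> iso ?HG (?H (- K))"
    using K G by (intro iso_relative_homology_excise_open) (auto simp: K_def compact_imp_closed)
  obtain u where u: "u \<in> carrier (?H (- {y}))"
    and u': "(\<forall>x\<in>carrier (?H (- {y})). \<exists>k::int. x = u [^]\<^bsub>?H (- {y})\<^esub> k) \<and>
      (\<forall>k l::int. u [^]\<^bsub>?H (- {y})\<^esub> k = u [^]\<^bsub>?H (- {y})\<^esub> l \<longrightarrow> k = l)"
    by (rule bexE [OF integer_group_generator [OF group_relative_homology_group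
          relative_homology_punctured_space [of y, folded n_def]]])
  have gen: "\<exists>k::int. x = u [^]\<^bsub>?H (- {y})\<^esub> k" if "x \<in> carrier (?H (- {y}))" for x
    by (rule bspec [OF conjunct1 [OF u'] that])
  have inj: "k = l" if "u [^]\<^bsub>?H (- {y})\<^esub> k = u [^]\<^bsub>?H (- {y})\<^esub> l" for k l :: int
    by (rule conjunct2 [OF u', rule_format, OF that])
  obtain r0 where r0: "G \<union> {y} \<subseteq> ball 0 r0"
    using G(2) bounded_subset_ballD [of "insert y G" 0] by auto
  have iso0: "?c r0 (- {y}) \<in> iso (?H (- cball 0 r0)) (?H (- {y}))"
    using r0 by (intro iso_relative_homology_cball_point) auto
  obtain c0 where c0: "c0 \<in> carrier (?H (- cball 0 r0))" "?c r0 (- {y}) c0 = u"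
    by (rule iso_surjE [OF iso0 u])
  obtain z0 where z0: "z0 \<in> carrier ?HG" "?J z0 = ?c r0 (- K) c0"
    by (rule iso_surjE [OF excise hom_induced_carrier])
  obtain d :: int where d: "?F z0 = u [^]\<^bsub>?H (- {y})\<^esub> d"
    using gen [of "?F z0"] by (auto simp: hom_induced_carrier)
  interpret Y: group "?H (- {y})" by simp
  interpret HG: group ?HG by simp
  have "has_index y f G d"
    unfolding has_index_def n_def [symmetric] K_def [symmetric]
  proof (intro allI impI ballI)
    fix r c assume r: "G \<union> {y} \<subseteq> ball 0 r" and c: "c \<in> carrier (?H (- cball 0 r))"
    obtain k where k: "?c r (- {y}) c = u [^]\<^bsub>?H (- {y})\<^esub> (k::int)"
      using gen [of "?c r (- {y}) c"] by (auto simp: hom_induced_carrier)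
    define ck where "ck = c0 [^]\<^bsub>?H (- cball 0 r0)\<^esub> k"
    have ck: "ck \<in> carrier (?H (- cball 0 r0))" using c0 by (simp add: ck_def group.int_pow_closed)
    have cK: "?c r (- K) c = ?c r0 (- K) ck"
    proof (rule restrict_class_cong [where y = y])
      show "?c r (- {y}) c = ?c r0 (- {y}) ck" using c0 k by (simp add: ck_def hom_induced_int_pow)
    qed (use r r0 c ck in \<open>auto simp: K_def\<close>)
    show "\<exists>z\<in>carrier ?HG. ?J z = ?c r (- K) c \<and> ?F z = ?c r (- {y}) c [^]\<^bsub>?H (- {y})\<^esub> d"
    proof (intro bexI conjI)
      show "z0 [^]\<^bsub>?HG\<^esub> k \<in> carrier ?HG" using z0 by simp
      show "?J (z0 [^]\<^bsub>?HG\<^esub> k) = ?c r (- K) c"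
        using z0 c0 by (simp add: hom_induced_int_pow cK ck_def)
      show "?F (z0 [^]\<^bsub>?HG\<^esub> k) = ?c r (- {y}) c [^]\<^bsub>?H (- {y})\<^esub> d"
        using z0 u by (simp add: hom_induced_int_pow d k Y.int_pow_pow mult.commute)
    qed
  qed
  moreover have "d1 = d2" if 1: "has_index y f G d1" and 2: "has_index y f G d2" for d1 d2
  proof -
    obtain z1 where z1: "z1 \<in> carrier ?HG" "?J z1 = ?c r0 (- K) c0" "?F z1 = u [^]\<^bsub>?H (- {y})\<^esub> d1"
      using 1 [unfolded has_index_def, folded n_def K_def, rule_format, OF r0 c0(1)] c0(2) by auto
    obtain z2 where z2: "z2 \<in> carrier ?HG" "?J z2 = ?c r0 (- K) c0" "?F z2 = u [^]\<^bsub>?H (- {y})\<^esub> d2"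
      using 2 [unfolded has_index_def, folded n_def K_def, rule_format, OF r0 c0(1)] c0(2) by auto
    have "z1 = z2" by (rule iso_injD [OF excise]) (simp_all add: z1 z2)
    then show ?thesis using z1(3) z2(3) inj by simp
  qed
  ultimately show ?thesis by blast
qed

text \<open>Only a neighbourhood of the fibre matters: the inclusion of \<open>G'\<close> carries
  witnesses over \<open>G'\<close> to witnesses over \<open>G\<close>.\<close>

lemma has_index_superset:
  fixes f :: "'a::euclidean_space \<Rightarrow> 'a"
  assumes d: "has_index y f G' d" and sub: "G' \<subseteq> G" "{x \<in> G. f x = y} \<subseteq> G'" and f: "continuous_on G f"
  shows "has_index y f G d"
proof -
  define n where "n = int DIM('a)"
  define K where "K = {x \<in> G. f x = y}"
  have K': "{x \<in> G'. f x = y} = K" using sub by (auto simp: K_def)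
  show ?thesis
    unfolding has_index_def n_def [symmetric] K_def [symmetric]
  proof (intro allI impI ballI)
    fix r c assume r: "G \<union> {y} \<subseteq> ball 0 r"
      and c: "c \<in> carrier (rel_homology n euclidean (- cball (0::'a) r))"
    have r': "G' \<union> {y} \<subseteq> ball 0 r" using r sub by auto
    obtain z where z: "z \<in> carrier (rel_homology n (top_of_set G') (G' - K))" "index_witness n y f G' K d r c z"
      using d [unfolded has_index_def, folded n_def, unfolded K', rule_format, OF r' c] by blast
    define w where "w = hom_induced n (top_of_set G') (G' - K) (top_of_set G) (G - K) id z"
    have GG: "continuous_map (top_of_set G') (top_of_set G) id" "id \<in> G' - K \<rightarrow> G - K"
      using sub by auto
    have "push_hom n G (G - K) (- K) id w = push_hom n G' (G' - K) (- K) id z"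
      unfolding w_def by (subst hom_induced_compose' [OF GG]) auto
    moreover have "push_hom n G (G - K) (- {y}) f w = push_hom n G' (G' - K) (- {y}) f z"
      unfolding w_def using f by (subst hom_induced_compose' [OF GG]) (auto simp: K_def)
    ultimately show "\<exists>z\<in>carrier (rel_homology n (top_of_set G) (G - K)). index_witness n y f G K d r c z"
      using z by (intro bexI [of _ w]) (auto simp: w_def hom_induced_carrier)
  qed
qed

lemma has_index_empty_fibre:
  fixes f :: "'a::euclidean_space \<Rightarrow> 'a"
  assumes "\<And>x. x \<in> G \<Longrightarrow> f x \<noteq> y"
  shows "has_index y f G 0"
proof -
  have K: "{x \<in> G. f x = y} = {}" using assms by auto
  define n where "n = int DIM('a)"
  have triv: "a = b" if "a \<in> carrier (rel_homology n euclidean (UNIV :: 'a set))"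
    "b \<in> carrier (rel_homology n euclidean (UNIV :: 'a set))" for a b
    using that trivial_relative_homology_group_topspace [of n "euclidean :: 'a topology"]
    by (simp add: trivial_group_def)
  interpret HG: group "rel_homology n (top_of_set G) G" by simp
  have "hom_induced n (top_of_set G) G euclidean UNIV id a
     = hom_induced n euclidean (- cball 0 r) euclidean UNIV id c" for a r c
    by (rule triv; rule hom_induced_carrier)
  then show ?thesis
    unfolding has_index_def n_def [symmetric] K
    by (auto intro!: bexI [of _ "\<one>\<^bsub>rel_homology n (top_of_set G) G\<^esub>"] simp: hom_induced_one)
qed

text \<open>With \<open>S = (A - KA) \<union> B\<close> between the union and \<open>T\<close>,
  excision of \<open>B\<close> identifies the homology of the union modulo \<open>S\<close> with
  that of \<open>A\<close> modulo \<open>A - KA\<close>, and excision of \<open>A - KA\<close>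
  identifies the homology of \<open>S\<close> modulo \<open>T\<close> with that of \<open>B\<close>
  modulo \<open>B - KB\<close>. The class \<open>a\<close> is chosen to agree with \<open>z\<close>
  modulo \<open>S\<close>; the remaining factor \<open>w\<close> is then in the kernel, and
  exactness of the triple makes it come from some \<open>b\<close>.\<close>

lemma relative_homology_disjoint_Un:
  fixes A B :: "'a::euclidean_space set"
  assumes A: "open A" and B: "open B" and AB: "disjnt A B" and K: "KA \<subseteq> A" "KB \<subseteq> B"
    and z: "z \<in> carrier (rel_homology p (top_of_set (A \<union> B)) (A \<union> B - (KA \<union> KB)))"
  obtains a b where "a \<in> carrier (rel_homology p (top_of_set A) (A - KA))"
    and "b \<in> carrier (rel_homology p (top_of_set B) (B - KB))"
    and "z = hom_induced p (top_of_set A) (A - KA) (top_of_set (A \<union> B)) (A \<union> B - (KA \<union> KB)) id a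
        \<otimes>\<^bsub>rel_homology p (top_of_set (A \<union> B)) (A \<union> B - (KA \<union> KB))\<^esub>
           hom_induced p (top_of_set B) (B - KB) (top_of_set (A \<union> B)) (A \<union> B - (KA \<union> KB)) id b"
proof -
  define X where "X = top_of_set (A \<union> B)"
  define T where "T = A \<union> B - (KA \<union> KB)"
  define S where "S = (A - KA) \<union> B"
  have disj: "A \<inter> B = {}" using AB by (simp add: disjnt_def)
  have TS: "T \<subseteq> S" "S \<subseteq> A \<union> B" using K disj by (auto simp: T_def S_def)
  have sub: "subtopology X S = top_of_set S"
    using TS by (simp add: X_def subtopology_subtopology inf.absorb2)
  have excise1: "X closure_of B \<subseteq> X interior_of S"
  proof -
    have "closedin X B"
    proof -
      have "openin X ((A \<union> B) \<inter> A)" unfolding X_def using A by (rule openin_open_Int)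
      moreover have "(A \<union> B) \<inter> A = A \<union> B - B" using disj by auto
      ultimately show ?thesis
        by (simp add: closedin_def X_def)
    qed
    moreover have "openin X B"
      using openin_open_Int [OF B, of "A \<union> B"] by (simp add: X_def Int_absorb1)
    ultimately show ?thesis
      by (simp add: closure_of_closedin interior_of_maximal S_def)
  qed
  have iso1: "hom_induced p (top_of_set A) (A - KA) X S id
      \<in> iso (rel_homology p (top_of_set A) (A - KA)) (rel_homology p X S)"
  proof -
    have "subtopology X (A \<union> B - B) = top_of_set A" "subtopology X (A \<union> B) = X" "S - B = A - KA"
      using disj by (auto simp: X_def S_def subtopology_subtopology intro!: arg_cong [where f = top_of_set])
    then show ?thesis using homology_excision_axiom [OF excise1, of "A \<union> B" p] TS by simp
  qed
  have excise2: "top_of_set S closure_of (A - KA) \<subseteq> top_of_set S interior_of T"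
  proof -
    have "A - KA = S - B" "A - KA = S \<inter> A" using K disj by (auto simp: S_def)
    moreover have "closedin (top_of_set S) (S - B)"
      using closedin_closed_Int [OF closed_Compl [OF B], of S] by (simp add: Diff_eq)
    moreover have "openin (top_of_set S) (S \<inter> A)" using A by (rule openin_open_Int)
    ultimately have "closedin (top_of_set S) (A - KA)" "openin (top_of_set S) (A - KA)" by auto
    moreover have "A - KA \<subseteq> T" using K disj by (auto simp: T_def)
    ultimately show ?thesis
      by (simp add: closure_of_closedin interior_of_maximal)
  qed
  have iso2: "hom_induced p (top_of_set B) (B - KB) (top_of_set S) T id
      \<in> iso (rel_homology p (top_of_set B) (B - KB)) (rel_homology p (top_of_set S) T)"
  proof -
    have eqs: "S - (A - KA) = B" "T - (A - KA) = B - KB" using K disj by (auto simp: S_def T_def)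
    have "subtopology (top_of_set S) B = top_of_set B"
      by (auto simp: S_def subtopology_subtopology intro!: arg_cong [where f = top_of_set])
    then show ?thesis
      using homology_excision_axiom [OF excise2 TS(1), of p]
      unfolding eqs by (simp add: subtopology_subtopology)
  qed
  let ?HT = "rel_homology p X T" and ?HS = "rel_homology p X S"
  let ?iA = "hom_induced p (top_of_set A) (A - KA) X T id"
  let ?iB = "hom_induced p (top_of_set B) (B - KB) X T id"
  let ?h = "hom_induced p X T X S id"
  interpret HT: comm_group ?HT by simp
  interpret HS: group ?HS by simp
  have z: "z \<in> carrier ?HT" using z by (simp add: X_def T_def)
  obtain a where a: "a \<in> carrier (rel_homology p (top_of_set A) (A - KA))"
    "hom_induced p (top_of_set A) (A - KA) X S id a = ?h z"
    by (rule iso_surjE [OF iso1 hom_induced_carrier])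
  have iA: "?iA a \<in> carrier ?HT" "?h (?iA a) = ?h z"
  proof -
    show "?iA a \<in> carrier ?HT" by (simp add: hom_induced_carrier)
    have "continuous_map (top_of_set A) X id" "id \<in> A - KA \<rightarrow> T"
      using K disj by (auto simp: X_def T_def)
    then show "?h (?iA a) = ?h z" using TS by (subst hom_induced_compose') (auto simp: a)
  qed
  define w where "w = z \<otimes>\<^bsub>?HT\<^esub> inv\<^bsub>?HT\<^esub> (?iA a)"
  have w: "w \<in> carrier ?HT" "?h w = \<one>\<^bsub>?HS\<^esub>"
    using z iA by (simp_all add: w_def hom_induced_mult hom_induced_inv hom_induced_carrier)
  then have "w \<in> kernel ?HT ?HS ?h" by (simp add: kernel_def)
  also have "kernel ?HT ?HS ?h
      = hom_induced p (top_of_set S) T X T id ` carrier (rel_homology p (top_of_set S) T)"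
    using homology_exactness_triple_3 [OF TS(1), of p X] by (simp add: sub)
  finally obtain w' where w': "w' \<in> carrier (rel_homology p (top_of_set S) T)"
    "w = hom_induced p (top_of_set S) T X T id w'"
    by blast
  obtain b where b: "b \<in> carrier (rel_homology p (top_of_set B) (B - KB))"
    "hom_induced p (top_of_set B) (B - KB) (top_of_set S) T id b = w'"
    by (rule iso_surjE [OF iso2 w'(1)])
  have "w = ?iB b"
  proof -
    have "continuous_map (top_of_set B) (top_of_set S) id" "id \<in> B - KB \<rightarrow> T"
      "continuous_map (top_of_set S) X id"
      using K disj TS by (auto simp: X_def T_def S_def)
    then show ?thesis unfolding w'(2) b(2) [symmetric] by (subst hom_induced_compose') auto
  qed
  moreover have "z = ?iA a \<otimes>\<^bsub>?HT\<^esub> w" using z iA by (simp add: w_def HT.m_lcomm)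
  ultimately have "z = ?iA a \<otimes>\<^bsub>?HT\<^esub> ?iB b" by simp
  then show ?thesis using that a b by (simp add: X_def T_def)
qed

lemma has_index_disjoint_Un:
  fixes f :: "'a::euclidean_space \<Rightarrow> 'a"
  assumes A: "open A" "compact {x \<in> A. f x = y}" "has_index y f A d"
    and B: "open B" "compact {x \<in> B. f x = y}" "has_index y f B e"
    and AB: "disjnt A B" and f: "continuous_on (A \<union> B) f"
  shows "has_index y f (A \<union> B) (d + e)"
proof -
  define n where "n = int DIM('a)"
  define KA where "KA = {x \<in> A. f x = y}"
  define KB where "KB = {x \<in> B. f x = y}"
  define G where "G = A \<union> B"
  define K where "K = KA \<union> KB"
  have K_eq: "{x \<in> G. f x = y} = K" by (auto simp: G_def K_def KA_def KB_def)
  have KAB: "KA \<subseteq> A" "KB \<subseteq> B" by (auto simp: KA_def KB_def)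
  have closed: "closed KA" "closed KB" "closed K"
    using A B by (auto simp: K_def KA_def KB_def compact_imp_closed)
  have disj: "A \<inter> B = {}" using AB by (simp add: disjnt_def)
  let ?H = "\<lambda>V. rel_homology n euclidean (V :: 'a set)"
  let ?c = "\<lambda>r V c. restrict_hom n (- cball 0 r) V c"
  let ?u = "\<lambda>r c k. ?c r (- {y}) c [^]\<^bsub>?H (- {y})\<^esub> (k::int)"
  let ?HG = "rel_homology n (top_of_set G) (G - K)"
  let ?into = "\<lambda>U L. hom_induced n (top_of_set U) (U - L) (top_of_set G) (G - K) id"
  let ?F = "push_hom n G (G - K) (- {y}) f"
  interpret Hy: group "?H (- {y})" by simp
  \<comment> \<open>Passing to the complement of \<open>L\<close> alone kills the part coming from
    \<open>V\<close>, which misses \<open>L\<close>. By excision the part coming from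
    \<open>U\<close> must then be the very class that witnesses the index over \<open>U\<close>. The
    disjunction in the hypothesis treats both pieces at once.\<close>
  have piece: "?F (?into U L a)
       = ?u r c k"
    if U: "U = A \<and> V = B \<and> L = KA \<and> M = KB \<or> U = B \<and> V = A \<and> L = KB \<and> M = KA" "has_index y f U k"
      and r: "G \<union> {y} \<subseteq> ball 0 r" and c: "c \<in> carrier (?H (- cball 0 r))"
      and a: "a \<in> carrier (rel_homology n (top_of_set U) (U - L))"
      and b: "b \<in> carrier (rel_homology n (top_of_set V) (V - M))"
      and z: "push_hom n G (G - K) (- K) id
         (?into U L a \<otimes>\<^bsub>?HG\<^esub>
          ?into V M b) = ?c r (- K) c"
    for U V L M a b k r c
  proof -
    have L: "{x \<in> U. f x = y} = L" "L \<subseteq> U" "open U" "closed L" "U \<inter> V = {}" "G = U \<union> V" "K = L \<union> M" "M \<subseteq> V"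
      using U(1) A B closed KAB disj by (auto simp: KA_def KB_def G_def K_def)
    let ?g = "push_hom n G (G - K) (- L) id"
    interpret HL: group "?H (- L)" by simp
    have iU: "continuous_map (top_of_set U) (top_of_set G) id" "id \<in> U - L \<rightarrow> G - K"
      and iV: "continuous_map (top_of_set V) (top_of_set G) id" "id \<in> V - M \<rightarrow> G - K"
      using L by (auto simp: disjoint_iff)
    have "push_hom n U (U - L) (- L) id a = ?g (?into U L a)"
      by (subst hom_induced_compose' [OF iU]) (auto simp: L)
    also have "\<dots> = ?g (?into U L a) \<otimes>\<^bsub>?H (- L)\<^esub> ?g (?into V M b)"
    proof -
      have "?g (?into V M b) = push_hom n V (V - M) (- L) id b"
        by (subst hom_induced_compose' [OF iV]) (auto simp: L)
      also have "\<dots> = \<one>\<^bsub>?H (- L)\<^esub>" using L b by (intro hom_induced_into_subspace) auto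
      finally show ?thesis by (simp add: hom_induced_carrier)
    qed
    also have "\<dots> = ?g (?into U L a \<otimes>\<^bsub>?HG\<^esub> ?into V M b)"
      by (simp add: hom_induced_mult hom_induced_carrier)
    also have "\<dots> = restrict_hom n (- K) (- L)
        (push_hom n G (G - K) (- K) id (?into U L a \<otimes>\<^bsub>?HG\<^esub> ?into V M b))"
      using L by (subst hom_induced_compose') auto
    also have "\<dots> = ?c r (- L) c" unfolding z using r L by (subst hom_induced_restrict_compose) auto
    finally have aL: "push_hom n U (U - L) (- L) id a = ?c r (- L) c" .
    have rU: "U \<union> {y} \<subseteq> ball 0 r" using r L by auto
    then obtain a' where a': "a' \<in> carrier (rel_homology n (top_of_set U) (U - L))"
      "push_hom n U (U - L) (- L) id a' = ?c r (- L) c"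
      "push_hom n U (U - L) (- {y}) f a' = ?u r c k"
      using U(2) c unfolding has_index_def n_def [symmetric] L(1) by metis
    have "a' = a"
      using iso_relative_homology_excise_open [OF L(3,4,2)] aL a a'(1,2) iso_injD by metis
    moreover have "?F (?into U L a) = push_hom n U (U - L) (- {y}) f a"
      using f by (subst hom_induced_compose' [OF iU]) (auto simp: G_def K_eq [symmetric])
    ultimately show "?F (?into U L a) = ?u r c k" using a' by simp
  qed
  show ?thesis
    unfolding has_index_def n_def [symmetric] G_def [symmetric] K_eq
  proof (intro allI impI ballI)
    fix r c assume r: "G \<union> {y} \<subseteq> ball 0 r" and c: "c \<in> carrier (?H (- cball 0 r))"
    have excise: "push_hom n G (G - K) (- K) id \<in> iso ?HG (?H (- K))"
      using A B closed KAB by (intro iso_relative_homology_excise_open) (auto simp: G_def K_def)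
    obtain z where z: "z \<in> carrier ?HG"
      "push_hom n G (G - K) (- K) id z = ?c r (- K) c"
      by (rule iso_surjE [OF excise hom_induced_carrier])
    obtain a b where a: "a \<in> carrier (rel_homology n (top_of_set A) (A - KA))"
      and b: "b \<in> carrier (rel_homology n (top_of_set B) (B - KB))"
      and zab: "z = ?into A KA a
        \<otimes>\<^bsub>?HG\<^esub> ?into B KB b"
      using relative_homology_disjoint_Un [OF A(1) B(1) AB KAB] z(1) unfolding G_def K_def by metis
    interpret HG: comm_group ?HG by simp
    have "?F z = ?u r c d \<otimes>\<^bsub>?H (- {y})\<^esub> ?u r c e"
    proof -
      have "?F (?into A KA a)
          = ?u r c d"
        using piece [of A B KA KB d r c a b] A(3) r c a b z(2) zab by blast
      moreover have "?F (?into B KB b)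
          = ?u r c e"
        using piece [of B A KB KA e r c b a] B(3) r c a b z(2) zab
        by (metis HG.m_comm hom_induced_carrier)
      ultimately show ?thesis
        unfolding zab by (simp add: hom_induced_mult hom_induced_carrier)
    qed
    also have "\<dots> = ?u r c (d + e)" by (simp add: Hy.int_pow_mult hom_induced_carrier)
    finally show "\<exists>z\<in>carrier ?HG.
        push_hom n G (G - K) (- K) id z = ?c r (- K) c \<and>
        ?F z = ?u r c (d + e)"
      using z by blast
  qed
qed

text \<open>Take a closed ball about \<open>y\<close> that misses the image of the frontier, and let
  \<open>L\<close> be its preimage. One class over \<open>L\<close> determines the behaviour at all
  values in the ball. If \<open>f\<close> omitted a value \<open>w\<close> in it, the push-forward
  of this class would be trivial at \<open>w\<close>, hence modulo the complement of the whole ball,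
  hence at \<open>y\<close>, and the index would vanish.\<close>

lemma has_index_nonzero_imp_ball:
  fixes f :: "'a::euclidean_space \<Rightarrow> 'a"
  assumes G: "open G" "bounded G" and f: "continuous_on (closure G) f"
    and y: "y \<notin> f ` frontier G" and d: "has_index y f G d" "d \<noteq> 0"
  obtains e where "e > 0" "ball y e \<subseteq> f ` G"
proof -
  have cG: "compact (closure G)" "compact (frontier G)"
    using G by (auto simp: compact_frontier_bounded)
  have fG: "continuous_on G f" using f continuous_on_subset closure_subset by blast
  have "closed (f ` frontier G)" using f cG by (intro compact_imp_closed compact_continuous_image)
      (auto intro: continuous_on_subset simp: frontier_def)
  then obtain e where e: "e > 0" "cball y e \<inter> f ` frontier G = {}"
    using y by (metis open_Compl open_contains_cball Compl_iff disjoint_eq_subset_Compl)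
  define K where "K = {x \<in> G. f x = y}"
  define L where "L = {x \<in> G. f x \<in> cball y e}"
  \<comment> \<open>No frontier point is mapped into the ball, so \<open>L\<close> is closed in the
    whole space, as excision requires.\<close>
  have L_eq: "L = {x \<in> closure G. f x \<in> cball y e}"
    using e(2) closure_Un_frontier [of G] by (auto simp: L_def)
  have "closed L"
    unfolding L_eq by (rule continuous_closed_preimage [OF f, unfolded vimage_def Int_def mem_Collect_eq]) auto
  have "closed {x \<in> closure G. f x \<in> {y}}"
    by (rule continuous_closed_preimage [OF f, unfolded vimage_def Int_def mem_Collect_eq]) auto
  moreover have "K = {x \<in> closure G. f x \<in> {y}}"
    using y closure_Un_frontier [of G] by (auto simp: K_def)
  ultimately have "compact K"
    using cG by (metis compact_Int_closed inf.absorb2 mem_Collect_eq subsetI)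
  define n where "n = int DIM('a)"
  have KL: "K \<subseteq> L" "L \<subseteq> G" using e by (auto simp: K_def L_def)
  have "ball y e \<subseteq> f ` G"
  proof (rule ccontr)
    assume "\<not> ball y e \<subseteq> f ` G"
    then obtain w where w: "w \<in> ball y e" "w \<notin> f ` G" by blast
    have "has_index y f G 0"
      unfolding has_index_def n_def [symmetric] K_def [symmetric]
    proof (intro allI impI ballI)
      fix r c assume r: "G \<union> {y} \<subseteq> ball 0 r"
        and c: "c \<in> carrier (rel_homology n euclidean (- cball (0::'a) r))"
      obtain z where z: "z \<in> carrier (rel_homology n (top_of_set G) (G - L))"
        "push_hom n G (G - L) (- L) id z = restrict_hom n (- cball 0 r) (- L) c"
        by (rule iso_surjE [OF iso_relative_homology_excise_open [OF G(1) \<open>closed L\<close> KL(2)] hom_induced_carrier])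
      let ?z = "hom_induced n (top_of_set G) (G - L) (top_of_set G) (G - K) id z"
      have GG: "continuous_map (top_of_set G) (top_of_set G) id" "id \<in> G - L \<rightarrow> G - K"
        using KL by auto
      have "push_hom n G (G - K) (- K) id ?z = push_hom n G (G - L) (- K) id z"
        by (subst hom_induced_compose' [OF GG]) auto
      also have "\<dots> = restrict_hom n (- L) (- K)
          (restrict_hom n (- cball 0 r) (- L) c)"
        unfolding z(2) [symmetric] using KL by (subst hom_induced_compose') auto
      also have "\<dots> = restrict_hom n (- cball 0 r) (- K) c"
        using KL r by (intro hom_induced_restrict_compose) auto
      finally have 1: "push_hom n G (G - K) (- K) id ?z = restrict_hom n (- cball 0 r) (- K) c" .
      let ?v = "push_hom n G (G - L) (- cball y e) f z"
      have fL: "continuous_map (top_of_set G) euclidean f" "f \<in> G - L \<rightarrow> - cball y e"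
        using fG by (auto simp: L_def)
      have sub: "- cball y e \<subseteq> - {w}" "- cball y e \<subseteq> - {y}" using w e by auto
      have "restrict_hom n (- cball y e) (- {w}) ?v = push_hom n G (G - L) (- {w}) f z"
        using sub by (subst hom_induced_compose' [OF fL]) auto
      also have "\<dots> = \<one>\<^bsub>rel_homology n euclidean (- {w})\<^esub>"
        using fL w z by (intro hom_induced_into_subspace) auto
      also have "\<dots> = restrict_hom n (- cball y e) (- {w})
          \<one>\<^bsub>rel_homology n euclidean (- cball y e)\<^esub>"
        by (simp add: hom_induced_one)
      finally have v: "restrict_hom n (- cball y e) (- {w}) ?v = restrict_hom n (- cball y e) (- {w})
          \<one>\<^bsub>rel_homology n euclidean (- cball y e)\<^esub>" .
      interpret He: group "rel_homology n euclidean (- cball y e)" by simp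
      have "?v = \<one>\<^bsub>rel_homology n euclidean (- cball y e)\<^esub>"
        by (rule iso_injD [OF iso_relative_homology_cball_point v])
          (use w in \<open>simp_all add: hom_induced_carrier\<close>)
      moreover have "push_hom n G (G - K) (- {y}) f ?z = restrict_hom n (- cball y e) (- {y}) ?v"
        using fG fL sub by (subst hom_induced_compose' [OF GG], force, force simp: K_def,
            subst hom_induced_compose' [OF fL]) auto
      ultimately have 2: "push_hom n G (G - K) (- {y}) f ?z
          = \<one>\<^bsub>rel_homology n euclidean (- {y})\<^esub>"
        by (simp add: hom_induced_one)
      show "\<exists>z\<in>carrier (rel_homology n (top_of_set G) (G - K)). index_witness n y f G K 0 r c z"
        using 1 2 hom_induced_carrier by (intro bexI [of _ ?z]) (auto simp: int_pow_def2)
    qed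
    then show False
      using d has_index_ex1 [of G f y] G fG \<open>compact K\<close> unfolding K_def by metis
  qed
  then show ?thesis using that e by blast
qed

section \<open>Light sense-preserving mappings\<close>

lemma compact_fibre_interior:
  fixes f :: "'a::euclidean_space \<Rightarrow> 'b::t1_space"
  assumes f: "continuous_on D f" and G: "compact (closure G)" "closure G \<subseteq> D" and y: "y \<notin> f ` frontier G"
  shows "compact {x \<in> G. f x = y}"
proof -
  have "closed {x \<in> closure G. f x \<in> {y}}"
    by (rule continuous_closed_preimage [unfolded vimage_def Int_def mem_Collect_eq])
      (use f G continuous_on_subset in auto)
  then have "compact (closure G \<inter> {x \<in> closure G. f x = y})"
    using G by (intro compact_Int_closed) auto
  moreover have "closure G \<inter> {x \<in> closure G. f x = y} = {x \<in> G. f x = y}"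
    using y closure_Un_frontier [of G] by auto
  ultimately show ?thesis by simp
qed

text \<open>In a small closed ball the component of \<open>x\<close> in its fibre is a single point,
  so the theorem of Sura-Bura gives a compact relatively clopen piece \<open>K\<close> of the fibre
  inside the open ball. An open set around \<open>K\<close>, separated from the rest of the fibre
  and from the exterior of the ball, has no fibre point on its frontier.\<close>

lemma normal_neighbourhood_exists:
  fixes f :: "'a::euclidean_space \<Rightarrow> 'b::t1_space"
  assumes f: "continuous_on D f" and U: "open U" "U \<subseteq> D" "x \<in> U"
    and light: "\<And>C. connected C \<Longrightarrow> C \<subseteq> {z \<in> D. f z = f x} \<Longrightarrow> x \<in> C \<Longrightarrow> C = {x}"
  obtains V where "open V" "x \<in> V" "compact (closure V)" "closure V \<subseteq> U" "f x \<notin> f ` frontier V"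
proof -
  obtain r where r: "r > 0" "cball x r \<subseteq> U" using U open_contains_cball by blast
  define S where "S = {z \<in> cball x r. f z = f x}"
  have "closed {z \<in> cball x r. f z \<in> {f x}}"
    by (rule continuous_closed_preimage [unfolded vimage_def Int_def mem_Collect_eq])
      (use f U r continuous_on_subset in \<open>auto, blast\<close>)
  then have "closed S" by (simp add: S_def)
  moreover have "bounded S" by (rule bounded_subset [OF bounded_cball]) (auto simp: S_def)
  ultimately have S: "compact S" by (simp add: compact_eq_bounded_closed)
  have xS: "x \<in> S" using r by (simp add: S_def)
  have "connected_component_set S x = {x}"
  proof (rule light)
    show "connected_component_set S x \<subseteq> {z \<in> D. f z = f x}"
    proof -
      have "S \<subseteq> {z \<in> D. f z = f x}" using r U by (auto simp: S_def)
      then show ?thesis using connected_component_subset [of S x] by blast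
    qed
  qed (use xS in \<open>auto simp: connected_component_refl\<close>)
  then have "{x} \<in> components S" using xS by (metis componentsI)
  then obtain K where K: "openin (top_of_set S) K" "compact K" "x \<in> K" "K \<subseteq> ball x r"
    using Sura_Bura_clopen_subset [of S "{x}" "ball x r"] S r
    by (metis centre_in_ball closed_imp_locally_compact compact_imp_closed compact_sing insert_subset empty_subsetI open_ball)
  obtain T where T: "open T" "K = S \<inter> T" using K(1) by (auto simp: openin_open)
  have "closed ((S - T) \<union> - ball x r)" using \<open>closed S\<close> T by (intro closed_Un) auto
  moreover have "K \<inter> ((S - T) \<union> - ball x r) = {}" using T K by auto
  ultimately obtain V W where V: "open V" "compact (closure V)" "open W" "K \<subseteq> V"
    "(S - T) \<union> - ball x r \<subseteq> W" "V \<inter> W = {}"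
    using separation_normal_compact K(2) by metis
  have cV: "closure V \<inter> W = {}" using V open_Int_closure_eq_empty by blast
  show ?thesis
  proof
    show "closure V \<subseteq> U" using cV V r by force
    show "f x \<notin> f ` frontier V"
    proof
      assume "f x \<in> f ` frontier V"
      then obtain z where z: "z \<in> frontier V" "f z = f x" by auto
      then have zc: "z \<in> closure V" by (simp add: frontier_def)
      then have "z \<in> S" using cV V z by (auto simp: S_def dest!: subsetD)
      then have "z \<in> K" using zc cV V T by auto
      then show False
        using V z by (auto simp: frontier_def interior_open)
    qed
  qed (use V K in auto)
qed

lemma has_index_Union:
  fixes f :: "'a::euclidean_space \<Rightarrow> 'a"
  assumes "finite \<C>" "pairwise disjnt \<C>" "continuous_on (\<Union>\<C>) f"
    and "\<And>C. C \<in> \<C> \<Longrightarrow> open C" "\<And>C. C \<in> \<C> \<Longrightarrow> compact {x \<in> C. f x = y}"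
    and "\<And>C. C \<in> \<C> \<Longrightarrow> has_index y f C (d C)"
  shows "has_index y f (\<Union>\<C>) (\<Sum>C\<in>\<C>. d C) \<and> compact {x \<in> \<Union>\<C>. f x = y}"
  using assms
proof (induction \<C> rule: finite_induct)
  case empty
  have "has_index y f {} 0" by (rule has_index_empty_fibre) simp
  then show ?case by simp
next
  case (insert C \<C>)
  have IH: "has_index y f (\<Union>\<C>) (\<Sum>C\<in>\<C>. d C)" "compact {x \<in> \<Union>\<C>. f x = y}"
    using insert by (auto simp: pairwise_insert intro: continuous_on_subset)
  have "disjnt C (\<Union>\<C>)" using insert by (auto simp: pairwise_insert disjnt_def)
  then have "has_index y f (C \<union> \<Union>\<C>) (d C + (\<Sum>C\<in>\<C>. d C))"
    using insert IH by (intro has_index_disjoint_Un) auto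
  moreover have "{x \<in> \<Union>(insert C \<C>). f x = y} = {x \<in> C. f x = y} \<union> {x \<in> \<Union>\<C>. f x = y}" by auto
  ultimately show ?case
    using insert IH by (simp add: compact_Un)
qed

text \<open>The definition of a sense-preserving map speaks of domains, while a normal neighbourhood
  may be disconnected. By compactness only finitely many components of \<open>V\<close> meet the
  fibre. Their frontiers lie in that of \<open>V\<close>, each has index at least 1, and by
  additivity the total is at least their number.\<close>

lemma sense_preserving_has_index:
  fixes f :: "'a::euclidean_space \<Rightarrow> 'a"
  assumes sp: "sense_preserving D f" and V: "open V" "compact (closure V)" "closure V \<subseteq> D"
    and y: "y \<notin> f ` frontier V"
  obtains d where "has_index y f V d" "d \<ge> 0" "y \<in> f ` V \<Longrightarrow> d \<ge> 1"
proof -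
  have f: "continuous_on D f" using sp by (simp add: sense_preserving_def)
  define K where "K = {x \<in> V. f x = y}"
  have K: "compact K" unfolding K_def by (rule compact_fibre_interior [OF f V(2,3) y])
  define \<C> where "\<C> = {C \<in> components V. C \<inter> K \<noteq> {}}"
  have comp: "open C" "connected C" "C \<noteq> {}" "C \<subseteq> V" if "C \<in> components V" for C
    using that V in_components_connected in_components_nonempty in_components_subset open_components
    by blast+
  have disj: "pairwise disjnt \<C>"
    using pairwise_disjoint_components [of V] by (simp add: \<C>_def pairwise_def disjnt_def)
  have cover: "K \<subseteq> \<Union>\<C>"
  proof
    fix x assume x: "x \<in> K"
    then have "x \<in> \<Union>(components V)" by (simp add: K_def)
    then obtain C where "C \<in> components V" "x \<in> C" ..
    then show "x \<in> \<Union>\<C>" using x by (auto simp: \<C>_def)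
  qed
  have fin: "finite \<C>"
  proof -
    have op: "open C" if "C \<in> \<C>" for C
      using that comp by (simp add: \<C>_def)
    obtain \<D> where \<D>: "\<D> \<subseteq> \<C>" "finite \<D>" "K \<subseteq> \<Union>\<D>" by (rule compactE [OF K cover op])
    have "\<C> \<subseteq> \<D>"
    proof
      fix C assume C: "C \<in> \<C>"
      then obtain x where x: "x \<in> C" "x \<in> K" by (auto simp: \<C>_def)
      then obtain C' where "C' \<in> \<D>" "x \<in> C'" using \<D> by blast
      then show "C \<in> \<D>" using C x disj \<D> by (metis disjnt_iff pairwiseD subsetD)
    qed
    then show ?thesis using \<D> finite_subset by blast
  qed
  have ind: "compact {x \<in> C. f x = y}" "has_index y f C (topological_index y f C)"
    "topological_index y f C \<ge> 1" if C: "C \<in> \<C>" for C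
  proof -
    have C': "C \<in> components V" "C \<inter> K \<noteq> {}" using C by (auto simp: \<C>_def)
    note cC = comp [OF C'(1)]
    have cl: "closure C \<subseteq> closure V" using cC by (simp add: closure_mono)
    then have cc: "compact (closure C)" "closure C \<subseteq> D"
      using V cC(4) bounded_subset by (auto simp: compact_closure)
    have fr: "frontier C \<subseteq> frontier V"
    proof -
      obtain a where "C = connected_component_set V a" using C'(1) by (auto simp: components_def)
      then show ?thesis by (simp add: frontier_of_connected_component_subset)
    qed
    then have yC: "y \<notin> f ` frontier C" using y by auto
    show cf: "compact {x \<in> C. f x = y}" by (rule compact_fibre_interior [OF f cc yC])
    have "continuous_on C f"
      using cc closure_subset [of C] by (intro continuous_on_subset [OF f]) blast
    moreover have "bounded C" using cc compact_closure by blast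
    ultimately have "\<exists>!d. has_index y f C d" using cC cf by (intro has_index_ex1) auto
    then show "has_index y f C (topological_index y f C)"
      unfolding topological_index_has_index by (rule theI')
    have "y \<in> f ` C - f ` frontier C" using C'(2) yC by (auto simp: K_def)
    then have "topological_index y f C > 0"
      using sp cC cc unfolding sense_preserving_def is_domain_def by blast
    then show "topological_index y f C \<ge> 1" by simp
  qed
  define d where "d = (\<Sum>C\<in>\<C>. topological_index y f C)"
  have subV: "\<Union>\<C> \<subseteq> V" using comp(4) unfolding \<C>_def by blast
  have fV: "continuous_on V f"
    using V closure_subset [of V] by (intro continuous_on_subset [OF f]) blast
  have "has_index y f (\<Union>\<C>) d"
    unfolding d_def using fin disj ind comp subV fV
    by (intro conjunct1 [OF has_index_Union]) (auto simp: \<C>_def intro: continuous_on_subset)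
  then have "has_index y f V d"
    using subV cover fV unfolding K_def by (rule has_index_superset [of y f "\<Union>\<C>"])
  moreover have "d \<ge> of_nat (card \<C>)"
    unfolding d_def using sum_bounded_below [of \<C> 1 "topological_index y f"] ind by simp
  moreover have "card \<C> \<ge> 1" if "y \<in> f ` V"
  proof -
    have "\<C> \<noteq> {}" using that cover by (auto simp: K_def)
    then show ?thesis using fin by (simp add: Suc_leI card_gt_0_iff)
  qed
  ultimately show ?thesis
    using that [of d] by force
qed

theorem light_sense_preserving_discrete_open:
  fixes f :: "'a::euclidean_space \<Rightarrow> 'a"
  assumes D: "open D" and sp: "sense_preserving D f"
    and light: "\<And>C x. connected C \<Longrightarrow> C \<subseteq> {z \<in> D. f z = f x} \<Longrightarrow> x \<in> C \<Longrightarrow> C = {x}"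
  shows "discrete_map D f \<and> open_map (top_of_set D) euclidean f"
proof
  have f: "continuous_on D f" using sp by (simp add: sense_preserving_def)
  show "open_map (top_of_set D) euclidean f"
    unfolding open_map_def
  proof (intro allI impI)
    fix U assume "openin (top_of_set D) U"
    then have U: "open U" "U \<subseteq> D" using D by (auto simp: openin_open_eq)
    have "\<exists>e>0. ball y e \<subseteq> f ` U" if y: "y \<in> f ` U" for y
    proof -
      obtain x where x: "x \<in> U" "y = f x" using y by auto
      obtain V where V: "open V" "x \<in> V" "compact (closure V)" "closure V \<subseteq> U" "f x \<notin> f ` frontier V"
        using normal_neighbourhood_exists [OF f U x(1)] light by metis
      have VD: "closure V \<subseteq> D" using V U by auto
      obtain d where d: "has_index (f x) f V d" "f x \<in> f ` V \<Longrightarrow> d \<ge> 1"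
        using sense_preserving_has_index [OF sp V(1,3) VD V(5)] by metis
      obtain e where "e > 0" "ball (f x) e \<subseteq> f ` V"
        using has_index_nonzero_imp_ball [OF V(1) _ _ V(5) d(1)] d V f VD compact_closure
        by (metis continuous_on_subset imageI not_one_le_zero)
      then show ?thesis using V(4) closure_subset x(2) by blast
    qed
    then show "openin euclidean (f ` U)" by (simp add: open_contains_ball)
  qed
  show "discrete_map D f"
    unfolding discrete_map_def
  proof (intro allI discreteI)
    fix y x assume "x \<in> {x \<in> D. f x = y}"
    then have x: "x \<in> D" "y = f x" by auto
    define P where "P = (\<lambda>V d. open V \<and> x \<in> V \<and> compact (closure V) \<and> closure V \<subseteq> D \<and>
      f x \<notin> f ` frontier V \<and> has_index (f x) f V (int d))"
    have ex: "\<exists>V d. P V d \<and> closure V \<subseteq> U" if U: "open U" "U \<subseteq> D" "x \<in> U" for U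
    proof -
      obtain V where V: "open V" "x \<in> V" "compact (closure V)" "closure V \<subseteq> U" "f x \<notin> f ` frontier V"
        using normal_neighbourhood_exists [OF f U] light by metis
      have VD: "closure V \<subseteq> D" using V U by auto
      obtain d where d: "has_index (f x) f V d" "d \<ge> 0"
        using sense_preserving_has_index [OF sp V(1,3) VD V(5)] by metis
      have "P V (nat d)" using V VD d by (simp add: P_def)
      then show ?thesis using V by blast
    qed
    \<comment> \<open>Indices of normal neighbourhoods are nonnegative integers, so one of them is
      least. A second fibre point \<open>z\<close> would use up index at least 1 outside a smaller
      normal neighbourhood of \<open>x\<close>, whose index would then be below the minimum.\<close>
    define m where "m = (LEAST d. \<exists>V. P V d)"
    have "\<exists>d V. P V d" using ex [OF D subset_refl x(1)] by blast
    then have "\<exists>V. P V m" unfolding m_def by (rule LeastI_ex)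
    then obtain V where V: "P V m" ..
    have min: "m \<le> d" if "P W d" for W d
      unfolding m_def using that by (blast intro: Least_le)
    have VV: "open V" "x \<in> V" "compact (closure V)" "closure V \<subseteq> D" "f x \<notin> f ` frontier V"
      "has_index (f x) f V (int m)"
      using V by (auto simp: P_def)
    have "V \<inter> {x \<in> D. f x = y} = {x}"
    proof (rule ccontr)
      assume "V \<inter> {x \<in> D. f x = y} \<noteq> {x}"
      then obtain z where z: "z \<in> V" "f z = f x" "z \<noteq> x" using VV x by auto
      have "open (V - {z})" "V - {z} \<subseteq> D" "x \<in> V - {z}" using VV z closure_subset by auto
      from ex [OF this] obtain W k where W: "P W k" "closure W \<subseteq> V - {z}"
        by blast
      have WW: "open W" "x \<in> W" "compact (closure W)" "f x \<notin> f ` frontier W" "has_index (f x) f W (int k)"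
        using W by (auto simp: P_def)
      \<comment> \<open>The frontier of this remainder is contained in the two given frontiers and
        therefore misses the fibre, so \<open>R\<close> has an index too, and the index is at least
        1 because of \<open>z\<close>.\<close>
      define R where "R = V - closure W"
      have R: "open R" "z \<in> R" "R \<subseteq> V" using VV W z by (auto simp: R_def)
      have clR: "closure R \<subseteq> closure V" using R by (simp add: closure_mono)
      have "frontier R \<subseteq> frontier V \<union> frontier W"
      proof
        fix a assume a: "a \<in> frontier R"
        then have a': "a \<in> closure R" "a \<notin> R" using R by (auto simp: frontier_def interior_open)
        have "W \<inter> R = {}" using closure_subset by (auto simp: R_def)
        then have "W \<inter> closure R = {}" using WW by (simp add: open_Int_closure_eq_empty)
        then have "a \<notin> W" using a' by blast
        then show "a \<in> frontier V \<union> frontier W"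
          using a' clR VV WW by (auto simp: R_def frontier_def interior_open)
      qed
      then have yR: "f x \<notin> f ` frontier R" using VV WW by blast
      have cR: "compact (closure R)" "closure R \<subseteq> D"
        using VV clR R(3) bounded_subset by (auto simp: compact_closure)
      obtain e where e: "has_index (f x) f R e" "f x \<in> f ` R \<Longrightarrow> e \<ge> 1"
        using sense_preserving_has_index [OF sp R(1) cR yR] by metis
      have WD: "closure W \<subseteq> D" using W VV closure_subset [of V] by blast
      have fV: "continuous_on V f"
        using VV closure_subset [of V] by (intro continuous_on_subset [OF f]) blast
      have WR: "W \<union> R \<subseteq> V" using R W closure_subset [of W] by blast
      have "has_index (f x) f (W \<union> R) (int k + e)"
      proof (rule has_index_disjoint_Un)
        show "compact {u \<in> W. f u = f x}" "compact {u \<in> R. f u = f x}"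
          using compact_fibre_interior [OF f] WW WD cR yR by auto
        show "disjnt W R" using closure_subset by (auto simp: R_def disjnt_def)
        show "continuous_on (W \<union> R) f" by (rule continuous_on_subset [OF fV WR])
      qed (use WW R e in auto)
      moreover have "{u \<in> V. f u = f x} \<subseteq> W \<union> R"
      proof
        fix u assume u: "u \<in> {u \<in> V. f u = f x}"
        then have "u \<notin> frontier W" using WW by (metis (mono_tags) imageI mem_Collect_eq)
        then show "u \<in> W \<union> R" using u WW by (auto simp: R_def frontier_def interior_open)
      qed
      ultimately have "has_index (f x) f V (int k + e)"
        using has_index_superset [of "f x" f "W \<union> R" "int k + e" V] WR fV by blast
      moreover have "\<exists>!d. has_index (f x) f V d"
        using VV fV compact_fibre_interior [OF f VV(3-5)] compact_closure
        by (intro has_index_ex1) auto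
      ultimately have "int m = int k + e" using VV by blast
      moreover have "e \<ge> 1" using e z R by (metis imageI)
      ultimately show False
        using min [OF W(1)] by simp
    qed
    then show "x isolated_in {x \<in> D. f x = y}" using VV x by (intro isolated_inI) auto
  qed
qed

section \<open>Modulus of paths leaving a connected set\<close>

lemma nn_integral_lborel_swap:
  fixes f :: "'a::euclidean_space \<Rightarrow> 'b::euclidean_space \<Rightarrow> ennreal"
  assumes "(\<lambda>(x, y). f x y) \<in> borel_measurable (borel \<Otimes>\<^sub>M borel)"
  shows "(\<integral>\<^sup>+ y. \<integral>\<^sup>+ x. f x y \<partial>lborel \<partial>lborel) = (\<integral>\<^sup>+ x. \<integral>\<^sup>+ y. f x y \<partial>lborel \<partial>lborel)"
proof -
  have "(\<lambda>(x, y). f x y) \<in> borel_measurable (lborel \<Otimes>\<^sub>M lborel)"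
    using assms by (simp cong: measurable_cong_sets)
  then show ?thesis by (rule lborel_pair.Fubini')
qed

lemma nn_integral_set_swap:
  fixes F :: "'a::euclidean_space \<Rightarrow> 'b::euclidean_space \<Rightarrow> ennreal"
  assumes [measurable]: "(\<lambda>(s, v). F s v) \<in> borel_measurable (borel \<Otimes>\<^sub>M borel)"
    "S \<in> sets borel" "W \<in> sets borel"
  shows "(\<integral>\<^sup>+ v. indicator W v * (\<integral>\<^sup>+ s \<in> S. F s v \<partial>lborel) \<partial>lborel)
       = (\<integral>\<^sup>+ s \<in> S. (\<integral>\<^sup>+ v. indicator W v * F s v \<partial>lborel) \<partial>lborel)"
proof -
  have "(\<integral>\<^sup>+ v. indicator W v * (\<integral>\<^sup>+ s \<in> S. F s v \<partial>lborel) \<partial>lborel)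
      = (\<integral>\<^sup>+ v. \<integral>\<^sup>+ s. (indicator W v * F s v) * indicator S s \<partial>lborel \<partial>lborel)"
    by (simp add: nn_integral_cmult mult.assoc)
  also have "\<dots> = (\<integral>\<^sup>+ s. \<integral>\<^sup>+ v. (indicator W v * F s v) * indicator S s \<partial>lborel \<partial>lborel)"
    by (rule nn_integral_lborel_swap) measurable
  finally show ?thesis by (simp add: nn_integral_multc)
qed

lemma nn_integral_lborel_translate:
  fixes f :: "'a::euclidean_space \<Rightarrow> ennreal"
  assumes [measurable]: "f \<in> borel_measurable borel"
  shows "(\<integral>\<^sup>+ x. f (a + x) \<partial>lborel) = (\<integral>\<^sup>+ x. f x \<partial>lborel)"
proof -
  have "(\<integral>\<^sup>+ x. f x \<partial>lborel) = (\<integral>\<^sup>+ x. f x \<partial>distr lborel borel ((+) a))"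
    by (simp add: lborel_distr_plus)
  also have "\<dots> = (\<integral>\<^sup>+ x. f (a + x) \<partial>lborel)" by (rule nn_integral_distr) auto
  finally show ?thesis ..
qed

lemma borel_measurable_enn_powr [measurable]:
  assumes [measurable]: "f \<in> borel_measurable M"
  shows "(\<lambda>x. enn_powr (f x) p) \<in> borel_measurable M"
  unfolding enn_powr_def by measurable

text \<open>Used with \<open>k\<close> depending on the position along a segment, in place of Hoelder's inequality.\<close>

lemma le_const_plus_enn_powr:
  assumes k: "k > 0" and p: "p \<ge> 1"
  shows "x \<le> ennreal k + ennreal (k powr (1 - p)) * enn_powr x p"
proof (cases x)
  case (real r)
  have "r \<le> k + k powr (1 - p) * r powr p"
  proof (cases "r \<le> k")
    case True
    then show ?thesis using real k by (simp add: add_increasing2)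
  next
    case False
    have "r = r powr p * r powr (1 - p)" using False k by (simp add: powr_add [symmetric])
    also have "\<dots> \<le> r powr p * k powr (1 - p)"
      using False k p by (intro mult_left_mono powr_mono2') auto
    finally show ?thesis using k by (simp add: mult.commute)
  qed
  then have "ennreal r \<le> ennreal (k + k powr (1 - p) * r powr p)"
    using k real by (intro ennreal_leI) auto
  then show ?thesis using real k by (simp add: enn_powr_def ennreal_mult ennreal_plus)
next
  case top
  then show ?thesis using k by (simp add: enn_powr_def ennreal_mult_top)
qed

text \<open>Integration over a hyperplane orthogonal to a basis vector \<open>i\<close> is expressed as integration over
  the slab \<open>0 \<le> v \<bullet> i < 1\<close> of a function of the projection, which avoids splitting the space.\<close>

definition hyperplane_proj :: "'a::euclidean_space \<Rightarrow> 'a \<Rightarrow> 'a" where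
  "hyperplane_proj i v = v - (v \<bullet> i) *\<^sub>R i"

definition slab :: "'a::euclidean_space \<Rightarrow> 'a set" where
  "slab i = {v. 0 \<le> v \<bullet> i \<and> v \<bullet> i < 1}"

definition slice :: "'a::euclidean_space \<Rightarrow> ('a \<Rightarrow> ennreal) \<Rightarrow> real \<Rightarrow> ennreal" where
  "slice i h t = (\<integral>\<^sup>+ v. indicator (slab i) v * h (hyperplane_proj i v + t *\<^sub>R i) \<partial>lborel)"

lemma measurable_hyperplane_proj [measurable]: "hyperplane_proj i \<in> borel_measurable borel"
  unfolding hyperplane_proj_def by measurable

lemma sets_slab [measurable]: "slab i \<in> sets borel"
  unfolding slab_def by measurable

lemma borel_measurable_slice [measurable]:
  assumes [measurable]: "h \<in> borel_measurable borel"
  shows "slice i h \<in> borel_measurable borel"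
proof -
  have "(\<lambda>(t, v). indicator (slab i) v * h (hyperplane_proj i v + t *\<^sub>R i))
      \<in> borel_measurable (borel \<Otimes>\<^sub>M lborel)"
    by measurable
  then have "(\<lambda>t. \<integral>\<^sup>+ v. indicator (slab i) v * h (hyperplane_proj i v + t *\<^sub>R i) \<partial>lborel)
      \<in> borel_measurable borel"
    by (rule lborel.borel_measurable_nn_integral)
  then show ?thesis by (simp add: slice_def [abs_def])
qed

text \<open>Shifting \<open>t\<close> by \<open>v \<bullet> i\<close> turns the projection of
  \<open>v\<close> into \<open>v\<close> itself, and then \<open>x = v + t *\<^sub>R i\<close> is
  taken as the new variable. A point \<open>x\<close> is counted for those \<open>t\<close> that put
  \<open>x - t *\<^sub>R i\<close> into the slab; they form an interval of length 1, because the
  slab has thickness 1.\<close>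

lemma nn_integral_slice:
  fixes h :: "'a::euclidean_space \<Rightarrow> ennreal"
  assumes [measurable]: "h \<in> borel_measurable borel" and i: "i \<in> Basis"
  shows "(\<integral>\<^sup>+ t. slice i h t \<partial>lborel) = (\<integral>\<^sup>+ x. h x \<partial>lborel)"
proof -
  let ?f = "\<lambda>v t. indicator (slab i) v * h (hyperplane_proj i v + t *\<^sub>R i)"
  let ?g = "\<lambda>v t. indicator (slab i) v * h (v + t *\<^sub>R i)"
  let ?k = "\<lambda>x t. indicator (slab i) (x - t *\<^sub>R i) * h x"
  have "(\<integral>\<^sup>+ t. slice i h t \<partial>lborel)
      = (\<integral>\<^sup>+ v. \<integral>\<^sup>+ t. ?f v t \<partial>lborel \<partial>lborel)"
    unfolding slice_def by (rule nn_integral_lborel_swap) measurable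
  also have "\<dots> = (\<integral>\<^sup>+ v. \<integral>\<^sup>+ t. ?g v t \<partial>lborel \<partial>lborel)"
  proof (rule nn_integral_cong)
    fix v :: 'a
    have "(\<integral>\<^sup>+ t. ?f v t \<partial>lborel)
        = (\<integral>\<^sup>+ t. indicator (slab i) v * h (hyperplane_proj i v + (v \<bullet> i + t) *\<^sub>R i) \<partial>lborel)"
      by (rule nn_integral_lborel_translate [symmetric]) measurable
    then show "(\<integral>\<^sup>+ t. ?f v t \<partial>lborel)
        = (\<integral>\<^sup>+ t. ?g v t \<partial>lborel)"
      by (simp add: hyperplane_proj_def algebra_simps)
  qed
  also have "\<dots> = (\<integral>\<^sup>+ t. \<integral>\<^sup>+ v. ?g v t \<partial>lborel \<partial>lborel)"
    by (rule nn_integral_lborel_swap) measurable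
  also have "\<dots> = (\<integral>\<^sup>+ t. \<integral>\<^sup>+ x. ?k x t \<partial>lborel \<partial>lborel)"
  proof (rule nn_integral_cong)
    fix t :: real
    have "(\<integral>\<^sup>+ x. indicator (slab i) (t *\<^sub>R i + x - t *\<^sub>R i) * h (t *\<^sub>R i + x) \<partial>lborel)
        = (\<integral>\<^sup>+ x. ?k x t \<partial>lborel)"
      by (rule nn_integral_lborel_translate) measurable
    then show "(\<integral>\<^sup>+ v. ?g v t \<partial>lborel)
        = (\<integral>\<^sup>+ x. ?k x t \<partial>lborel)"
      by (simp add: add.commute)
  qed
  also have "\<dots> = (\<integral>\<^sup>+ x. \<integral>\<^sup>+ t. ?k x t \<partial>lborel \<partial>lborel)"
    by (rule nn_integral_lborel_swap [symmetric]) measurable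
  also have "\<dots> = (\<integral>\<^sup>+ x. h x \<partial>lborel)"
  proof (rule nn_integral_cong)
    fix x :: 'a
    have "(\<integral>\<^sup>+ t. ?k x t \<partial>lborel)
        = (\<integral>\<^sup>+ t. h x * indicator {x \<bullet> i - 1<..x \<bullet> i} t \<partial>lborel)"
      using i by (intro nn_integral_cong)
        (auto simp: slab_def indicator_def inner_diff_left inner_Basis)
    also have "\<dots> = h x" by (simp add: nn_integral_cmult)
    finally show "(\<integral>\<^sup>+ t. ?k x t \<partial>lborel) = h x" .
  qed
  finally show ?thesis .
qed

lemma slice_at_point:
  fixes h :: "'a::euclidean_space \<Rightarrow> ennreal"
  assumes [measurable]: "h \<in> borel_measurable borel" and i: "i \<in> Basis"
  shows "(\<integral>\<^sup>+ v. indicator (slab i) v * h (c + hyperplane_proj i v) \<partial>lborel) = slice i h (c \<bullet> i)"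
proof -
  define b where "b = hyperplane_proj i c"
  have "slice i h (c \<bullet> i)
      = (\<integral>\<^sup>+ v. indicator (slab i) (b + v) * h (hyperplane_proj i (b + v) + (c \<bullet> i) *\<^sub>R i) \<partial>lborel)"
    unfolding slice_def by (rule nn_integral_lborel_translate [symmetric]) measurable
  also have "\<dots> = (\<integral>\<^sup>+ v. indicator (slab i) v * h (c + hyperplane_proj i v) \<partial>lborel)"
  proof (rule nn_integral_cong)
    fix v
    have "b \<bullet> i = 0" using i by (simp add: b_def hyperplane_proj_def inner_diff_left)
    then have "indicator (slab i) (b + v) = (indicator (slab i) v :: ennreal)"
      by (simp add: slab_def indicator_def inner_add_left)
    moreover have "hyperplane_proj i (b + v) + (c \<bullet> i) *\<^sub>R i = c + hyperplane_proj i v"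
      using \<open>b \<bullet> i = 0\<close> by (simp add: hyperplane_proj_def inner_add_left b_def)
    ultimately show "indicator (slab i) (b + v) * h (hyperplane_proj i (b + v) + (c \<bullet> i) *\<^sub>R i)
        = indicator (slab i) v * h (c + hyperplane_proj i v)"
      by simp
  qed
  finally show ?thesis ..
qed

text \<open>\<open>T\<close> is the homothety of factor \<open>s\<close> in the directions
  orthogonal to \<open>i\<close> and the identity along \<open>i\<close>. It therefore preserves the
  slab and has Jacobian \<open>s ^ (DIM('a) - 1)\<close>.\<close>

lemma slice_scale:
  fixes h :: "'a::euclidean_space \<Rightarrow> ennreal"
  assumes [measurable]: "h \<in> borel_measurable borel" and i: "i \<in> Basis" and s: "s > 0"
  shows "ennreal (s ^ (DIM('a) - 1)) *
      (\<integral>\<^sup>+ v. indicator (slab i) v * h (c + s *\<^sub>R hyperplane_proj i v) \<partial>lborel) = slice i h (c \<bullet> i)"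
proof -
  define k where "k = (\<lambda>j. if j = i then 1 else s)"
  define T where "T = (\<lambda>v::'a. 0 + (\<Sum>j\<in>Basis. (k j * (v \<bullet> j)) *\<^sub>R j))"
  have [measurable]: "T \<in> borel_measurable borel" unfolding T_def by measurable
  have Ti: "T v \<bullet> i = v \<bullet> i" for v
    using i by (simp add: T_def inner_sum_left inner_Basis k_def if_distrib cong: if_cong)
  have "T v = (v \<bullet> i) *\<^sub>R i + s *\<^sub>R hyperplane_proj i v" for v
  proof (rule euclidean_eqI)
    fix j :: 'a assume j: "j \<in> Basis"
    then have "T v \<bullet> j = k j * (v \<bullet> j)"
      by (simp add: T_def inner_sum_left inner_Basis if_distrib cong: if_cong)
    moreover have "hyperplane_proj i v \<bullet> j = (if j = i then 0 else v \<bullet> j)"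
      using i j by (simp add: hyperplane_proj_def inner_diff_left inner_Basis)
    ultimately show "T v \<bullet> j = ((v \<bullet> i) *\<^sub>R i + s *\<^sub>R hyperplane_proj i v) \<bullet> j"
      using i j by (simp add: k_def inner_add_left inner_Basis)
  qed
  then have PT: "hyperplane_proj i (T v) = s *\<^sub>R hyperplane_proj i v" for v
    unfolding hyperplane_proj_def [of i "T v"] Ti by simp
  have "(\<Prod>j\<in>Basis. \<bar>k j\<bar>) = \<bar>k i\<bar> * (\<Prod>j\<in>Basis - {i}. \<bar>k j\<bar>)" using i by (simp add: prod.remove)
  also have "\<dots> = s ^ (DIM('a) - 1)"
  proof -
    have "(\<Prod>j\<in>Basis - {i}. \<bar>k j\<bar>) = (\<Prod>j\<in>Basis - {i}. s)"
      using s by (intro prod.cong) (auto simp: k_def)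
    then show ?thesis using i by (simp add: k_def)
  qed
  finally have det: "(\<Prod>j\<in>Basis. \<bar>k j\<bar>) = s ^ (DIM('a) - 1)" .
  have leb: "lborel = density (distr lborel borel T) (\<lambda>_. ennreal (s ^ (DIM('a) - 1)))"
    using lborel_affine_euclidean [of k 0] s unfolding T_def det by (simp add: k_def)
  have "slice i h (c \<bullet> i) = (\<integral>\<^sup>+ v. indicator (slab i) v * h (c + hyperplane_proj i v) \<partial>lborel)"
    using i by (simp add: slice_at_point)
  also have "\<dots> = ennreal (s ^ (DIM('a) - 1)) *
      (\<integral>\<^sup>+ v. indicator (slab i) (T v) * h (c + hyperplane_proj i (T v)) \<partial>lborel)"
    by (subst leb) (simp add: nn_integral_density nn_integral_distr nn_integral_cmult)
  also have "\<dots> = ennreal (s ^ (DIM('a) - 1)) *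
      (\<integral>\<^sup>+ v. indicator (slab i) v * h (c + s *\<^sub>R hyperplane_proj i v) \<partial>lborel)"
    by (simp add: PT) (simp add: slab_def indicator_def Ti)
  finally show ?thesis ..
qed

lemma nn_integral_powr_0_1:
  assumes "a > -1"
  shows "(\<integral>\<^sup>+ s \<in> {0<..1}. ennreal (s powr a) \<partial>lborel) = ennreal (1 / (a + 1))"
proof -
  have "(\<integral>\<^sup>+ s. ennreal (indicator {0..1} s * s powr a) \<partial>lborel) = ennreal (1 / (a + 1))"
    using has_integral_powr_from_0 [OF assms, of 1] by (intro nn_integral_has_integral_lebesgue) auto
  moreover have "(\<integral>\<^sup>+ s \<in> {0<..1}. ennreal (s powr a) \<partial>lborel)
      = (\<integral>\<^sup>+ s. ennreal (indicator {0..1} s * s powr a) \<partial>lborel)"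
    by (intro nn_integral_cong) (auto simp: indicator_def)
  ultimately show ?thesis by simp
qed

section \<open>Lower bound for a family of broken lines\<close>

text \<open>The line integral over the polygon with vertices \<open>c\<close>, \<open>c + v\<close>,
  \<open>c + v + u\<close>, each leg parametrised over a unit interval. The parameter 0 is left out
  because scaling by it degenerates.\<close>

definition broken_line_integral :: "('a::euclidean_space \<Rightarrow> ennreal) \<Rightarrow> 'a \<Rightarrow> 'a \<Rightarrow> 'a \<Rightarrow> ennreal" where
  "broken_line_integral \<rho> c v u =
     ennreal (norm v) * (\<integral>\<^sup>+ s \<in> {0<..1}. \<rho> (c + s *\<^sub>R v) \<partial>lborel) +
     ennreal (norm u) * (\<integral>\<^sup>+ s \<in> {0<..1}. \<rho> (c + v + s *\<^sub>R u) \<partial>lborel)"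

text \<open>The inequality \<open>line\<close> is integrated over \<open>v\<close> in
  \<open>W\<close>, with \<open>\<rho>\<close> bounded by a constant plus a multiple of its p-th
  power. On the first leg the constant is \<open>k * s powr (- \<beta>)\<close>; after scaling the
  hyperplane by \<open>s\<close>, the two terms carry \<open>s powr (- \<beta>)\<close> and the
  power of \<open>s\<close> with exponent \<beta> (p - 1) - (n - 1), n being the dimension. The
  assumptions on \<open>\<beta>\<close> say that both are integrable at 0. On the second leg nothing
  is scaled and the constant \<open>k\<close> suffices. The parameter \<open>k\<close> remains free,
  so that the term with the measure of \<open>W\<close> can later be absorbed on the left.\<close>

lemma broken_line_slice_bound:
  fixes \<rho> :: "'a::euclidean_space \<Rightarrow> ennreal"
  assumes \<rho> [measurable]: "\<rho> \<in> borel_measurable borel" and i: "i \<in> Basis"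
    and W [measurable]: "W \<in> sets borel" and Wsub: "W \<subseteq> slab i"
      "\<And>v. v \<in> W \<Longrightarrow> norm (hyperplane_proj i v) \<le> \<delta>"
    and \<delta>: "\<delta> > 0" and p: "p \<ge> 1" and k: "k > 0"
    and \<beta>: "\<beta> < 1" "\<beta> * (p - 1) > real DIM('a) - 2"
    and line: "\<And>v. v \<in> W \<Longrightarrow> 1 \<le> broken_line_integral \<rho> c (hyperplane_proj i v) u"
  defines "h \<equiv> slice i (\<lambda>x. enn_powr (\<rho> x) p)"
  shows "emeasure lborel W \<le> ennreal (k * (\<delta> / (1 - \<beta>) + norm u)) * emeasure lborel W +
     ennreal (k powr (1 - p)) * (ennreal (\<delta> / (\<beta> * (p - 1) - (real DIM('a) - 2))) * h (c \<bullet> i) +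
       ennreal (norm u) * (\<integral>\<^sup>+ s \<in> {0<..1}. h (c \<bullet> i + s * (u \<bullet> i)) \<partial>lborel))"
proof -
  let ?P = "hyperplane_proj i"
  let ?L1 = "\<lambda>v. \<integral>\<^sup>+ s \<in> {0<..1}. \<rho> (c + s *\<^sub>R ?P v) \<partial>lborel"
  let ?L2 = "\<lambda>v. \<integral>\<^sup>+ s \<in> {0<..1}. \<rho> (c + ?P v + s *\<^sub>R u) \<partial>lborel"
  let ?S1 = "\<lambda>s. \<integral>\<^sup>+ v. indicator W v * \<rho> (c + s *\<^sub>R ?P v) \<partial>lborel"
  let ?S2 = "\<lambda>s. \<integral>\<^sup>+ v. indicator W v * \<rho> (c + ?P v + s *\<^sub>R u) \<partial>lborel"
  let ?H = "\<integral>\<^sup>+ s \<in> {0<..1}. h (c \<bullet> i + s * (u \<bullet> i)) \<partial>lborel"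
  define \<sigma> where "\<sigma> = (\<lambda>x. enn_powr (\<rho> x) p)"
  define w where "w = emeasure lborel W"
  define B where "B = \<beta> * (p - 1) - (real DIM('a) - 2)"
  have B: "B > 0" using \<beta> by (simp add: B_def)
  have [measurable]: "\<sigma> \<in> borel_measurable borel" unfolding \<sigma>_def by measurable
  have h: "h = slice i \<sigma>" by (simp add: h_def \<sigma>_def)
  have [measurable]: "h \<in> borel_measurable borel" unfolding h by measurable
  have first: "?S1 s
      \<le> ennreal (k * s powr (- \<beta>)) * w + ennreal (k powr (1 - p) * s powr (B - 1)) * h (c \<bullet> i)"
    if s: "s > 0" for s
  proof -
    let ?k = "k * s powr (- \<beta>)"
    have k': "?k > 0" using k s by simp
    have "?S1 s
        \<le> (\<integral>\<^sup>+ v. ennreal ?k * indicator W v +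
            ennreal (?k powr (1 - p)) * (indicator (slab i) v * \<sigma> (c + s *\<^sub>R ?P v)) \<partial>lborel)"
    proof (rule nn_integral_mono)
      fix v
      have "indicator W v * \<rho> (c + s *\<^sub>R ?P v)
          \<le> indicator W v * (ennreal ?k + ennreal (?k powr (1 - p)) * \<sigma> (c + s *\<^sub>R ?P v))"
        unfolding \<sigma>_def by (intro mult_left_mono le_const_plus_enn_powr k' p) simp
      also have "\<dots> \<le> ennreal ?k * indicator W v +
            ennreal (?k powr (1 - p)) * (indicator (slab i) v * \<sigma> (c + s *\<^sub>R ?P v))"
        using Wsub by (auto simp: indicator_def)
      finally show "indicator W v * \<rho> (c + s *\<^sub>R ?P v) \<le> \<dots>" .
    qed
    also have "\<dots> = ennreal ?k * w + ennreal (?k powr (1 - p)) *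
        (\<integral>\<^sup>+ v. indicator (slab i) v * \<sigma> (c + s *\<^sub>R ?P v) \<partial>lborel)"
      by (simp add: nn_integral_add nn_integral_cmult w_def)
    also have "ennreal (?k powr (1 - p)) * (\<integral>\<^sup>+ v. indicator (slab i) v * \<sigma> (c + s *\<^sub>R ?P v) \<partial>lborel)
        = ennreal (k powr (1 - p) * s powr (B - 1)) * h (c \<bullet> i)"
    proof -
      have "?k powr (1 - p) = k powr (1 - p) * s powr (\<beta> * (p - 1))"
        using k s by (simp add: powr_mult powr_powr algebra_simps)
      \<comment> \<open>The exponent splits into \<open>B - 1\<close>, which is integrable at 0, and
        the n - 1 powers of \<open>s\<close> that are the Jacobian of the scaling.\<close>
      also have "\<beta> * (p - 1) = (B - 1) + real (DIM('a) - 1)"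
        using DIM_positive [where 'a = 'a] by (simp add: B_def of_nat_diff)
      also have "s powr \<dots> = s powr (B - 1) * s ^ (DIM('a) - 1)"
        using s by (simp only: powr_add powr_realpow)
      finally have "ennreal (?k powr (1 - p))
          = ennreal (k powr (1 - p) * s powr (B - 1)) * ennreal (s ^ (DIM('a) - 1))"
        using s by (simp add: ennreal_mult' mult.assoc [symmetric])
      then show ?thesis unfolding h using slice_scale [of \<sigma> i s c] i s by (simp add: mult.assoc)
    qed
    finally show ?thesis .
  qed
  have second: "?S2 s
      \<le> ennreal k * w + ennreal (k powr (1 - p)) * h (c \<bullet> i + s * (u \<bullet> i))" for s
  proof -
    have "?S2 s
        \<le> (\<integral>\<^sup>+ v. ennreal k * indicator W v +
            ennreal (k powr (1 - p)) * (indicator (slab i) v * \<sigma> (c + s *\<^sub>R u + ?P v)) \<partial>lborel)"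
    proof (rule nn_integral_mono)
      fix v
      have "indicator W v * \<rho> (c + ?P v + s *\<^sub>R u)
          \<le> indicator W v * (ennreal k + ennreal (k powr (1 - p)) * \<sigma> (c + ?P v + s *\<^sub>R u))"
        unfolding \<sigma>_def by (intro mult_left_mono le_const_plus_enn_powr k p) simp
      also have "\<dots> \<le> ennreal k * indicator W v +
            ennreal (k powr (1 - p)) * (indicator (slab i) v * \<sigma> (c + s *\<^sub>R u + ?P v))"
        using Wsub by (auto simp: indicator_def ac_simps)
      finally show "indicator W v * \<rho> (c + ?P v + s *\<^sub>R u) \<le> \<dots>" .
    qed
    also have "\<dots> = ennreal k * w + ennreal (k powr (1 - p)) *
        (\<integral>\<^sup>+ v. indicator (slab i) v * \<sigma> (c + s *\<^sub>R u + ?P v) \<partial>lborel)"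
      by (simp add: nn_integral_add nn_integral_cmult w_def)
    also have "\<dots> = ennreal k * w + ennreal (k powr (1 - p)) * h (c \<bullet> i + s * (u \<bullet> i))"
      unfolding h using slice_at_point [of \<sigma> i "c + s *\<^sub>R u"] i by (simp add: inner_add_left)
    finally show ?thesis .
  qed
  have "w \<le> (\<integral>\<^sup>+ v. ennreal \<delta> * (indicator W v * ?L1 v) +
      ennreal (norm u) * (indicator W v * ?L2 v) \<partial>lborel)"
  proof -
    have "w = (\<integral>\<^sup>+ v. indicator W v \<partial>lborel)" by (simp add: w_def)
    also have "\<dots> \<le> (\<integral>\<^sup>+ v. ennreal \<delta> * (indicator W v * ?L1 v) +
      ennreal (norm u) * (indicator W v * ?L2 v) \<partial>lborel)"
    proof (rule nn_integral_mono)
      fix v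
      show "indicator W v \<le> ennreal \<delta> * (indicator W v * ?L1 v) +
        ennreal (norm u) * (indicator W v * ?L2 v)"
      proof (cases "v \<in> W")
        case True
        then show ?thesis
          using line [OF True] Wsub(2) [OF True] unfolding broken_line_integral_def
          by (auto elim!: order_trans intro!: add_mono mult_right_mono ennreal_leI)
      qed auto
    qed
    finally show ?thesis .
  qed
  also have "\<dots> = ennreal \<delta> * (\<integral>\<^sup>+ v. indicator W v * ?L1 v \<partial>lborel) +
      ennreal (norm u) * (\<integral>\<^sup>+ v. indicator W v * ?L2 v \<partial>lborel)"
    by (simp add: nn_integral_add nn_integral_cmult)
  also have "(\<integral>\<^sup>+ v. indicator W v * ?L1 v \<partial>lborel)
      = (\<integral>\<^sup>+ s \<in> {0<..1}. ?S1 s \<partial>lborel)"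
    by (rule nn_integral_set_swap) measurable
  also have "(\<integral>\<^sup>+ v. indicator W v * ?L2 v \<partial>lborel)
      = (\<integral>\<^sup>+ s \<in> {0<..1}. ?S2 s \<partial>lborel)"
    by (rule nn_integral_set_swap) measurable
  also have "(\<integral>\<^sup>+ s \<in> {0<..1}. ?S1 s \<partial>lborel)
      \<le> ennreal (k / (1 - \<beta>)) * w + ennreal (k powr (1 - p) / B) * h (c \<bullet> i)"
  proof -
    have "(\<integral>\<^sup>+ s \<in> {0<..1}. ?S1 s \<partial>lborel)
        \<le> (\<integral>\<^sup>+ s. (ennreal k * w) * (ennreal (s powr (- \<beta>)) * indicator {0<..1} s) +
            (ennreal (k powr (1 - p)) * h (c \<bullet> i)) * (ennreal (s powr (B - 1)) * indicator {0<..1} s) \<partial>lborel)"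
      using first k by (intro nn_integral_mono) (auto simp: indicator_def ennreal_mult ac_simps)
    also have "\<dots> = (ennreal k * w) * ennreal (1 / (1 - \<beta>)) +
        (ennreal (k powr (1 - p)) * h (c \<bullet> i)) * ennreal (1 / B)"
      using \<beta> B nn_integral_powr_0_1 [of "- \<beta>"] nn_integral_powr_0_1 [of "B - 1"]
      by (simp add: nn_integral_add nn_integral_cmult)
    also have "\<dots> = ennreal (k * (1 / (1 - \<beta>))) * w + ennreal (k powr (1 - p) * (1 / B)) * h (c \<bullet> i)"
    proof -
      have "ennreal (k * (1 / (1 - \<beta>))) = ennreal k * ennreal (1 / (1 - \<beta>))"
        using k \<beta> by (intro ennreal_mult) auto
      moreover have "ennreal (k powr (1 - p) * (1 / B)) = ennreal (k powr (1 - p)) * ennreal (1 / B)"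
        using k B by (intro ennreal_mult) auto
      ultimately show ?thesis
        by (simp add: ac_simps)
    qed
    finally show ?thesis by simp
  qed
  also have "(\<integral>\<^sup>+ s \<in> {0<..1}. ?S2 s \<partial>lborel)
      \<le> ennreal k * w + ennreal (k powr (1 - p)) * ?H"
  proof -
    have "(\<integral>\<^sup>+ s \<in> {0<..1}. ?S2 s \<partial>lborel)
        \<le> (\<integral>\<^sup>+ s. ennreal k * w * indicator {0<..1} s +
            ennreal (k powr (1 - p)) * (h (c \<bullet> i + s * (u \<bullet> i)) * indicator {0<..1} s) \<partial>lborel)"
      using second by (intro nn_integral_mono) (auto simp: indicator_def)
    also have "\<dots> = ennreal k * w + ennreal (k powr (1 - p)) * ?H"
      by (simp add: nn_integral_add nn_integral_cmult)
    finally show ?thesis .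
  qed
  finally have "w \<le> ennreal \<delta> * (ennreal (k / (1 - \<beta>)) * w + ennreal (k powr (1 - p) / B) * h (c \<bullet> i)) +
      ennreal (norm u) * (ennreal k * w + ennreal (k powr (1 - p)) * ?H)"
    by (simp add: add_mono mult_left_mono)
  also have "\<dots> = (ennreal \<delta> * ennreal (k / (1 - \<beta>)) + ennreal (norm u) * ennreal k) * w +
     ((ennreal \<delta> * ennreal (k powr (1 - p) / B)) * h (c \<bullet> i) +
       ennreal (k powr (1 - p)) * (ennreal (norm u) * ?H))"
    by (simp add: algebra_simps)
  also have "ennreal \<delta> * ennreal (k / (1 - \<beta>)) + ennreal (norm u) * ennreal k = ennreal (k * (\<delta> / (1 - \<beta>) + norm u))"
    using k \<beta> \<delta> by (simp add: ennreal_mult' [symmetric] ennreal_plus [symmetric] algebra_simps del: ennreal_plus)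
  also have "ennreal \<delta> * ennreal (k powr (1 - p) / B) = ennreal (k powr (1 - p)) * ennreal (\<delta> / B)"
    using \<delta> B by (simp add: ennreal_mult' [symmetric] mult.commute)
  finally show ?thesis by (simp add: w_def B_def distrib_left mult.assoc)
qed

text \<open>The constants in the bound for one hyperplane depend neither on \<open>t\<close> nor on
  the point of \<open>C\<close> found there, so it may be integrated over \<open>t\<close>. By
  translation invariance the slices and their shifts along \<open>u\<close> both add up to the full
  integral of the p-th power of \<open>\<rho>\<close>.\<close>

lemma broken_line_capacity_positive:
  fixes C :: "'a::euclidean_space set"
  assumes n: "DIM('a) \<ge> 2" and p: "p > real DIM('a) - 1" and C: "connected C" "a \<in> C" "b \<in> C" "a \<noteq> b"
    and \<delta>: "\<delta> > 0"
  obtains \<epsilon> where "\<epsilon> > 0"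
    "\<And>\<rho>. \<rho> \<in> borel_measurable borel \<Longrightarrow>
      (\<And>c v. c \<in> C \<Longrightarrow> norm v \<le> \<delta> \<Longrightarrow> 1 \<le> broken_line_integral \<rho> c v u) \<Longrightarrow>
      ennreal \<epsilon> \<le> (\<integral>\<^sup>+ x. enn_powr (\<rho> x) p \<partial>lborel)"
proof -
  obtain i a b where i: "i \<in> Basis" and ab: "a \<in> C" "b \<in> C" "a \<bullet> i < b \<bullet> i"
    using C(2-4) euclidean_eqI [of a b] by (metis linorder_neqE_linordered_idom)
  let ?P = "hyperplane_proj i"
  have p1: "p > 1" using n p by linarith
  \<comment> \<open>This is the assumption that p exceeds n - 1 in another form; it leaves room for
    an exponent \<open>\<beta>\<close> below 1.\<close>
  have "(real DIM('a) - 2) / (p - 1) < 1" using p p1 by simp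
  then obtain \<beta> where "(real DIM('a) - 2) / (p - 1) < \<beta>" "\<beta> < 1" using dense by blast
  then have \<beta>: "\<beta> < 1" "\<beta> * (p - 1) > real DIM('a) - 2"
    using p1 by (simp_all add: pos_divide_less_eq)
  define B where "B = \<delta> / (\<beta> * (p - 1) - (real DIM('a) - 2))"
  have B: "B > 0" using \<delta> \<beta> by (simp add: B_def)
  \<comment> \<open>With this choice the first term of \<open>broken_line_slice_bound\<close> is
    half the measure of \<open>W\<close>, which can be subtracted because the measure is
    finite.\<close>
  define k where "k = 1 / (2 * (\<delta> / (1 - \<beta>) + norm u))"
  have "\<delta> / (1 - \<beta>) + norm u > 0" using \<delta> \<beta> by (simp add: add_pos_nonneg)
  then have k: "k > 0" "k * (\<delta> / (1 - \<beta>) + norm u) = 1 / 2" by (simp_all add: k_def)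
  \<comment> \<open>The cylinder over the disc of radius \<open>\<delta>\<close>, as high as the
    slab is thick.\<close>
  define W where "W = {v \<in> slab i. norm (?P v) \<le> \<delta>}"
  have W [measurable]: "W \<in> sets borel" unfolding W_def by measurable
  have "bounded W"
  proof (rule boundedI)
    fix v assume v: "v \<in> W"
    have "v = ?P v + (v \<bullet> i) *\<^sub>R i" by (simp add: hyperplane_proj_def)
    then have "norm v \<le> norm (?P v) + \<bar>v \<bullet> i\<bar> * norm i" by (metis norm_triangle_ineq norm_scaleR)
    then show "norm v \<le> \<delta> + 1" using v i by (simp add: W_def slab_def)
  qed
  then have Wfin: "emeasure lborel W < \<infinity>" by (rule emeasure_bounded_finite)
  define w where "w = measure lborel W"
  have w: "emeasure lborel W = ennreal w"
    using Wfin by (simp add: w_def emeasure_eq_ennreal_measure less_top)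
  have "w > 0"
  proof -
    \<comment> \<open>A ball of radius at most \<open>1/2\<close> about the centre of the slab stays
      in it; the projection is estimated by \<open>norm x + \<bar>x \<bullet> i\<bar>\<close>, below
      \<open>2 * r\<close>, whence the second bound \<open>\<delta> / 2\<close>.\<close>
    define r where "r = min (1/2) (\<delta> / 2)"
    have r: "r > 0" "r \<le> 1/2" "2 * r \<le> \<delta>" using \<delta> by (auto simp: r_def)
    have "ball ((1/2) *\<^sub>R i) r \<subseteq> W"
    proof
      fix v assume "v \<in> ball ((1/2) *\<^sub>R i) r"
      define x where "x = v - (1/2) *\<^sub>R i"
      have x: "norm x < r" "v = (1/2) *\<^sub>R i + x"
        using \<open>v \<in> _\<close> by (simp_all add: x_def dist_norm norm_minus_commute)
      have xi: "\<bar>x \<bullet> i\<bar> < r" using Basis_le_norm [OF i, of x] x by linarith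
      have vi: "v \<bullet> i = 1/2 + x \<bullet> i" using i by (simp add: x inner_add_left)
      have "?P v = x - (x \<bullet> i) *\<^sub>R i"
        unfolding hyperplane_proj_def vi by (simp add: x algebra_simps)
      then have "norm (?P v) \<le> norm x + \<bar>x \<bullet> i\<bar>"
        using i norm_triangle_ineq4 [of x "(x \<bullet> i) *\<^sub>R i"] by simp
      then show "v \<in> W" using x xi vi r by (auto simp: W_def slab_def abs_if split: if_splits)
    qed
    then have "emeasure lborel (ball ((1/2) *\<^sub>R i) r) \<le> ennreal w"
      unfolding w [symmetric] by (intro emeasure_mono) auto
    moreover have "emeasure lborel (ball ((1/2) *\<^sub>R i) r) > 0" using r by (simp add: emeasure_ball)
    ultimately show ?thesis
      by (metis ennreal_less_zero_iff not_le order_less_le_trans ennreal_0 ennreal_eq_0_iff linorder_not_less)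
  qed
  define M where "M = k powr (1 - p) * (B + norm u)"
  have M: "M > 0" using k B by (simp add: M_def add_pos_nonneg)
  define L where "L = b \<bullet> i - a \<bullet> i"
  have L: "L > 0" using ab by (simp add: L_def)
  show ?thesis
  proof
    show "L * (w / 2) / M > 0" using L \<open>w > 0\<close> M by simp
    fix \<rho> :: "'a \<Rightarrow> ennreal"
    assume \<rho> [measurable]: "\<rho> \<in> borel_measurable borel"
      and line: "\<And>c v. c \<in> C \<Longrightarrow> norm v \<le> \<delta> \<Longrightarrow> 1 \<le> broken_line_integral \<rho> c v u"
    define h where "h = slice i (\<lambda>x. enn_powr (\<rho> x) p)"
    have [measurable]: "h \<in> borel_measurable borel" unfolding h_def by measurable
    define I where "I = (\<integral>\<^sup>+ x. enn_powr (\<rho> x) p \<partial>lborel)"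
    have hI: "(\<integral>\<^sup>+ t. h t \<partial>lborel) = I"
      unfolding h_def I_def using i by (intro nn_integral_slice) measurable
    let ?X = "\<lambda>t. ennreal (k powr (1 - p)) * (ennreal B * h t +
          ennreal (norm u) * (\<integral>\<^sup>+ s \<in> {0<..1}. h (t + s * (u \<bullet> i)) \<partial>lborel))"
    have bound: "ennreal (w / 2) \<le> ?X t" if t: "t \<in> {a \<bullet> i<..<b \<bullet> i}" for t
    proof -
      obtain c where c: "c \<in> C" "c \<bullet> i = t"
        using connected_ivt_hyperplane [OF C(1) ab(1,2), of i t] t by (auto simp: inner_commute)
      have "emeasure lborel W \<le> ennreal (k * (\<delta> / (1 - \<beta>) + norm u)) * emeasure lborel W + ?X t"
        unfolding c(2) [symmetric] h_def B_def
        by (rule broken_line_slice_bound) (use i \<delta> p1 k \<beta> line c in \<open>auto simp: W_def\<close>)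
      then have "ennreal w \<le> ennreal (w / 2) + ?X t"
      proof -
        have "ennreal (1 / 2) * ennreal w = ennreal (w / 2)"
          by (subst ennreal_mult' [symmetric]) auto
        then show ?thesis using \<open>emeasure lborel W \<le> _\<close> unfolding w k(2) by argo
      qed
      then have "ennreal (w / 2) + ennreal (w / 2) \<le> ennreal (w / 2) + ?X t"
        using \<open>w > 0\<close> by (simp add: ennreal_plus [symmetric] del: ennreal_plus)
      then show ?thesis by (simp add: ennreal_add_left_cancel_le)
    qed
    have "ennreal (L * (w / 2)) = (\<integral>\<^sup>+ t. ennreal (w / 2) * indicator {a \<bullet> i<..<b \<bullet> i} t \<partial>lborel)"
      using L \<open>w > 0\<close> ennreal_mult' [of L "w / 2"]
        emeasure_lborel_Ioo [of "a \<bullet> i" "b \<bullet> i"] ab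
      by (simp add: nn_integral_cmult mult.commute L_def [symmetric] del: emeasure_lborel_Ioo)
    also have "\<dots> \<le> (\<integral>\<^sup>+ t. ?X t \<partial>lborel)"
      using bound by (intro nn_integral_mono) (auto simp: indicator_def)
    also have "\<dots> = ennreal (k powr (1 - p)) * (ennreal B * I +
        ennreal (norm u) * (\<integral>\<^sup>+ t. (\<integral>\<^sup>+ s \<in> {0<..1}. h (t + s * (u \<bullet> i)) \<partial>lborel) \<partial>lborel))"
      by (simp add: nn_integral_add nn_integral_cmult hI)
    also have "(\<integral>\<^sup>+ t. (\<integral>\<^sup>+ s \<in> {0<..1}. h (t + s * (u \<bullet> i)) \<partial>lborel) \<partial>lborel)
        = (\<integral>\<^sup>+ s. \<integral>\<^sup>+ t. h (t + s * (u \<bullet> i)) * indicator {0<..1} s \<partial>lborel \<partial>lborel)"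
      by (rule nn_integral_lborel_swap) measurable
    also have "\<dots> = (\<integral>\<^sup>+ s. I * indicator {0<..1::real} s \<partial>lborel)"
    proof (rule nn_integral_cong)
      fix s :: real
      have "(\<integral>\<^sup>+ t. h (s * (u \<bullet> i) + t) \<partial>lborel) = I"
        unfolding hI [symmetric] by (rule nn_integral_lborel_translate) measurable
      then show "(\<integral>\<^sup>+ t. h (t + s * (u \<bullet> i)) * indicator {0<..1} s \<partial>lborel) = I * indicator {0<..1} s"
        by (simp add: nn_integral_multc add.commute)
    qed
    also have "\<dots> = I" by (simp add: nn_integral_cmult)
    also have "ennreal (k powr (1 - p)) * (ennreal B * I + ennreal (norm u) * I) = ennreal M * I"
      using B by (simp add: M_def ennreal_mult' ennreal_plus distrib_right mult.assoc)
    finally have "ennreal (L * (w / 2)) \<le> ennreal M * I" .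
    then have "ennreal (1 / M) * ennreal (L * (w / 2)) \<le> ennreal (1 / M) * (ennreal M * I)"
      by (rule mult_left_mono) simp
    also have "ennreal (1 / M) * (ennreal M * I) = I"
      using M by (simp add: mult.assoc [symmetric] ennreal_mult' [symmetric])
    also have "ennreal (1 / M) * ennreal (L * (w / 2)) = ennreal (L * (w / 2) / M)"
      using M L by (simp add: ennreal_mult' [symmetric] mult.commute)
    finally show "ennreal (L * (w / 2) / M) \<le> I" .
  qed
qed

section \<open>Broken lines as curves\<close>

text \<open>Parametrised by arc length on the interval from 0 to \<open>norm v + norm u\<close>, so
  that \<open>path_line_integral\<close> becomes an ordinary integral. If \<open>v = 0\<close>, the
  first leg is a point and the corner sits at parameter 0.\<close>

definition broken_line :: "'a::euclidean_space \<Rightarrow> 'a \<Rightarrow> 'a \<Rightarrow> real \<Rightarrow> 'a" where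
  "broken_line c v u s =
     (if s \<le> norm v then c + s *\<^sub>R sgn v else c + v + (s - norm v) *\<^sub>R sgn u)"

lemma norm_scaleR_sgn: "norm v *\<^sub>R sgn v = (v :: 'a::real_normed_vector)"
  by (cases "v = 0") (simp_all add: sgn_div_norm)

lemma broken_line_alt: "s \<ge> norm v \<Longrightarrow> broken_line c v u s = c + v + (s - norm v) *\<^sub>R sgn u"
  by (auto simp: broken_line_def norm_scaleR_sgn)

lemma broken_line_ends:
  "broken_line c v u 0 = c" "broken_line c v u (norm v + norm u) = c + v + u"
  by (simp_all add: broken_line_def norm_scaleR_sgn)

lemma dist_broken_line_le: "dist (broken_line c v u s) (broken_line c v u t) \<le> \<bar>s - t\<bar>"
proof -
  have *: "dist (broken_line c v u s) (broken_line c v u t) \<le> t - s" if "s \<le> t" for s t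
  proof -
    have seg: "dist (e + s *\<^sub>R sgn w) (e + t *\<^sub>R sgn w) \<le> \<bar>t - s\<bar>" for e w :: 'a and s t
      by (simp add: dist_norm norm_sgn abs_minus_commute flip: scaleR_diff_left)
    consider "t \<le> norm v" | "norm v \<le> s" | "s \<le> norm v" "norm v \<le> t"
      using that by linarith
    then show ?thesis
    proof cases
      case 1
      then show ?thesis using that seg [of c s v t] by (simp add: broken_line_def)
    next
      case 2
      then show ?thesis
        using that seg [of "c + v" "s - norm v" u "t - norm v"] by (simp add: broken_line_alt)
    next
      case 3
      have "dist (c + s *\<^sub>R sgn v) (c + v) \<le> norm v - s"
        using 3 seg [of c s v "norm v"] by (simp add: norm_scaleR_sgn)
      moreover have "dist (c + v) (c + v + (t - norm v) *\<^sub>R sgn u) \<le> t - norm v"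
        using 3 seg [of "c + v" 0 u "t - norm v"] by simp
      ultimately show ?thesis
        using 3 dist_triangle [of "c + s *\<^sub>R sgn v" "c + v + (t - norm v) *\<^sub>R sgn u" "c + v"]
        by (simp add: broken_line_alt [of v t]) (simp add: broken_line_def)
    qed
  qed
  show ?thesis using *[of s t] *[of t s] by (cases "s \<le> t") (auto simp: dist_commute)
qed

lemma continuous_on_broken_line: "continuous_on S (broken_line c v u)"
  unfolding continuous_on_iff
  by (metis dist_broken_line_le dist_real_def dist_commute order_le_less_trans)

text \<open>The upper bound telescopes the Lipschitz estimate. For the lower bound, the partition
  whose only inner node is the corner, clamped to the interval, already attains the length.\<close>

lemma curve_length_broken_line:
  assumes u: "u \<noteq> 0" and a: "0 \<le> a" "a \<le> t"
  shows "curve_length (broken_line c v u) a t = ennreal (t - a)"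
proof (rule antisym)
  let ?\<gamma> = "broken_line c v u"
  have upper: "(\<Sum>i<k. ennreal (dist (?\<gamma> (\<tau> i)) (?\<gamma> (\<tau> (Suc i))))) \<le> ennreal (t - a)"
    if mono: "mono_on {..k} \<tau>" and im: "\<tau> ` {..k} \<subseteq> {a..t}" for k \<tau>
  proof -
    have "(\<Sum>i<k. ennreal (dist (?\<gamma> (\<tau> i)) (?\<gamma> (\<tau> (Suc i))))) \<le> (\<Sum>i<k. ennreal (\<tau> (Suc i) - \<tau> i))"
    proof (intro sum_mono ennreal_leI)
      fix i assume "i \<in> {..<k}"
      then have "\<tau> i \<le> \<tau> (Suc i)" using mono by (auto simp: mono_on_def)
      then show "dist (?\<gamma> (\<tau> i)) (?\<gamma> (\<tau> (Suc i))) \<le> \<tau> (Suc i) - \<tau> i"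
        using dist_broken_line_le [of c v u "\<tau> i" "\<tau> (Suc i)"] by simp
    qed
    also have "\<dots> = ennreal (\<Sum>i<k. \<tau> (Suc i) - \<tau> i)"
      using mono by (intro sum_ennreal) (auto simp: mono_on_def)
    also have "(\<Sum>i<k. \<tau> (Suc i) - \<tau> i) = \<tau> k - \<tau> 0" by (rule sum_lessThan_telescope)
    also have "ennreal (\<tau> k - \<tau> 0) \<le> ennreal (t - a)"
    proof (rule ennreal_leI)
      have "\<tau> k \<in> {a..t}" "\<tau> 0 \<in> {a..t}" using im by auto
      then show "\<tau> k - \<tau> 0 \<le> t - a" by simp
    qed
    finally show ?thesis .
  qed
  then show "curve_length ?\<gamma> a t \<le> ennreal (t - a)"
    unfolding curve_length_def by (intro SUP_least) auto
  define m where "m = max a (min t (norm v))"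
  define \<tau> where "\<tau> = (\<lambda>i::nat. if i = 0 then a else if i = 1 then m else t)"
  have m: "a \<le> m" "m \<le> t" using a by (auto simp: m_def)
  have d1: "dist (?\<gamma> a) (?\<gamma> m) = m - a"
  proof (cases "a < norm v")
    case True
    then have "m \<le> norm v" "v \<noteq> 0" using a by (auto simp: m_def)
    have "dist (?\<gamma> a) (?\<gamma> m) = norm ((a - m) *\<^sub>R sgn v)"
      using True \<open>m \<le> norm v\<close> by (simp add: broken_line_def dist_norm scaleR_diff_left)
    also have "\<dots> = m - a" using m \<open>v \<noteq> 0\<close> by (simp add: norm_sgn)
    finally show ?thesis .
  next
    case False
    then show ?thesis by (simp add: m_def)
  qed
  have d2: "dist (?\<gamma> m) (?\<gamma> t) = t - m"
  proof (cases "t \<le> norm v")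
    case True
    then show ?thesis using a by (simp add: m_def)
  next
    case False
    then have "m \<ge> norm v" by (auto simp: m_def)
    then have "dist (?\<gamma> m) (?\<gamma> t) = norm ((m - t) *\<^sub>R sgn u)"
      using False by (simp add: broken_line_alt dist_norm algebra_simps)
    also have "\<dots> = t - m" using m u by (simp add: norm_sgn)
    finally show ?thesis .
  qed
  have "ennreal (t - a) = (\<Sum>i<2. ennreal (dist (?\<gamma> (\<tau> i)) (?\<gamma> (\<tau> (Suc i)))))"
    using d1 d2 m by (simp add: numeral_2_eq_2 \<tau>_def ennreal_plus [symmetric] del: ennreal_plus)
  also have "\<dots> \<le> curve_length ?\<gamma> a t"
  proof -
    have "mono_on {..2} \<tau>" "\<tau> ` {..2} \<subseteq> {a..t}" using m by (auto simp: mono_on_def \<tau>_def)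
    then show ?thesis unfolding curve_length_def by (intro SUP_upper2 [of "(2, \<tau>)"]) auto
  qed
  finally show "ennreal (t - a) \<le> curve_length ?\<gamma> a t" .
qed

lemma nn_integral_scale_segment:
  fixes g :: "'a::euclidean_space \<Rightarrow> ennreal"
  assumes [measurable]: "g \<in> borel_measurable borel"
  shows "(\<integral>\<^sup>+ s \<in> {m<..m + norm v}. g (c + (s - m) *\<^sub>R sgn v) \<partial>lborel)
       = ennreal (norm v) * (\<integral>\<^sup>+ s \<in> {0<..1}. g (c + s *\<^sub>R v) \<partial>lborel)"
proof (cases "v = 0")
  case False
  let ?F = "\<lambda>s. g (c + (s - m) *\<^sub>R sgn v) * indicator {m<..m + norm v} s"
  have "(\<integral>\<^sup>+ s. ?F s \<partial>lborel) = ennreal \<bar>norm v\<bar> * (\<integral>\<^sup>+ s. ?F (m + norm v * s) \<partial>lborel)"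
    using False by (intro nn_integral_real_affine) auto
  also have "(\<lambda>s. ?F (m + norm v * s)) = (\<lambda>s. g (c + s *\<^sub>R v) * indicator {0<..1} s)"
  proof
    fix s
    have "(norm v * s) *\<^sub>R sgn v = s *\<^sub>R v"
      using norm_scaleR_sgn [of v] by (metis mult.commute scaleR_scaleR)
    moreover have "indicator {m<..m + norm v} (m + norm v * s) = (indicator {0<..1} s :: ennreal)"
      using False by (auto simp: indicator_def zero_less_mult_iff)
    ultimately show "?F (m + norm v * s) = g (c + s *\<^sub>R v) * indicator {0<..1} s" by simp
  qed
  finally show ?thesis by simp
qed simp

text \<open>The left side may run over a proper part of the broken line, since only such a part
  belongs to the path family in question. On a broken line the length coordinate determines the
  parameter, so the choice in \<open>arc_length_param\<close> can only be
  \<open>a + s\<close>.\<close>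

lemma path_line_integral_broken_line_le:
  fixes \<rho> :: "'a::euclidean_space \<Rightarrow> ennreal"
  assumes [measurable]: "\<rho> \<in> borel_measurable borel" and u: "u \<noteq> 0"
    and ab: "0 \<le> a" "a \<le> b" "b \<le> norm v + norm u"
  shows "path_line_integral \<rho> (broken_line c v u) a b \<le> broken_line_integral \<rho> c v u"
proof -
  let ?\<gamma> = "broken_line c v u"
  have [measurable]: "?\<gamma> \<in> borel_measurable borel"
    using continuous_on_broken_line by (rule borel_measurable_continuous_onI)
  have par: "arc_length_param ?\<gamma> a b s = ?\<gamma> (a + s)" if "s \<in> {0..b - a}" for s
  proof -
    have "(SOME t. t \<in> {a..b} \<and> curve_length ?\<gamma> a t = ennreal s) = a + s"
    proof (rule some_equality)
      show "a + s \<in> {a..b} \<and> curve_length ?\<gamma> a (a + s) = ennreal s"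
        using that ab u by (simp add: curve_length_broken_line)
      show "t = a + s" if t: "t \<in> {a..b} \<and> curve_length ?\<gamma> a t = ennreal s" for t
        using t \<open>s \<in> {0..b - a}\<close> ab u by (auto simp: curve_length_broken_line)
    qed
    then show ?thesis by (simp add: arc_length_param_def)
  qed
  have "path_line_integral \<rho> ?\<gamma> a b = (\<integral>\<^sup>+ s \<in> {0..b - a}. \<rho> (?\<gamma> (a + s)) \<partial>lborel)"
    unfolding path_line_integral_def using ab u
    by (intro nn_integral_cong) (auto simp: curve_length_broken_line par indicator_def)
  also have "\<dots> = (\<integral>\<^sup>+ s. \<rho> (?\<gamma> (a + s)) * indicator {a..b} (a + s) \<partial>lborel)"
    by (intro nn_integral_cong) (auto simp: indicator_def)
  also have "\<dots> = (\<integral>\<^sup>+ s \<in> {a..b}. \<rho> (?\<gamma> s) \<partial>lborel)"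
    by (rule nn_integral_lborel_translate) measurable
  also have "\<dots> \<le> (\<integral>\<^sup>+ s \<in> {0<..norm v + norm u}. \<rho> (?\<gamma> s) \<partial>lborel)"
    using AE_lborel_singleton [of "0::real"] ab
    by (intro nn_integral_mono_AE) (auto simp: indicator_def elim!: AE_mp)
  also have "\<dots> = (\<integral>\<^sup>+ s. \<rho> (c + (s - 0) *\<^sub>R sgn v) * indicator {0<..0 + norm v} s +
      \<rho> (c + v + (s - norm v) *\<^sub>R sgn u) * indicator {norm v<..norm v + norm u} s \<partial>lborel)"
    using norm_ge_zero [of u] norm_ge_zero [of v]
    by (intro nn_integral_cong) (auto simp: broken_line_def indicator_def simp del: norm_ge_zero)
  also have "\<dots> = broken_line_integral \<rho> c v u"
    unfolding broken_line_integral_def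
    by (subst nn_integral_add) (auto simp only: nn_integral_scale_segment [OF assms(1)], measurable)
  finally show ?thesis .
qed

lemma line_integral_broken_line_le:
  fixes \<rho> :: "'a::euclidean_space \<Rightarrow> ennreal"
  assumes "\<rho> \<in> borel_measurable borel" and "u \<noteq> 0" and I: "I \<subseteq> {0..norm v + norm u}"
  shows "line_integral \<rho> (I, broken_line c v u) \<le> broken_line_integral \<rho> c v u"
  unfolding line_integral_def
proof (clarsimp, rule SUP_least, clarsimp)
  fix a b :: real assume "a \<le> b" "{a..b} \<subseteq> I"
  then have "a \<in> I" "b \<in> I" by auto
  then show "path_line_integral \<rho> (broken_line c v u) a b \<le> broken_line_integral \<rho> c v u"
    using assms \<open>a \<le> b\<close> by (intro path_line_integral_broken_line_le) auto
qed

lemma locally_rectifiable_broken_line: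
  assumes "u \<noteq> 0" and I: "I \<subseteq> {0..}"
  shows "locally_rectifiable (I, broken_line c v u)"
  unfolding locally_rectifiable_def prod.case
proof (intro allI impI)
  fix a b :: real assume "a \<le> b \<and> {a..b} \<subseteq> I"
  moreover from this have "a \<in> I" by auto
  ultimately show "curve_length (broken_line c v u) a b < \<infinity>"
    using assms by (subst curve_length_broken_line) auto
qed

section \<open>Total disconnectedness of the fibres\<close>

text \<open>\<open>b\<close> is the first time at which the image is at distance at least
  \<open>r2\<close> from \<open>y0\<close>, and \<open>a\<close> the last time before
  \<open>b\<close> at distance at most \<open>r1\<close>. By continuity both distances are attained
  exactly, and strictly between the two times the image is inside the annulus.\<close>

lemma lifted_paths_subpath:
  fixes f :: "'a::euclidean_space \<Rightarrow> 'a"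
  assumes f: "continuous_on D f" and \<gamma>: "continuous_on {0..l} \<gamma>" "\<gamma> ` {0..l} \<subseteq> D"
    and r: "0 < r1" "r1 < r2" and l: "0 \<le> l" and ends: "f (\<gamma> 0) = y0" "dist (f (\<gamma> l)) y0 \<ge> r2"
  obtains a b where "{a..b} \<subseteq> {0..l}" "({a..b}, \<gamma>) \<in> lifted_paths D f y0 r1 r2"
proof -
  define g where "g = (\<lambda>s. dist (f (\<gamma> s)) y0)"
  have f\<gamma>: "continuous_on {0..l} (f \<circ> \<gamma>)"
    using f \<gamma> by (intro continuous_on_compose) (auto intro: continuous_on_subset)
  then have g: "continuous_on {0..l} g" unfolding g_def comp_def by (intro continuous_intros)
  have g0: "g 0 = 0" and gl: "g l \<ge> r2" using ends by (simp_all add: g_def)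
  have "closed {s \<in> {0..l}. g s \<in> {r2..}}"
    by (rule continuous_closed_preimage [unfolded vimage_def Int_def mem_Collect_eq]) (use g in auto)
  then have "compact ({0..l} \<inter> {s \<in> {0..l}. g s \<in> {r2..}})" by (intro compact_Int_closed) auto
  moreover have "l \<in> {0..l} \<inter> {s \<in> {0..l}. g s \<in> {r2..}}" using l gl by auto
  ultimately have "\<exists>b\<in>{0..l} \<inter> {s \<in> {0..l}. g s \<in> {r2..}}. \<forall>s\<in>{0..l} \<inter> {s \<in> {0..l}. g s \<in> {r2..}}. b \<le> s"
    by (intro compact_attains_inf) auto
  then obtain b where b: "b \<in> {0..l}" "g b \<ge> r2" "\<And>s. s \<in> {0..l} \<Longrightarrow> g s \<ge> r2 \<Longrightarrow> b \<le> s" by auto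
  have gb: "g b = r2"
  proof -
    obtain s where s: "0 \<le> s" "s \<le> b" "g s = r2"
      using IVT' [of g 0 r2 b] g0 b r continuous_on_subset [OF g, of "{0..b}"] by auto
    then show ?thesis using b by (metis atLeastAtMost_iff order.refl order.trans order_antisym)
  qed
  have "closed {s \<in> {0..b}. g s \<in> {..r1}}"
    by (rule continuous_closed_preimage [unfolded vimage_def Int_def mem_Collect_eq])
      (use g b continuous_on_subset [OF g, of "{0..b}"] in auto)
  then have "compact ({0..b} \<inter> {s \<in> {0..b}. g s \<in> {..r1}})" by (intro compact_Int_closed) auto
  moreover have "0 \<in> {0..b} \<inter> {s \<in> {0..b}. g s \<in> {..r1}}" using b g0 r by auto
  ultimately have "\<exists>a\<in>{0..b} \<inter> {s \<in> {0..b}. g s \<in> {..r1}}. \<forall>s\<in>{0..b} \<inter> {s \<in> {0..b}. g s \<in> {..r1}}. s \<le> a"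
    by (intro compact_attains_sup) auto
  then obtain a where a: "a \<in> {0..b}" "g a \<le> r1" "\<And>s. s \<in> {0..b} \<Longrightarrow> g s \<le> r1 \<Longrightarrow> s \<le> a" by auto
  have ga: "g a = r1"
  proof -
    obtain s where s: "a \<le> s" "s \<le> b" "g s = r1"
      using IVT' [of g a r1 b] a gb r b continuous_on_subset [OF g, of "{a..b}"] by auto
    then show ?thesis using a by (metis atLeastAtMost_iff order.refl order.trans order_antisym)
  qed
  have sub: "{a..b} \<subseteq> {0..l}" using a b by auto
  have "a \<noteq> b" using ga gb r by auto
  then have "a < b" using a by simp
  moreover have "g s < r2" if "s \<in> {a<..<b}" for s
  proof -
    have "s \<in> {0..l}" using that a(1) b(1) by auto
    then show ?thesis using that b(3) [of s] by (cases "g s \<ge> r2") auto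
  qed
  moreover have "g s > r1" if "s \<in> {a<..<b}" for s
  proof -
    have "s \<in> {0..b}" using that a(1) by auto
    then show ?thesis using that a(3) [of s] by (cases "g s \<le> r1") auto
  qed
  ultimately have "({a..b}, f \<circ> \<gamma>) \<in> joining_paths (sphere y0 r1) (sphere y0 r2) (annulus r1 r2 y0)"
    unfolding joining_paths_def
    using ga gb continuous_on_subset [OF f\<gamma> sub] by (auto simp: annulus_def g_def dist_commute)
  then have "({a..b}, \<gamma>) \<in> lifted_paths D f y0 r1 r2"
    unfolding lifted_paths_def using \<gamma> sub by (auto intro: continuous_on_subset)
  then show ?thesis using that sub by blast
qed

lemma broken_line_in_convex:
  assumes S: "convex S" "c \<in> S" "c + v \<in> S" "c + v + u \<in> S" and s: "s \<in> {0..norm v + norm u}"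
  shows "broken_line c v u s \<in> S"
proof -
  have seg: "e + t *\<^sub>R sgn w \<in> S" if "e \<in> S" "e + w \<in> S" "0 \<le> t" "t \<le> norm w" for e w t
  proof (cases "w = 0")
    case False
    have "e + t *\<^sub>R sgn w = (1 - t / norm w) *\<^sub>R e + (t / norm w) *\<^sub>R (e + w)"
      using False by (simp add: sgn_div_norm algebra_simps divide_inverse)
    also have "\<dots> \<in> S" using S(1) that False by (intro convexD) auto
    finally show ?thesis .
  qed (use that in simp)
  show ?thesis
    using seg [of c v s] seg [of "c + v" u "s - norm v"] S s by (auto simp: broken_line_def)
qed

text \<open>Admissible functions are Borel, so the completed measure in the definition may be
  exchanged for \<open>lborel\<close>.\<close>

lemma modulus_ge:
  assumes "\<And>\<rho>. \<rho> \<in> borel_measurable borel \<Longrightarrow> (\<And>\<gamma>. \<gamma> \<in> \<Gamma> \<Longrightarrow> locally_rectifiable \<gamma> \<Longrightarrow> line_integral \<rho> \<gamma> \<ge> 1)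
    \<Longrightarrow> m \<le> (\<integral>\<^sup>+ x. enn_powr (\<rho> x) p \<partial>lborel)"
  shows "m \<le> modulus p \<Gamma>"
  unfolding modulus_def
proof (rule INF_greatest)
  fix \<rho> assume "\<rho> \<in> admissible \<Gamma>"
  then have \<rho> [measurable]: "\<rho> \<in> borel_measurable borel" and "\<And>\<gamma>. \<gamma> \<in> \<Gamma> \<Longrightarrow> locally_rectifiable \<gamma> \<Longrightarrow> line_integral \<rho> \<gamma> \<ge> 1"
    by (auto simp: admissible_def)
  then have "m \<le> (\<integral>\<^sup>+ x. enn_powr (\<rho> x) p \<partial>lborel)" by (rule assms)
  also have "\<dots> = (\<integral>\<^sup>+ x. enn_powr (\<rho> x) p \<partial>lebesgue)"
    by (rule nn_integral_completion [symmetric]) measurable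
  finally show "m \<le> (\<integral>\<^sup>+ x. enn_powr (\<rho> x) p \<partial>lebesgue)" .
qed

text \<open>The lower bound from \<open>broken_line_capacity_positive\<close> depends on a connected
  piece of the fibre, the disc radius \<open>\<delta>\<close> and the vector \<open>u\<close>, all
  of which are fixed before \<open>r1\<close>. Whatever \<open>r1\<close> is, each broken line
  contains a path of the lifted family, so the modulus stays above that bound while
  \<open>small\<close> lets it tend to 0.\<close>

theorem fibre_totally_disconnected:
  fixes f :: "'a::euclidean_space \<Rightarrow> 'a"
  assumes n: "DIM('a) \<ge> 2" and p: "p > real DIM('a) - 1"
    and D: "is_domain D" and f: "continuous_on D f" "\<not> f constant_on D"
    and small: "r0 > 0" "\<And>r2 \<epsilon>. 0 < r2 \<Longrightarrow> r2 \<le> r0 \<Longrightarrow> 0 < \<epsilon> \<Longrightarrow>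
      \<exists>r1. 0 < r1 \<and> r1 < r2 \<and> modulus p (lifted_paths D f (f x) r1 r2) \<le> ennreal \<epsilon>"
    and C: "connected C" "C \<subseteq> {z \<in> D. f z = f x}" "x \<in> C"
  shows "C = {x}"
proof (rule ccontr)
  assume "C \<noteq> {x}"
  then obtain x' where x': "x' \<in> C" "x' \<noteq> x" using C(3) by blast
  have D': "open D" "connected D" using D by (auto simp: is_domain_def)
  define E where "E = {z \<in> D. f z = f x}"
  let ?thick = "\<lambda>z r. \<exists>K a b. K \<subseteq> ball z r \<inter> E \<and> connected K \<and> a \<in> K \<and> b \<in> K \<and> a \<noteq> b"
  \<comment> \<open>Arbitrarily small connected pieces are needed because the broken lines have to
    stay in a ball inside \<open>D\<close>, whereas \<open>C\<close> itself may be large.\<close>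
  define A where "A = {z \<in> D. \<forall>r>0. ?thick z r}"
  \<comment> \<open>Otherwise the component of \<open>x\<close> in the fibre would be trivial in a
    ball, and a normal neighbourhood of \<open>x\<close> without \<open>x'\<close> would exist. Its
    frontier misses the fibre, although the connected set \<open>C\<close> has to cross it.\<close>
  have "x \<in> A"
    unfolding A_def
  proof (intro CollectI conjI allI impI)
    show xD: "x \<in> D" using C by auto
    fix r :: real assume "r > 0"
    define U where "U = D \<inter> ball x r \<inter> - {x'}"
    have U: "open U" "x \<in> U" "U \<subseteq> D \<inter> ball x r" using D' xD x' \<open>r > 0\<close> by (auto simp: U_def)
    show "?thick x r"
    proof (rule ccontr)
      assume neg: "\<not> ?thesis"
      have light: "K = {x}" if "connected K" "K \<subseteq> {z \<in> D \<inter> ball x r. f z = f x}" "x \<in> K" for K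
      proof -
        have "K \<subseteq> ball x r \<inter> E" using that by (auto simp: E_def)
        then have "y = x" if "y \<in> K" for y
          using neg \<open>connected K\<close> \<open>x \<in> K\<close> that by blast
        then show ?thesis using \<open>x \<in> K\<close> by blast
      qed
      have cont: "continuous_on (D \<inter> ball x r) f" using f(1) by (rule continuous_on_subset) auto
      obtain V where V: "open V" "x \<in> V" "closure V \<subseteq> U" "f x \<notin> f ` frontier V"
        by (rule normal_neighbourhood_exists [OF cont U(1) U(3) U(2) light])
      have "x' \<notin> V" using V closure_subset by (auto simp: U_def)
      then have "C \<inter> frontier V \<noteq> {}" using C V x' by (intro connected_Int_frontier) auto
      then obtain q where q: "q \<in> C" "q \<in> frontier V" by blast
      then have "f q = f x" using C by auto
      then show False
        using V(4) q(2) by (metis imageI)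
    qed
  qed
  \<comment> \<open>\<open>A\<close> is always closed in \<open>D\<close>. If it lay in the interior
    of the fibre it would also be open, since every ball inside the fibre consists of points of
    \<open>A\<close>. By connectedness it would be all of \<open>D\<close>, and \<open>f\<close>
    would be constant.\<close>
  have "\<not> A \<subseteq> interior E"
  proof
    assume AE: "A \<subseteq> interior E"
    have "open A"
      unfolding open_contains_ball
    proof
      fix z assume "z \<in> A"
      then obtain e where e: "e > 0" "ball z e \<subseteq> E" using AE by (meson mem_interior subsetD)
      have "z' \<in> A" if z': "z' \<in> ball z e" for z'
        unfolding A_def
      proof (intro CollectI conjI allI impI)
        show "z' \<in> D" using e z' by (auto simp: E_def)
        fix r :: real assume r: "r > 0"
        obtain e' where e': "e' > 0" "ball z' e' \<subseteq> ball z e"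
          using z' by (meson open_ball open_contains_ball)
        define t where "t = min r e' / 2"
        have t: "t > 0" "t < r" "t < e'" using r e' by (auto simp: t_def)
        obtain i :: 'a where i: "i \<in> Basis" using nonempty_Basis by blast
        have "ball z' (min r e') \<subseteq> ball z' r \<inter> E" using e e' by auto
        moreover have "z' \<in> ball z' (min r e')" "z' + t *\<^sub>R i \<in> ball z' (min r e')" "z' \<noteq> z' + t *\<^sub>R i"
          using t r e' i nonzero_Basis [OF i] by (auto simp: dist_norm)
        ultimately show "?thick z' r" using connected_ball by blast
      qed
      then show "\<exists>e>0. ball z e \<subseteq> A" using e by blast
    qed
    moreover have "closedin (top_of_set D) A"
    proof -
      have "z \<in> A" if z: "z \<in> D" "z islimpt A" for z
        unfolding A_def
      proof (intro CollectI conjI allI impI)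
        show "z \<in> D" by fact
        fix r :: real assume "r > 0"
        then obtain z' where z': "z' \<in> A" "dist z' z < r"
          using z(2) by (auto simp: islimpt_approachable)
        have sub: "ball z' (r - dist z' z) \<subseteq> ball z r"
        proof
          fix q assume "q \<in> ball z' (r - dist z' z)"
          then show "q \<in> ball z r" using dist_triangle [of z q z'] by (simp add: dist_commute)
        qed
        have "r - dist z' z > 0" using z' by simp
        then obtain K a b where "K \<subseteq> ball z' (r - dist z' z) \<inter> E" "connected K" "a \<in> K" "b \<in> K" "a \<noteq> b"
          using z'(1) unfolding A_def by blast
        then show "?thick z r" using sub by blast
      qed
      moreover have "A \<subseteq> D" by (auto simp: A_def)
      ultimately show ?thesis
        by (auto simp: closedin_limpt)
    qed
    ultimately have "A = D"
      using D' \<open>x \<in> A\<close> connected_clopen [of D] openin_open_eq [of D A] by (auto simp: A_def)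
    then have "D \<subseteq> E" using AE interior_subset by blast
    then show False
      using f(2) by (auto simp: E_def constant_on_def)
  qed
  then obtain z where z: "z \<in> A" "z \<notin> interior E" by blast
  then obtain r where r: "r > 0" "ball z r \<subseteq> D" using D' by (auto simp: A_def open_contains_ball)
  obtain w where w: "w \<in> ball z r" "w \<notin> E" using z(2) r by (meson mem_interior subsetI)
  define d where "d = dist (f w) (f x)"
  have d: "d > 0" using w r by (auto simp: d_def E_def)
  \<comment> \<open>Near \<open>w\<close> the map varies by less than \<open>d / 2\<close>, so its
    values stay at distance at least \<open>d / 2\<close> from \<open>f x\<close>.\<close>
  define r2 where "r2 = min r0 (d / 2)"
  have r2: "r2 > 0" "r2 \<le> r0" "r2 < d" using small d by (auto simp: r2_def)
  obtain e where e: "e > 0" "\<And>\<zeta>. \<zeta> \<in> D \<Longrightarrow> dist \<zeta> w < e \<Longrightarrow> dist (f \<zeta>) (f w) < d / 2"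
  proof -
    have "w \<in> D" using w r by blast
    then obtain e where "e > 0" "\<forall>\<zeta>\<in>D. dist \<zeta> w < e \<longrightarrow> dist (f \<zeta>) (f w) < d / 2"
      using f(1) half_gt_zero [OF d] unfolding continuous_on_iff by blast
    then show ?thesis using that by blast
  qed
  obtain e' where e': "e' > 0" "ball w e' \<subseteq> ball z r"
    using w by (meson open_ball open_contains_ball)
  define \<delta> where "\<delta> = min (min e e') r / 2"
  have \<delta>: "\<delta> > 0" "2 * \<delta> \<le> e" "2 * \<delta> \<le> e'" "2 * \<delta> \<le> r" using e e' r by (auto simp: \<delta>_def)
  have far: "dist (f \<zeta>) (f x) \<ge> r2" "\<zeta> \<in> ball z r" if "dist \<zeta> w < 2 * \<delta>" for \<zeta>
  proof -
    have "\<zeta> \<in> ball w e'" using that \<delta> by (simp add: dist_commute)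
    then show "\<zeta> \<in> ball z r" using e' by blast
    then have "dist (f \<zeta>) (f w) < d / 2" using that \<delta> r by (intro e(2)) auto
    then show "dist (f \<zeta>) (f x) \<ge> r2"
      using dist_triangle [of "f w" "f x" "f \<zeta>"] by (simp add: d_def [symmetric] r2_def dist_commute)
  qed
  obtain K a b where K: "K \<subseteq> ball z \<delta> \<inter> E" "connected K" "a \<in> K" "b \<in> K" "a \<noteq> b"
    using z(1) \<delta>(1) unfolding A_def by blast
  \<comment> \<open>For \<open>c\<close> within \<open>\<delta>\<close> of \<open>z\<close> and
    \<open>norm v \<le> \<delta>\<close>, the endpoint \<open>c + v + u\<close> is within
    \<open>2 * \<delta>\<close> of \<open>w\<close>. All three vertices then lie in
    \<open>ball z r\<close>, and by convexity the whole broken line does.\<close>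
  define u where "u = w - z"
  have u: "u \<noteq> 0"
  proof
    assume "u = 0"
    then have "dist a w < 2 * \<delta>" using K \<delta> by (auto simp: u_def dist_commute)
    then show False
      using far(1) [of a] K r2 by (auto simp: E_def)
  qed
  obtain \<epsilon> where \<epsilon>: "\<epsilon> > 0"
    "\<And>\<rho>. \<rho> \<in> borel_measurable borel \<Longrightarrow>
      (\<And>c v. c \<in> K \<Longrightarrow> norm v \<le> \<delta> \<Longrightarrow> 1 \<le> broken_line_integral \<rho> c v u) \<Longrightarrow>
      ennreal \<epsilon> \<le> (\<integral>\<^sup>+ x. enn_powr (\<rho> x) p \<partial>lborel)"
    by (rule broken_line_capacity_positive [OF n p K(2-5) \<delta>(1), of u]) blast
  obtain r1 where r1: "0 < r1" "r1 < r2" "modulus p (lifted_paths D f (f x) r1 r2) \<le> ennreal (\<epsilon> / 2)"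
    using small(2) [of r2 "\<epsilon> / 2"] r2 \<epsilon>(1) by auto
  have "ennreal \<epsilon> \<le> modulus p (lifted_paths D f (f x) r1 r2)"
  proof (rule modulus_ge, rule \<epsilon>(2))
    fix \<rho> :: "'a \<Rightarrow> ennreal" and c v :: 'a
    assume \<rho>: "\<rho> \<in> borel_measurable borel"
      "\<And>\<gamma>. \<gamma> \<in> lifted_paths D f (f x) r1 r2 \<Longrightarrow> locally_rectifiable \<gamma> \<Longrightarrow> line_integral \<rho> \<gamma> \<ge> 1"
    assume cv: "c \<in> K" "norm v \<le> \<delta>"
    let ?\<gamma> = "broken_line c v u"
    have zc: "dist z c < \<delta>" "f c = f x" using cv K by (auto simp: E_def)
    have zcv: "dist z (c + v) < 2 * \<delta>"
      using zc(1) cv(2) dist_triangle [of z "c + v" c] by (simp add: dist_norm)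
    have "dist (c + v + u) w = dist z (c + v)"
      by (simp add: u_def dist_norm norm_minus_commute algebra_simps)
    then have tip: "dist (f (c + v + u)) (f x) \<ge> r2" "c + v + u \<in> ball z r" using far zcv by auto
    have "?\<gamma> s \<in> ball z r" if "s \<in> {0..norm v + norm u}" for s
      using that zc zcv tip \<delta> by (intro broken_line_in_convex) auto
    then have im: "?\<gamma> ` {0..norm v + norm u} \<subseteq> D" using r by auto
    have ends: "f (?\<gamma> 0) = f x" "dist (f (?\<gamma> (norm v + norm u))) (f x) \<ge> r2"
      using tip zc by (simp_all add: broken_line_ends)
    have nonneg: "0 \<le> norm v + norm u" by simp
    obtain a b where ab: "{a..b} \<subseteq> {0..norm v + norm u}" "({a..b}, ?\<gamma>) \<in> lifted_paths D f (f x) r1 r2"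
      by (rule lifted_paths_subpath [OF f(1) continuous_on_broken_line im r1(1,2) nonneg ends])
    have "1 \<le> line_integral \<rho> ({a..b}, ?\<gamma>)"
      using ab u by (intro \<rho>(2) locally_rectifiable_broken_line) auto
    also have "\<dots> \<le> broken_line_integral \<rho> c v u"
      using \<rho>(1) u ab(1) by (rule line_integral_broken_line_le)
    finally show "1 \<le> broken_line_integral \<rho> c v u" .
  qed
  also have "\<dots> \<le> ennreal (\<epsilon> / 2)" by fact
  finally show False
    using \<epsilon>(1) by (simp add: ennreal_le_iff)
qed

section \<open>Spherical means and small weights\<close>

lemma nn_integral_lborel_scaleR:
  fixes f :: "'a::euclidean_space \<Rightarrow> ennreal"
  assumes [measurable]: "f \<in> borel_measurable borel" and s: "s > 0"
  shows "(\<integral>\<^sup>+ x. f x \<partial>lborel) = ennreal (s ^ DIM('a)) * (\<integral>\<^sup>+ x. f (s *\<^sub>R x) \<partial>lborel)"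
  by (subst lborel_affine [of s 0]) (use s in \<open>simp_all add: nn_integral_density nn_integral_distr nn_integral_cmult\<close>)

text \<open>The integral of a Borel function against \<open>sphere_area\<close>, with the cone
  formula written out. This avoids the completed measure and makes the dependence on the radius
  visibly measurable.\<close>

definition sphere_integral :: "('a::euclidean_space \<Rightarrow> ennreal) \<Rightarrow> 'a \<Rightarrow> real \<Rightarrow> ennreal" where
  "sphere_integral g y0 r = ennreal (real DIM('a) * r ^ (DIM('a) - 1)) *
     (\<integral>\<^sup>+ x. g (y0 + r *\<^sub>R sgn x) * indicator (ball 0 1) x \<partial>lborel)"

abbreviation (input) sphere_weight :: "('a::euclidean_space \<Rightarrow> real) \<Rightarrow> 'a \<Rightarrow> real \<Rightarrow> ennreal" where
  "sphere_weight Q \<equiv> sphere_integral (\<lambda>y. ennreal (Q y))"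

lemma sets_ball [measurable]: "ball (x :: 'a::euclidean_space) r \<in> sets borel"
  by simp

lemma borel_measurable_sgn [measurable]: "sgn \<in> borel_measurable (borel :: 'a::euclidean_space measure)"
  unfolding sgn_div_norm [abs_def] by measurable

lemma borel_measurable_sphere_integral [measurable]:
  fixes y0 :: "'a::euclidean_space"
  assumes [measurable]: "g \<in> borel_measurable borel"
  shows "sphere_integral g y0 \<in> borel_measurable borel"
proof -
  have "(\<lambda>(r, x). g (y0 + r *\<^sub>R sgn x) * indicator (ball 0 1) x) \<in> borel_measurable (borel \<Otimes>\<^sub>M lborel)"
    by measurable
  then have [measurable]: "(\<lambda>r. \<integral>\<^sup>+ x. g (y0 + r *\<^sub>R sgn x) * indicator (ball 0 1) x \<partial>lborel)
      \<in> borel_measurable borel"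
    by (rule lborel.borel_measurable_nn_integral)
  show ?thesis unfolding sphere_integral_def [abs_def] by measurable
qed

lemma nn_integral_inverse_power:
  assumes "a > 0" and n: "n > 0"
  shows "(\<integral>\<^sup>+ s. ennreal (real n / s ^ (n + 1)) * indicator {a<..} s \<partial>lborel) = ennreal (1 / a ^ n)"
proof -
  have "(\<integral>\<^sup>+ s. ennreal (real n / s ^ (n + 1)) * indicator {a..} s \<partial>lborel) = ennreal (0 - (- (1 / a ^ n)))"
  proof (rule nn_integral_FTC_atLeast)
    show "(\<lambda>s. real n / s ^ (n + 1)) \<in> borel_measurable borel" by measurable
    show "((\<lambda>s. - (1 / s ^ n)) has_real_derivative real n / s ^ (n + 1)) (at s)" if "a \<le> s" for s
    proof -
      have "((\<lambda>s. - (1 / s ^ n)) has_real_derivative (real n * s ^ (n - 1)) / (s ^ n * s ^ n)) (at s)"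
        using that assms by (auto intro!: derivative_eq_intros)
      moreover have "(real n * s ^ (n - 1)) / (s ^ n * s ^ n) = real n / s ^ (n + 1)"
        using that assms by (cases n) (auto simp: field_simps)
      ultimately show ?thesis by simp
    qed
    show "((\<lambda>s::real. - (1 / s ^ n)) \<longlongrightarrow> 0) at_top"
    proof -
      have "((\<lambda>s::real. inverse (s ^ n)) \<longlongrightarrow> 0) at_top"
        using n by (intro tendsto_inverse_0_at_top filterlim_pow_at_top filterlim_ident) auto
      then have "((\<lambda>s::real. - inverse (s ^ n)) \<longlongrightarrow> - 0) at_top" by (rule tendsto_minus)
      then show ?thesis by (simp add: inverse_eq_divide)
    qed
  qed (use assms in auto)
  moreover have "(\<integral>\<^sup>+ s. ennreal (real n / s ^ (n + 1)) * indicator {a..} s \<partial>lborel)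
      = (\<integral>\<^sup>+ s. ennreal (real n / s ^ (n + 1)) * indicator {a<..} s \<partial>lborel)"
    by (rule nn_integral_cong_AE)
      (use AE_lborel_singleton [of a] in \<open>auto simp: indicator_def elim!: AE_mp\<close>)
  ultimately show ?thesis by simp
qed

text \<open>Follows from the cone formula by substitution alone. Setting
  \<open>r = norm x * s\<close> turns \<open>r *\<^sub>R sgn x\<close> into
  \<open>s *\<^sub>R x\<close>, and \<open>w = s *\<^sub>R x\<close> is then the new space variable,
  restricted to \<open>norm w < s\<close>. What remains is the integral of n / s^(n+1) over s above
  the norm of \<open>w\<close>, which cancels the accumulated factor
  \<open>norm w ^ DIM('a)\<close>. The origin has to be excluded throughout, and is
  negligible.\<close>

lemma nn_integral_polar:
  fixes y0 :: "'a::euclidean_space"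
  assumes [measurable]: "g \<in> borel_measurable borel"
  shows "(\<integral>\<^sup>+ r \<in> {0<..}. sphere_integral g y0 r \<partial>lborel) = (\<integral>\<^sup>+ y. g y \<partial>lborel)"
proof -
  let ?n = "DIM('a)"
  let ?B = "indicator (ball 0 1) :: 'a \<Rightarrow> ennreal"
  let ?F1 = "\<lambda>x r. ennreal (real ?n * r ^ (?n - 1)) * (g (y0 + r *\<^sub>R sgn x) * ?B x) * indicator {0<..} r"
  let ?F2 = "\<lambda>x s. ennreal (real ?n * s ^ (?n - 1)) * (ennreal (norm x ^ ?n) * (g (y0 + s *\<^sub>R x) * ?B x)) * indicator {0<..} s"
  let ?F3 = "\<lambda>s w. (ennreal (norm w ^ ?n) * g (y0 + w)) * (ennreal (real ?n / s ^ (?n + 1)) * (if norm w < s then 1 else 0))"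
  have n: "?n > 0" by simp
  have "(\<integral>\<^sup>+ r \<in> {0<..}. sphere_integral g y0 r \<partial>lborel)
      = (\<integral>\<^sup>+ r. \<integral>\<^sup>+ x. ?F1 x r \<partial>lborel \<partial>lborel)"
    by (simp add: sphere_integral_def nn_integral_cmult nn_integral_multc)
  also have "\<dots> = (\<integral>\<^sup>+ x. \<integral>\<^sup>+ r. ?F1 x r \<partial>lborel \<partial>lborel)"
    by (rule nn_integral_lborel_swap) measurable
  also have "\<dots> = (\<integral>\<^sup>+ x. \<integral>\<^sup>+ s. ?F2 x s \<partial>lborel \<partial>lborel)"
  proof (rule nn_integral_cong_AE, rule AE_mp [OF AE_lborel_singleton [of 0]], intro AE_I2 impI)
    fix x :: 'a assume x: "x \<noteq> 0"
    have "(\<integral>\<^sup>+ r. ?F1 x r \<partial>lborel) = ennreal \<bar>norm x\<bar> * (\<integral>\<^sup>+ s. ?F1 x (0 + norm x * s) \<partial>lborel)"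
      using x by (intro nn_integral_real_affine) auto
    also have "\<dots> = (\<integral>\<^sup>+ s. ennreal (norm x) * ?F1 x (norm x * s) \<partial>lborel)"
      by (simp add: nn_integral_cmult)
    also have "\<dots> = (\<integral>\<^sup>+ s. ?F2 x s \<partial>lborel)"
    proof (rule nn_integral_cong)
      fix s :: real
      show "ennreal (norm x) * ?F1 x (norm x * s)
        = ?F2 x s"
      proof (cases "s > 0")
        case True
        have "(norm x * s) *\<^sub>R sgn x = s *\<^sub>R x" using x by (simp add: sgn_div_norm)
        moreover have "norm x * (real ?n * (norm x * s) ^ (?n - 1)) = (real ?n * s ^ (?n - 1)) * norm x ^ ?n"
          using n by (cases ?n) (simp_all add: power_mult_distrib)
        then have "ennreal (norm x) * ennreal (real ?n * (norm x * s) ^ (?n - 1))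
            = ennreal (real ?n * s ^ (?n - 1)) * ennreal (norm x ^ ?n)"
          using True by (simp add: ennreal_mult' [symmetric])
        ultimately show ?thesis
          using True x by (simp add: mult.assoc [symmetric])
      next
        case False
        then show ?thesis using x by (simp add: zero_less_mult_iff)
      qed
    qed
    finally show "(\<integral>\<^sup>+ r. ?F1 x r \<partial>lborel) = \<dots>" .
  qed
  also have "\<dots> = (\<integral>\<^sup>+ s. \<integral>\<^sup>+ x. ?F2 x s \<partial>lborel \<partial>lborel)"
    by (rule nn_integral_lborel_swap) measurable
  also have "\<dots> = (\<integral>\<^sup>+ s. \<integral>\<^sup>+ w. ?F3 s w \<partial>lborel \<partial>lborel)"
  proof (rule nn_integral_cong)
    fix s :: real
    show "(\<integral>\<^sup>+ x. ?F2 x s \<partial>lborel)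
      = (\<integral>\<^sup>+ w. ?F3 s w \<partial>lborel)"
    proof (cases "s > 0")
      case True
      have "(\<integral>\<^sup>+ w. ?F3 s w \<partial>lborel) = ennreal (s ^ ?n) * (\<integral>\<^sup>+ x. ?F3 s (s *\<^sub>R x) \<partial>lborel)"
        using True by (intro nn_integral_lborel_scaleR) measurable
      also have "\<dots> = (\<integral>\<^sup>+ x. ennreal (s ^ ?n) * ?F3 s (s *\<^sub>R x) \<partial>lborel)"
        by (simp add: nn_integral_cmult)
      also have "\<dots> = (\<integral>\<^sup>+ x. ?F2 x s \<partial>lborel)"
      proof (rule nn_integral_cong)
        fix x :: 'a
        have *: "s ^ ?n * (norm (s *\<^sub>R x) ^ ?n * (real ?n / s ^ (?n + 1))) = (real ?n * s ^ (?n - 1)) * norm x ^ ?n"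
          using True n by (cases ?n) (simp_all add: power_mult_distrib field_simps)
        have **: "ennreal (s ^ ?n) * (ennreal (norm (s *\<^sub>R x) ^ ?n) * ennreal (real ?n / s ^ (?n + 1)))
            = ennreal (real ?n * s ^ (?n - 1)) * ennreal (norm x ^ ?n)"
        proof -
          have "0 \<le> s ^ ?n" "0 \<le> norm (s *\<^sub>R x) ^ ?n" "0 \<le> real ?n / s ^ (?n + 1)"
            "0 \<le> real ?n * s ^ (?n - 1)" "0 \<le> norm x ^ ?n"
            using True by auto
          then show ?thesis using * by (simp only: ennreal_mult [symmetric] mult_nonneg_nonneg)
        qed
        have ind: "(if norm (s *\<^sub>R x) < s then 1 else 0) = ?B x"
          using True by (auto simp: indicator_def)
        have rearrange: "a * ((b * G) * (c * d)) = (a * (b * c)) * (G * d)" for a b c d G :: ennreal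
          by (simp add: ac_simps)
        show "ennreal (s ^ ?n) * ?F3 s (s *\<^sub>R x)
          = ?F2 x s"
          unfolding ind rearrange ** using True by (simp add: mult.assoc)
      qed
      finally show ?thesis ..
    next
      case False
      have "\<not> norm w < s" for w :: 'a
        using False norm_ge_zero [of w] by linarith
      then show ?thesis using False by simp
    qed
  qed
  also have "\<dots> = (\<integral>\<^sup>+ w. \<integral>\<^sup>+ s. ?F3 s w \<partial>lborel \<partial>lborel)"
    by (rule nn_integral_lborel_swap) measurable
  also have "\<dots> = (\<integral>\<^sup>+ w. g (y0 + w) \<partial>lborel)"
  proof (rule nn_integral_cong_AE, rule AE_mp [OF AE_lborel_singleton [of 0]], intro AE_I2 impI)
    fix w :: 'a assume w: "w \<noteq> 0"
    have "(\<integral>\<^sup>+ s. ?F3 s w \<partial>lborel)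
       = (ennreal (norm w ^ ?n) * g (y0 + w)) * ennreal (1 / norm w ^ ?n)"
    proof -
      have ind: "(if norm w < s then 1 else 0) = (indicator {norm w<..} s :: ennreal)" for s
        by simp
      have "(\<integral>\<^sup>+ s. ennreal (real ?n / s ^ (?n + 1)) * indicator {norm w<..} s \<partial>lborel) = ennreal (1 / norm w ^ ?n)"
        using w by (intro nn_integral_inverse_power) auto
      then show ?thesis unfolding ind by (subst nn_integral_cmult) auto
    qed
    also have "\<dots> = (ennreal (norm w ^ ?n) * ennreal (1 / norm w ^ ?n)) * g (y0 + w)"
      by (simp add: ac_simps)
    also have "ennreal (norm w ^ ?n) * ennreal (1 / norm w ^ ?n) = 1"
      using w by (simp add: ennreal_mult' [symmetric])
    finally show "(\<integral>\<^sup>+ s. ?F3 s w \<partial>lborel)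
       = g (y0 + w)" by simp
  qed
  also have "\<dots> = (\<integral>\<^sup>+ y. g y \<partial>lborel)" by (rule nn_integral_lborel_translate) measurable
  finally show ?thesis .
qed

lemma sphere_integral_radial:
  fixes y0 :: "'a::euclidean_space"
  assumes [measurable]: "g \<in> borel_measurable borel" "\<phi> \<in> borel_measurable borel" and r: "r > 0"
  shows "sphere_integral (\<lambda>y. g y * \<phi> (dist y y0)) y0 r = sphere_integral g y0 r * \<phi> r"
proof -
  have "(\<integral>\<^sup>+ x. g (y0 + r *\<^sub>R sgn x) * \<phi> (dist (y0 + r *\<^sub>R sgn x) y0) * indicator (ball 0 1) x \<partial>lborel)
     = (\<integral>\<^sup>+ x. (g (y0 + r *\<^sub>R sgn x) * indicator (ball 0 1) x) * \<phi> r \<partial>lborel)"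
    by (rule nn_integral_cong_AE, rule AE_mp [OF AE_lborel_singleton [of 0]])
      (use r in \<open>auto simp: dist_norm norm_sgn ac_simps\<close>)
  also have "\<dots> = (\<integral>\<^sup>+ x. g (y0 + r *\<^sub>R sgn x) * indicator (ball 0 1) x \<partial>lborel) * \<phi> r"
    by (rule nn_integral_multc) measurable
  finally show ?thesis by (simp add: sphere_integral_def mult.assoc)
qed

lemma nn_integral_polar_radial:
  fixes y0 :: "'a::euclidean_space"
  assumes [measurable]: "g \<in> borel_measurable borel" "\<phi> \<in> borel_measurable borel" and \<phi>: "\<And>t. t \<le> 0 \<Longrightarrow> \<phi> t = 0"
  shows "(\<integral>\<^sup>+ y. g y * \<phi> (dist y y0) \<partial>lborel) = (\<integral>\<^sup>+ r. sphere_integral g y0 r * \<phi> r \<partial>lborel)"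
proof -
  have "(\<integral>\<^sup>+ y. g y * \<phi> (dist y y0) \<partial>lborel)
      = (\<integral>\<^sup>+ r \<in> {0<..}. sphere_integral (\<lambda>y. g y * \<phi> (dist y y0)) y0 r \<partial>lborel)"
    by (rule nn_integral_polar [symmetric]) measurable
  also have "\<dots> = (\<integral>\<^sup>+ r. sphere_integral g y0 r * \<phi> r \<partial>lborel)"
    by (rule nn_integral_cong) (auto simp: indicator_def sphere_integral_radial \<phi>)
  finally show ?thesis .
qed

lemma nn_integral_sphere_area:
  fixes y0 :: "'a::euclidean_space"
  assumes [measurable]: "g \<in> borel_measurable borel"
  shows "(\<integral>\<^sup>+ y. g y \<partial>sphere_area y0 r) = sphere_integral g y0 r"
proof -
  define T where "T = (\<lambda>x. y0 + r *\<^sub>R sgn (x :: 'a))"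
  have [measurable]: "T \<in> borel_measurable borel" unfolding T_def by measurable
  have T' [measurable]: "T \<in> restrict_space lborel (ball 0 1) \<rightarrow>\<^sub>M borel"
    by (rule measurable_restrict_space1) simp
  have "(\<integral>\<^sup>+ y. g y \<partial>sphere_area y0 r)
      = ennreal (real DIM('a) * r ^ (DIM('a) - 1)) * (\<integral>\<^sup>+ y. g y \<partial>distr (restrict_space lborel (ball 0 1)) borel T)"
    unfolding sphere_area_def T_def [symmetric]
    by (subst nn_integral_completion) (simp_all add: nn_integral_scale_measure)
  also have "(\<integral>\<^sup>+ y. g y \<partial>distr (restrict_space lborel (ball 0 1)) borel T)
      = (\<integral>\<^sup>+ x. g (T x) \<partial>restrict_space lborel (ball 0 1))"
    by (rule nn_integral_distr) measurable
  also have "\<dots> = (\<integral>\<^sup>+ x. g (T x) * indicator (ball 0 1) x \<partial>lborel)"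
    by (subst nn_integral_restrict_space) auto
  finally show ?thesis by (simp add: sphere_integral_def T_def)
qed

lemma sets_sphere_area: "A \<in> sets borel \<Longrightarrow> A \<in> sets (sphere_area y0 r)"
  unfolding sphere_area_def by (rule sets_completionI_sets) simp

lemma sphere_integral_indicator_sphere:
  fixes y0 :: "'a::euclidean_space"
  assumes "r > 0"
  shows "sphere_integral (\<lambda>y. g y * indicator (sphere y0 r) y) y0 r = sphere_integral g y0 r"
proof -
  have "(\<integral>\<^sup>+ x. g (y0 + r *\<^sub>R sgn x) * indicator (sphere y0 r) (y0 + r *\<^sub>R sgn x) * indicator (ball 0 1) x \<partial>lborel)
     = (\<integral>\<^sup>+ x. g (y0 + r *\<^sub>R sgn x) * indicator (ball 0 1) x \<partial>lborel)"
    by (rule nn_integral_cong_AE, rule AE_mp [OF AE_lborel_singleton [of 0]])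
      (use assms in \<open>auto simp: dist_norm norm_sgn indicator_def\<close>)
  then show ?thesis by (simp add: sphere_integral_def)
qed

definition unit_sphere_area :: "'a::euclidean_space itself \<Rightarrow> real" where
  "unit_sphere_area _ = real DIM('a) * unit_ball_vol (real DIM('a))"

lemma unit_sphere_area_pos: "unit_sphere_area TYPE('a::euclidean_space) > 0"
  by (simp add: unit_sphere_area_def)

lemma emeasure_unit_sphere:
  "emeasure (sphere_area (0::'a::euclidean_space) 1) (sphere 0 1) = ennreal (unit_sphere_area TYPE('a))"
proof -
  have [measurable]: "sphere (0::'a) 1 \<in> sets borel" by (simp add: borel_closed)
  have "emeasure (sphere_area (0::'a) 1) (sphere 0 1) = (\<integral>\<^sup>+ y. indicator (sphere 0 1) y \<partial>sphere_area (0::'a) 1)"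
    by (simp add: sets_sphere_area)
  also have "\<dots> = sphere_integral (\<lambda>y. 1 * indicator (sphere 0 1) y) (0::'a) 1"
    by (subst nn_integral_sphere_area) auto
  also have "\<dots> = sphere_integral (\<lambda>_. 1) (0::'a) 1" by (rule sphere_integral_indicator_sphere) simp
  also have "\<dots> = ennreal (unit_sphere_area TYPE('a))"
    by (simp add: sphere_integral_def emeasure_ball unit_sphere_area_def ennreal_mult)
  finally show ?thesis .
qed

lemma sphere_mean_eq:
  fixes y0 :: "'a::euclidean_space"
  assumes [measurable]: "Q \<in> borel_measurable borel" and r: "r > 0"
  shows "sphere_mean Q y0 r
    = sphere_weight Q y0 r / ennreal (unit_sphere_area TYPE('a) * r ^ (DIM('a) - 1))"
proof -
  have [measurable]: "sphere y0 r \<in> sets borel" by (simp add: borel_closed)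
  have "(\<integral>\<^sup>+ y \<in> sphere y0 r. ennreal (Q y) \<partial>sphere_area y0 r) = sphere_weight Q y0 r"
    using r by (subst nn_integral_sphere_area) (auto simp: sphere_integral_indicator_sphere)
  then show ?thesis
    using unit_sphere_area_pos [where 'a = 'a] r
    by (simp add: sphere_mean_def emeasure_unit_sphere ennreal_mult')
qed

text \<open>By polar coordinates a Borel null set of the space meets almost every sphere about
  \<open>y0\<close> in a set of area zero. This is what allows a Lebesgue measurable
  \<open>Q\<close> to be exchanged for a Borel representative in the conditions on spherical
  means.\<close>

lemma sphere_mean_cong_AE:
  fixes y0 :: "'a::euclidean_space"
  assumes eq: "AE y in lborel. Q y = Q' y"
  shows "AE r in lborel. r > 0 \<longrightarrow> sphere_mean Q y0 r = sphere_mean Q' y0 r"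
proof -
  obtain N where N: "{y \<in> space lborel. Q y \<noteq> Q' y} \<subseteq> N" "emeasure lborel N = 0" "N \<in> sets lborel"
    using eq by (rule AE_E)
  then have [measurable]: "N \<in> sets borel" by simp
  have "(\<integral>\<^sup>+ r \<in> {0<..}. sphere_integral (indicator N) y0 r \<partial>lborel) = 0"
    using N by (subst nn_integral_polar) auto
  then have "AE r in lborel. sphere_integral (indicator N) y0 r * indicator {0<..} r = 0"
    by (subst (asm) nn_integral_0_iff_AE) auto
  then show ?thesis
  proof (rule AE_mp, intro AE_I2 impI)
    fix r :: real
    assume "sphere_integral (indicator N) y0 r * indicator {0<..} r = 0" and r: "r > 0"
    then have "sphere_integral (indicator N) y0 r = 0" by simp
    then have "(\<integral>\<^sup>+ y. indicator N y \<partial>sphere_area y0 r) = 0" by (subst nn_integral_sphere_area) auto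
    then have "emeasure (sphere_area y0 r) N = 0" by (simp add: sets_sphere_area)
    then have "N \<in> null_sets (sphere_area y0 r)" by (simp add: null_sets_def sets_sphere_area)
    then have "AE y in sphere_area y0 r. Q y = Q' y" using N(1) by (intro AE_I') auto
    then have "(\<integral>\<^sup>+ y \<in> sphere y0 r. ennreal (Q y) \<partial>sphere_area y0 r)
        = (\<integral>\<^sup>+ y \<in> sphere y0 r. ennreal (Q' y) \<partial>sphere_area y0 r)"
      by (intro nn_integral_cong_AE) auto
    then show "sphere_mean Q y0 r = sphere_mean Q' y0 r" by (simp add: sphere_mean_def)
  qed
qed

text \<open>Enlarging the domain to the full annulus makes the weight radial, and polar coordinates
  reduce the integral to one variable.\<close>

lemma annulus_integral_le:
  fixes y0 :: "'a::euclidean_space"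
  assumes eq: "AE y in lborel. Q y = Q' y" and [measurable]: "Q' \<in> borel_measurable borel"
    and [measurable]: "\<eta> \<in> borel_measurable borel" and r1: "r1 \<ge> 0"
  shows "(\<integral>\<^sup>+ y \<in> S \<inter> annulus r1 r2 y0. ennreal (Q y) * enn_powr (\<eta> (dist y y0)) p \<partial>lebesgue)
    \<le> (\<integral>\<^sup>+ t \<in> {r1<..<r2}. sphere_weight Q' y0 t * enn_powr (\<eta> t) p \<partial>lborel)"
proof -
  have eq': "AE y in lebesgue. Q y = Q' y" using eq by (rule AE_completion)
  let ?\<phi> = "\<lambda>t. enn_powr (\<eta> t) p * indicator {r1<..<r2} t"
  have "(\<integral>\<^sup>+ y \<in> S \<inter> annulus r1 r2 y0. ennreal (Q y) * enn_powr (\<eta> (dist y y0)) p \<partial>lebesgue)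
      \<le> (\<integral>\<^sup>+ y. ennreal (Q' y) * ?\<phi> (dist y y0) \<partial>lebesgue)"
  proof (rule nn_integral_mono_AE, rule AE_mp [OF eq'], intro AE_I2 impI)
    fix y assume "Q y = Q' y"
    then show "ennreal (Q y) * enn_powr (\<eta> (dist y y0)) p * indicator (S \<inter> annulus r1 r2 y0) y
        \<le> ennreal (Q' y) * ?\<phi> (dist y y0)"
      by (auto simp: indicator_def annulus_def)
  qed
  also have "\<dots> = (\<integral>\<^sup>+ y. ennreal (Q' y) * ?\<phi> (dist y y0) \<partial>lborel)"
    by (rule nn_integral_completion) measurable
  also have "\<dots> = (\<integral>\<^sup>+ t. sphere_weight Q' y0 t * ?\<phi> t \<partial>lborel)"
    using r1 by (intro nn_integral_polar_radial) auto
  finally show ?thesis by (simp add: mult.assoc)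
qed

section \<open>Radial weights of small cost\<close>

text \<open>For b = n - 1 and \<open>m\<close> the spherical mean this is the integrand of the
  divergence condition. Up to a constant it is s^(-1/(p-1)), with s the integral over the sphere,
  the function that minimises the integral of s \<eta>^p for a given integral of \<eta>.\<close>

abbreviation (input) extremal_weight :: "real \<Rightarrow> real \<Rightarrow> ennreal \<Rightarrow> real \<Rightarrow> ennreal" where
  "extremal_weight b p m t \<equiv> 1 / (ennreal (t powr (b / (p - 1))) * enn_powr m (1 / (p - 1)))"

text \<open>For \<open>s t\<close> the integral of \<open>Q\<close> over the sphere of radius \<open>t\<close> about \<open>y\<^sub>0\<close>, this bounds the right-hand
  side of the modulus inequality.\<close>

definition small_weights :: "(real \<Rightarrow> ennreal) \<Rightarrow> real \<Rightarrow> real \<Rightarrow> bool" where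
  "small_weights s p r2 \<longleftrightarrow> (\<forall>\<epsilon>>0. \<exists>r1 \<eta>. 0 < r1 \<and> r1 < r2 \<and> \<eta> \<in> borel_measurable borel \<and>
     (\<integral>\<^sup>+ t \<in> {r1<..<r2}. \<eta> t \<partial>lborel) \<ge> 1 \<and>
     (\<integral>\<^sup>+ t \<in> {r1<..<r2}. s t * enn_powr (\<eta> t) p \<partial>lborel) \<le> ennreal \<epsilon>)"

lemma enn_powr_mult_ennreal:
  assumes "c \<ge> 0"
  shows "enn_powr (x * ennreal c) p \<le> enn_powr x p * ennreal (c powr p)"
proof (cases x)
  case (real r)
  then show ?thesis
    using assms by (simp add: enn_powr_def ennreal_mult' [symmetric] powr_mult mult.commute)
next
  case top
  then show ?thesis using assms by (cases "c = 0") (auto simp: enn_powr_def ennreal_top_mult)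
qed

text \<open>For finite positive \<open>s\<close> equality holds: the reciprocal \<open>y\<close> of
  the weight satisfies \<open>y powr (p - 1) = s / w\<close>. Only the inequality is stated so that
  the extreme values are covered: for \<open>s = 0\<close> the left side is 0 although the weight is
  infinite, and for \<open>s = \<infinity>\<close> the weight is 0.\<close>

lemma extremal_weight_identity:
  fixes s :: ennreal and t w p b :: real
  assumes t: "t > 0" and w: "w > 0" and p: "p > 1"
  defines "m \<equiv> s / ennreal (w * t powr b)"
  defines "\<psi> \<equiv> extremal_weight b p m t"
  shows "s * enn_powr \<psi> p \<le> ennreal w * \<psi>"
proof -
  define c where "c = w * t powr b"
  have c: "c > 0" using t w by (simp add: c_def)
  show ?thesis
  proof (cases s)
    case top
    then have "m = \<infinity>" by (simp add: m_def ennreal_top_divide)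
    then have "\<psi> = 0" using t by (simp add: \<psi>_def enn_powr_def ennreal_mult_top)
    then show ?thesis using p by (simp add: enn_powr_def)
  next
    case (real a)
    show ?thesis
    proof (cases "a = 0")
      case True
      then show ?thesis using real by simp
    next
      case False
      define x where "x = a / c"
      have a: "a > 0" and x: "x > 0" "a = w * t powr b * x"
        using False real c by (auto simp: x_def c_def)
      have m: "m = ennreal x"
        using real c by (simp add: m_def c_def [symmetric] divide_ennreal x_def)
      define y where "y = t powr (b / (p - 1)) * x powr (1 / (p - 1))"
      have y: "y > 0" using t x by (simp add: y_def)
      have \<psi>: "\<psi> = ennreal (1 / y)"
        using t x y divide_ennreal [of 1 y] by (simp add: \<psi>_def m enn_powr_def ennreal_mult' [symmetric] y_def)
      have yx: "t powr b * x = y powr (p - 1)" using t x p by (simp add: y_def powr_mult powr_powr)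
      have "(1 / y) powr p = y powr (- p)" using y by (simp add: powr_divide powr_minus_divide)
      then have "a * (1 / y) powr p = w * (y powr (p - 1) * y powr (- p))"
        unfolding x(2) yx [symmetric] by simp
      also have "\<dots> = w * (1 / y)" using y by (simp add: powr_diff powr_minus_divide)
      finally have "a * (1 / y) powr p = w * (1 / y)" .
      moreover have "s * enn_powr \<psi> p = ennreal (a * (1 / y) powr p)"
        using real y by (simp add: \<psi> enn_powr_def ennreal_mult' [symmetric])
      moreover have "ennreal w * \<psi> = ennreal (w * (1 / y))" using w by (simp only: \<psi> ennreal_mult')
      ultimately show ?thesis
        by simp
    qed
  qed
qed

text \<open>Cut off at \<open>r1\<close>, the divergent integral has a finite value
  \<open>J\<close>. Dividing the extremal weight by \<open>J\<close> makes it admissible at a cost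
  of at most \<open>w * J powr (1 - p)\<close>, and \<open>J\<close> grows without bound as
  \<open>r1\<close> tends to 0.\<close>

lemma small_weights_of_divergence:
  fixes s :: "real \<Rightarrow> ennreal" and w p b r2 :: real
  assumes s [measurable]: "s \<in> borel_measurable borel" and w: "w > 0" and p: "p > 1" and r2: "r2 > 0"
  defines "\<psi> \<equiv> \<lambda>t. extremal_weight b p (s t / ennreal (w * t powr b)) t"
  assumes fin: "\<And>r. 0 < r \<Longrightarrow> r < r2 \<Longrightarrow> (\<integral>\<^sup>+ t \<in> {r<..<r2}. \<psi> t \<partial>lborel) < \<infinity>"
    and inf: "(\<integral>\<^sup>+ t \<in> {0<..<r2}. \<psi> t \<partial>lborel) = \<infinity>"
  shows "small_weights s p r2"
  unfolding small_weights_def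
proof (intro allI impI, goal_cases)
  case \<epsilon>: (1 \<epsilon>)
  \<comment> \<open>The denominator \<open>k + 2\<close> keeps the left endpoints strictly between 0
    and \<open>r2\<close>.\<close>
  let ?J = "\<lambda>k. {r2 / real (k + 2)<..<r2}"
  have [measurable]: "\<psi> \<in> borel_measurable borel" unfolding \<psi>_def by measurable
  have "((\<lambda>J. w * J powr (1 - p)) \<longlongrightarrow> w * 0) at_top"
    using p by (intro tendsto_mult tendsto_const tendsto_neg_powr filterlim_ident) auto
  then have "\<forall>\<^sub>F J in at_top. w * J powr (1 - p) < \<epsilon>" using \<epsilon> by (intro order_tendstoD(2)) auto
  then obtain N where N: "\<And>J. J \<ge> N \<Longrightarrow> w * J powr (1 - p) < \<epsilon>"
    by (auto simp: eventually_at_top_linorder)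
  define I where "I = (\<lambda>k. \<integral>\<^sup>+ t \<in> ?J k. \<psi> t \<partial>lborel)"
  have "(SUP k. I k) = (\<integral>\<^sup>+ t. (SUP k. \<psi> t * indicator (?J k) t) \<partial>lborel)"
    unfolding I_def
  proof (rule nn_integral_monotone_convergence_SUP [symmetric])
    show "incseq (\<lambda>k t. \<psi> t * indicator (?J k) t)"
    proof (intro incseq_SucI le_funI mult_left_mono)
      fix k t
      have "r2 / real (Suc k + 2) \<le> r2 / real (k + 2)" using r2 by (intro divide_left_mono) auto
      then show "indicator (?J k) t \<le> (indicator {r2 / real (Suc k + 2)<..<r2} t :: ennreal)"
        by (auto simp: indicator_def)
    qed simp
  qed measurable
  also have "\<dots> = (\<integral>\<^sup>+ t \<in> {0<..<r2}. \<psi> t \<partial>lborel)"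
  proof (rule nn_integral_cong)
    fix t :: real
    have "(SUP k. \<psi> t * indicator (?J k) t) = \<psi> t * (SUP k. indicator (?J k) t)"
      by (rule SUP_mult_left_ennreal [symmetric])
    also have "(SUP k. indicator (?J k) t :: ennreal) = indicator {0<..<r2} t"
    proof (cases "t \<in> {0<..<r2}")
      case True
      obtain k where k: "r2 / t < real k" using reals_Archimedean2 by blast
      then have "r2 < t * real k" using True by (simp add: pos_divide_less_eq mult.commute)
      also have "\<dots> \<le> t * real (k + 2)" using True by simp
      finally have "r2 / real (k + 2) < t" by (simp add: pos_divide_less_eq)
      then have "(1::ennreal) \<le> indicator (?J k) t" using True by simp
      then have "1 \<le> (SUP k. indicator (?J k) t :: ennreal)" by (rule SUP_upper2 [rotated]) simp
      moreover have "(SUP k. indicator (?J k) t :: ennreal) \<le> 1"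
        by (intro SUP_least) (simp add: indicator_def)
      ultimately show ?thesis
        using True by (simp add: antisym)
    next
      case False
      have "indicator (?J k) t = (0::ennreal)" for k
      proof -
        have "0 < r2 / real (k + 2)" using r2 by simp
        then have "t \<notin> ?J k" using False by auto
        then show ?thesis by simp
      qed
      then show ?thesis using False by simp
    qed
    finally show "(SUP k. \<psi> t * indicator (?J k) t) = \<psi> t * indicator {0<..<r2} t" .
  qed
  finally have "(SUP k. I k) = \<infinity>" using inf by simp
  then have "ennreal (max N 1) < (SUP k. I k)" by (simp only: infinity_ennreal_def ennreal_less_top)
  then obtain k where k: "ennreal (max N 1) < I k" by (auto simp: less_SUP_iff)
  define r1 where "r1 = r2 / real (k + 2)"
  have r1: "0 < r1" "r1 < r2" using r2 by (auto simp: r1_def field_simps add_pos_nonneg)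
  have Ik: "I k = (\<integral>\<^sup>+ t \<in> {r1<..<r2}. \<psi> t \<partial>lborel)" by (simp add: I_def r1_def)
  then have "I k < \<infinity>" using fin [OF r1] by simp
  then obtain J where J: "I k = ennreal J" "J \<ge> 0" by (cases "I k") auto
  have J1: "J \<ge> N" "J \<ge> 1" using k J by (auto simp: ennreal_less_iff)
  define \<eta> where "\<eta> = (\<lambda>t. \<psi> t * ennreal (1 / J))"
  have [measurable]: "\<eta> \<in> borel_measurable borel" unfolding \<eta>_def by measurable
  have "(\<integral>\<^sup>+ t \<in> {r1<..<r2}. \<eta> t \<partial>lborel) = (\<integral>\<^sup>+ t. (\<psi> t * indicator {r1<..<r2} t) * ennreal (1 / J) \<partial>lborel)"
    by (simp add: \<eta>_def ac_simps)
  also have "\<dots> = ennreal J * ennreal (1 / J)"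
    by (subst nn_integral_multc) (auto simp: Ik [symmetric] J)
  also have "\<dots> = 1" using J1 by (simp add: ennreal_mult' [symmetric])
  finally have 1: "(\<integral>\<^sup>+ t \<in> {r1<..<r2}. \<eta> t \<partial>lborel) = 1" .
  have "(\<integral>\<^sup>+ t \<in> {r1<..<r2}. s t * enn_powr (\<eta> t) p \<partial>lborel)
      \<le> (\<integral>\<^sup>+ t. (\<psi> t * indicator {r1<..<r2} t) * ennreal (w * (1 / J) powr p) \<partial>lborel)"
  proof (rule nn_integral_mono)
    fix t :: real
    show "s t * enn_powr (\<eta> t) p * indicator {r1<..<r2} t
      \<le> (\<psi> t * indicator {r1<..<r2} t) * ennreal (w * (1 / J) powr p)"
    proof (cases "t \<in> {r1<..<r2}")
      case True
      then have "t > 0" using r1 by simp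
      have "s t * enn_powr (\<eta> t) p \<le> s t * (enn_powr (\<psi> t) p * ennreal ((1 / J) powr p))"
        unfolding \<eta>_def using J1 by (intro mult_left_mono enn_powr_mult_ennreal) auto
      also have "\<dots> = (s t * enn_powr (\<psi> t) p) * ennreal ((1 / J) powr p)" by (simp add: mult.assoc)
      also have "\<dots> \<le> (ennreal w * \<psi> t) * ennreal ((1 / J) powr p)"
        unfolding \<psi>_def by (intro mult_right_mono extremal_weight_identity \<open>t > 0\<close> w p) simp
      also have "\<dots> = \<psi> t * ennreal (w * (1 / J) powr p)"
        using w by (simp add: ennreal_mult' ac_simps)
      finally show ?thesis using True by simp
    qed simp
  qed
  also have "\<dots> = ennreal J * ennreal (w * (1 / J) powr p)"
    by (subst nn_integral_multc) (auto simp: Ik [symmetric] J)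
  also have "\<dots> = ennreal (w * J powr (1 - p))"
  proof -
    have "J * (w * (1 / J) powr p) = w * J powr (1 - p)"
      using J1 by (simp add: powr_diff powr_divide)
    then show ?thesis using J(2) by (metis ennreal_mult')
  qed
  also have "\<dots> \<le> ennreal \<epsilon>" using N [OF J1(1)] by (intro ennreal_leI) simp
  finally show ?case using r1 1 by (intro exI [of _ r1] exI [of _ \<eta>]) auto
qed

lemma sum_inverse_unbounded:
  assumes "k1 \<ge> 1"
  obtains m where "m > k1" "(\<Sum>k = k1..<m. 1 / real k) \<ge> (N :: real)"
proof -
  have "\<forall>\<^sub>F n in sequentially. (harm n :: real) \<ge> N + harm k1"
    using harm_at_top by (auto simp: filterlim_at_top)
  then obtain n where n: "n \<ge> k1" "(harm n :: real) \<ge> N + harm k1"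
    by (metis (mono_tags, lifting) eventually_sequentially le_cases order.trans order_refl)
  have "{1..n} = {1..<k1} \<union> {k1..<Suc n}" using n assms by auto
  then have "(harm n :: real) = (\<Sum>k \<in> {1..<k1} \<union> {k1..<Suc n}. inverse (real k))"
    by (simp add: harm_def)
  also have "\<dots> = (\<Sum>k = 1..<k1. inverse (real k)) + (\<Sum>k = k1..<Suc n. inverse (real k))"
    by (rule sum.union_disjoint) auto
  also have "(\<Sum>k = 1..<k1. inverse (real k)) \<le> harm k1" unfolding harm_def by (rule sum_mono2) auto
  finally show ?thesis using n that [of "Suc n"] by (simp add: inverse_eq_divide)
qed

lemma enn_powr_disjoint_sum:
  assumes "finite F" and disj: "\<And>j k. j \<in> F \<Longrightarrow> k \<in> F \<Longrightarrow> t \<in> J j \<Longrightarrow> t \<in> J k \<Longrightarrow> j = k" and p: "p > 0"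
    and c: "\<And>k. k \<in> F \<Longrightarrow> c k \<ge> 0"
  shows "enn_powr (\<Sum>k\<in>F. ennreal (c k) * indicator (J k) t) p
    = (\<Sum>k\<in>F. ennreal (c k powr p) * indicator (J k) t)"
proof (cases "\<exists>j\<in>F. t \<in> J j")
  case True
  then obtain j where j: "j \<in> F" "t \<in> J j" by blast
  have single: "(\<Sum>k\<in>F. ennreal (b k) * indicator (J k) t) = ennreal (b j)" for b :: "_ \<Rightarrow> real"
  proof -
    have "(\<Sum>k\<in>F. ennreal (b k) * indicator (J k) t) = (\<Sum>k\<in>F. if k = j then ennreal (b j) else 0)"
      using j disj by (intro sum.cong) (auto simp: indicator_def)
    then show ?thesis using j assms(1) by simp
  qed
  show ?thesis unfolding single using c j by (simp add: enn_powr_def)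
next
  case False
  then have "(\<Sum>k\<in>F. ennreal (b k) * indicator (J k) t) = 0" for b :: "_ \<Rightarrow> real"
    by (intro sum.neutral) auto
  then show ?thesis using p by (simp add: enn_powr_def)
qed

abbreviation (input) dyadic_integral :: "(real \<Rightarrow> ennreal) \<Rightarrow> nat \<Rightarrow> ennreal" where
  "dyadic_integral s k \<equiv> \<integral>\<^sup>+ t \<in> {(1/2) ^ (k + 1)..<(1/2) ^ k}. s t \<partial>lborel"

text \<open>On the k-th dyadic shell log(1/t) is comparable with \<open>k\<close>, so this is what a
  spherical mean of order (log(1/t))^(n-1) gives there.\<close>

abbreviation (input) dyadic_bound :: "real \<Rightarrow> nat \<Rightarrow> nat \<Rightarrow> real" where
  "dyadic_bound C n k \<equiv> C * (1/2) ^ (k * n) * real k ^ (n - 1)"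

text \<open>The weight is a step function modelled on 1/(t log(1/t)) and normalised by a partial
  harmonic sum \<open>H\<close>. The k-th shell costs at most
  \<open>B * H powr (- p) * (1 / real k)\<close>, so the total is at most
  \<open>B * H powr (1 - p)\<close>, and \<open>H\<close> can be made as large as desired.\<close>

lemma small_weights_of_dyadic_bound:
  fixes s :: "real \<Rightarrow> ennreal" and n K0 :: nat
  assumes s [measurable]: "s \<in> borel_measurable borel" and p: "p > 1" "p \<le> real n" and C: "C \<ge> 0"
    and bound: "\<And>k. k \<ge> K0 \<Longrightarrow> dyadic_integral s k
      \<le> ennreal (dyadic_bound C n k)"
    and r2: "r2 > 0"
  shows "small_weights s p r2"
  unfolding small_weights_def
proof (intro allI impI, goal_cases)
  case \<epsilon>: (1 \<epsilon>)
  define a where "a = (\<lambda>k::nat. (1/2::real) ^ k)"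
  have a_mono: "a k \<le> a j" if "j \<le> k" for j k
    using that unfolding a_def by (intro power_decreasing) auto
  define J where "J = (\<lambda>k. {a (k + 1)..<a k})"
  have [measurable]: "J k \<in> sets borel" for k
    by (simp add: J_def)
  obtain k0 where k0: "a k0 < r2" using real_arch_pow_inv [of r2 "1/2"] r2 by (auto simp: a_def)
  define k1 where "k1 = max (max K0 1) k0"
  have k1: "k1 \<ge> K0" "k1 \<ge> 1" "a k1 < r2" using a_mono [of k0 k1] k0 by (auto simp: k1_def)
  define B where "B = 2 powr p * C"
  have B: "B \<ge> 0" using C by (simp add: B_def)
  have "((\<lambda>J. B * J powr (1 - p)) \<longlongrightarrow> B * 0) at_top"
    using p by (intro tendsto_mult tendsto_const tendsto_neg_powr filterlim_ident) auto
  then have "\<forall>\<^sub>F J in at_top. B * J powr (1 - p) < \<epsilon>" using \<epsilon> by (intro order_tendstoD(2)) auto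
  then obtain N where N: "\<And>J. J \<ge> N \<Longrightarrow> B * J powr (1 - p) < \<epsilon>"
    by (auto simp: eventually_at_top_linorder)
  obtain m where m: "m > k1" "(\<Sum>k = k1..<m. 1 / real k) \<ge> max N 1"
    using sum_inverse_unbounded [OF k1(2)] by blast
  define H where "H = (\<Sum>k = k1..<m. 1 / real k)"
  have H: "H \<ge> N" "H \<ge> 1" using m by (auto simp: H_def)
  \<comment> \<open>\<open>2 ^ (k + 1)\<close> is the reciprocal of the length of
    \<open>J k\<close>, so this interval contributes \<open>1 / (k * H)\<close> to the integral of
    the weight.\<close>
  define c where "c = (\<lambda>k. 2 ^ (k + 1) / real k / H)"
  have c0: "c k \<ge> 0" for k
    using H by (simp add: c_def)
  define \<eta> where "\<eta> = (\<lambda>t. \<Sum>k = k1..<m. ennreal (c k) * indicator (J k) t)"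
  have [measurable]: "\<eta> \<in> borel_measurable borel" unfolding \<eta>_def by measurable
  define r1 where "r1 = a m"
  have r1: "0 < r1" "r1 < r2" using a_mono [of k1 m] m k1 by (auto simp: r1_def) (simp add: a_def)
  \<comment> \<open>The exceptional point is the left endpoint of \<open>J (m - 1)\<close>, which is
    \<open>r1\<close> itself.\<close>
  have Jsub: "t \<in> {r1<..<r2}" if "t \<in> J k" "k \<in> {k1..<m}" "t \<noteq> r1" for t k
    using that a_mono [of "k + 1" m] a_mono [of k1 k] k1 by (auto simp: J_def r1_def)
  have len: "emeasure lborel (J k) = ennreal (a (k + 1))" for k
    by (simp add: J_def a_def)
  have "(\<integral>\<^sup>+ t \<in> {r1<..<r2}. \<eta> t \<partial>lborel) = (\<integral>\<^sup>+ t. \<eta> t \<partial>lborel)"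
  proof (rule nn_integral_cong_AE, rule AE_mp [OF AE_lborel_singleton [of r1]], intro AE_I2 impI)
    fix t assume t: "t \<noteq> r1"
    show "\<eta> t * indicator {r1<..<r2} t = \<eta> t"
    proof (cases "t \<in> {r1<..<r2}")
      case False
      then have "\<eta> t = 0"
        unfolding \<eta>_def using Jsub t by (intro sum.neutral) (auto simp: indicator_def)
      then show ?thesis by simp
    qed simp
  qed
  also have "\<dots> = (\<Sum>k = k1..<m. ennreal (c k) * ennreal (a (k + 1)))"
    unfolding \<eta>_def by (subst nn_integral_sum) (auto simp: nn_integral_cmult len)
  also have "\<dots> = (\<Sum>k = k1..<m. ennreal (1 / real k * (1 / H)))"
  proof (rule sum.cong [OF refl])
    fix k
    have "c k * a (k + 1) = 1 / real k * (1 / H)" by (simp add: c_def a_def power_one_over)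
    then show "ennreal (c k) * ennreal (a (k + 1)) = ennreal (1 / real k * (1 / H))"
      by (metis c0 ennreal_mult')
  qed
  also have "\<dots> = ennreal (\<Sum>k = k1..<m. 1 / real k * (1 / H))" using H by (intro sum_ennreal) auto
  also have "(\<Sum>k = k1..<m. 1 / real k * (1 / H)) = 1"
    using H by (simp only: sum_distrib_right [symmetric] H_def [symmetric]) simp
  finally have 1: "(\<integral>\<^sup>+ t \<in> {r1<..<r2}. \<eta> t \<partial>lborel) = 1" by simp
  have disj: "j = k" if "t \<in> J j" "t \<in> J k" for t j k
  proof (rule ccontr)
    assume "j \<noteq> k"
    then consider "j + 1 \<le> k" | "k + 1 \<le> j" by linarith
    then show False
      using that a_mono [of "j + 1" k] a_mono [of "k + 1" j] by cases (auto simp: J_def)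
  qed
  have "(\<integral>\<^sup>+ t \<in> {r1<..<r2}. s t * enn_powr (\<eta> t) p \<partial>lborel)
      \<le> (\<integral>\<^sup>+ t. (\<Sum>k = k1..<m. ennreal (c k powr p) * (s t * indicator (J k) t)) \<partial>lborel)"
  proof (rule nn_integral_mono)
    fix t :: real
    have "s t * enn_powr (\<eta> t) p = (\<Sum>k = k1..<m. ennreal (c k powr p) * (s t * indicator (J k) t))"
    proof -
      have "enn_powr (\<eta> t) p = (\<Sum>k = k1..<m. ennreal (c k powr p) * indicator (J k) t)"
        unfolding \<eta>_def by (rule enn_powr_disjoint_sum) (use disj p c0 in auto)
      then show ?thesis by (simp only: sum_distrib_left mult.left_commute)
    qed
    then show "s t * enn_powr (\<eta> t) p * indicator {r1<..<r2} t
        \<le> (\<Sum>k = k1..<m. ennreal (c k powr p) * (s t * indicator (J k) t))"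
      by (simp add: indicator_def)
  qed
  also have "\<dots> = (\<Sum>k = k1..<m. ennreal (c k powr p) * (\<integral>\<^sup>+ t \<in> J k. s t \<partial>lborel))"
    by (subst nn_integral_sum) (auto simp: nn_integral_cmult)
  also have "\<dots> \<le> (\<Sum>k = k1..<m. ennreal (B * H powr (- p) * (1 / real k)))"
  proof (rule sum_mono)
    fix k assume "k \<in> {k1..<m}"
    then have k: "k \<ge> 1" "k \<ge> K0" using k1 by auto
    have n: "n \<ge> 1" using p by (cases n) auto
    \<comment> \<open>Since \<open>x \<ge> 1\<close> and \<open>p \<le> n\<close>, the exponent
      \<open>p\<close> may be raised to \<open>n\<close>; then the powers of 2 cancel and those of
      \<open>k\<close> leave exactly \<open>1 / k\<close>.\<close>
    define x where "x = 2 ^ k / real k"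
    have "real k \<le> 2 ^ k"
      using less_exp [of k] by (metis less_imp_le of_nat_le_iff of_nat_numeral of_nat_power)
    then have x: "x \<ge> 1" using k by (simp add: x_def)
    have "c k = 2 * x * inverse H" by (simp add: c_def x_def divide_inverse)
    then have "c k powr p = 2 powr p * x powr p * H powr (- p)"
      using x H by (simp add: powr_mult powr_minus inverse_powr)
    also have "\<dots> \<le> 2 powr p * x powr real n * H powr (- p)"
      using x p H by (intro mult_right_mono mult_left_mono powr_mono) auto
    also have "x powr real n = x ^ n" using x by (intro powr_realpow) simp
    finally have "c k powr p * dyadic_bound C n k
        \<le> (2 powr p * x ^ n * H powr (- p)) * dyadic_bound C n k"
      using C by (intro mult_right_mono) auto
    also have "\<dots> = B * H powr (- p) * (x ^ n * (1/2) ^ (k * n) * real k ^ (n - 1))"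
      by (simp add: B_def)
    also have "x ^ n * (1/2) ^ (k * n) * real k ^ (n - 1) = 1 / real k"
    proof -
      have "x ^ n * (1/2) ^ (k * n) = 1 / real k ^ n"
        by (simp add: x_def power_divide power_mult power_one_over)
      moreover have "real k ^ n = real k * real k ^ (n - 1)" using n by (cases n) auto
      ultimately show ?thesis
        using k by simp
    qed
    finally have le: "c k powr p * dyadic_bound C n k \<le> B * H powr (- p) * (1 / real k)" .
    have "ennreal (c k powr p) * (\<integral>\<^sup>+ t \<in> J k. s t \<partial>lborel)
        \<le> ennreal (c k powr p) * ennreal (dyadic_bound C n k)"
      using bound [OF k(2)] by (intro mult_left_mono) (auto simp: J_def a_def)
    also have "\<dots> = ennreal (c k powr p * dyadic_bound C n k)" by (simp add: ennreal_mult')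
    also have "\<dots> \<le> ennreal (B * H powr (- p) * (1 / real k))" using le by (rule ennreal_leI)
    finally show "ennreal (c k powr p) * (\<integral>\<^sup>+ t \<in> J k. s t \<partial>lborel) \<le> ennreal (B * H powr (- p) * (1 / real k))" .
  qed
  also have "\<dots> = ennreal (\<Sum>k = k1..<m. B * H powr (- p) * (1 / real k))"
    using B by (intro sum_ennreal) auto
  also have "(\<Sum>k = k1..<m. B * H powr (- p) * (1 / real k)) = B * H powr (- p) * H"
    by (simp only: sum_distrib_left [symmetric] H_def [symmetric])
  also have "\<dots> = B * H powr (1 - p)" using H by (simp add: powr_diff powr_minus divide_inverse)
  also have "ennreal \<dots> \<le> ennreal \<epsilon>" using N [OF H(1)] by (intro ennreal_leI) simp
  finally show ?case using r1 1 by (intro exI [of _ r1] exI [of _ \<eta>]) auto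
qed

section \<open>Small weights under each of the three conditions\<close>

lemma dyadic_bound_of_log_mean:
  fixes s :: "real \<Rightarrow> ennreal" and n :: nat
  assumes ev: "AE t in lborel. 0 < t \<longrightarrow> t < t0 \<longrightarrow> s t \<le> ennreal (D * ln (1 / t) ^ (n - 1) * t ^ (n - 1))"
    and t0: "t0 > 0" and n: "n \<ge> 1"
  obtains C K0 where "C \<ge> 0" "\<And>k. k \<ge> K0 \<Longrightarrow> dyadic_integral s k
      \<le> ennreal (dyadic_bound C n k)"
proof -
  obtain k0 where k0: "(1/2::real) ^ k0 < t0" using real_arch_pow_inv [of t0 "1/2"] t0 by auto
  define C where "C = \<bar>D\<bar> * 2 ^ (n - 1)"
  show ?thesis
  proof
    show "C \<ge> 0" by (simp add: C_def)
    \<comment> \<open>The bound \<open>k0\<close> puts the shell below \<open>t0\<close>, and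
      \<open>k \<ge> 1\<close> gives \<open>k + 1 \<le> 2 * k\<close>, the source of the factor
      \<open>2 ^ (n - 1)\<close> in \<open>C\<close>.\<close>
    fix k assume k: "k \<ge> max k0 1"
    define a where "a = (1/2::real) ^ k"
    have "a \<le> (1/2) ^ k0" unfolding a_def using k by (intro power_decreasing) auto
    then have "a < t0" using k0 by (rule order_le_less_trans)
    then have a: "a > 0" "a \<le> 1" "a < t0" "(1/2) ^ (k + 1) = a / 2"
      by (simp_all add: a_def power_le_one)
    define M where "M = \<bar>D\<bar> * (2 * real k) ^ (n - 1) * a ^ (n - 1)"
    have pt: "D * ln (1 / t) ^ (n - 1) * t ^ (n - 1) \<le> M" if t: "t \<in> {a / 2..<a}" for t
    proof -
      have t': "t > 0" "t < 1" using t a by auto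
      have ln0: "ln (1 / t) \<ge> 0" using t' by simp
      have "1 / t \<le> 2 ^ (k + 1)" using t t' by (simp add: a_def field_simps power_one_over)
      then have "ln (1 / t) \<le> ln (2 ^ (k + 1))" using t' by simp
      also have "\<dots> = real (k + 1) * ln 2" by (rule ln_realpow)
      also have "\<dots> \<le> real (k + 1) * 1" using ln_2_less_1 by (intro mult_left_mono) auto
      also have "\<dots> \<le> 2 * real k" using k by simp
      finally have ln1: "ln (1 / t) \<le> 2 * real k" .
      have "D * ln (1 / t) ^ (n - 1) * t ^ (n - 1) \<le> \<bar>D\<bar> * ln (1 / t) ^ (n - 1) * t ^ (n - 1)"
        using ln0 t' by (intro mult_right_mono) auto
      also have "\<dots> \<le> M"
        unfolding M_def using ln0 ln1 t t' by (intro mult_mono mult_left_mono power_mono) auto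
      finally show ?thesis .
    qed
    have "dyadic_integral s k \<le> (\<integral>\<^sup>+ t. ennreal M * indicator {a / 2..<a} t \<partial>lborel)"
    proof (rule nn_integral_mono_AE, rule AE_mp [OF ev], intro AE_I2 impI)
      fix t assume h: "0 < t \<longrightarrow> t < t0 \<longrightarrow> s t \<le> ennreal (D * ln (1 / t) ^ (n - 1) * t ^ (n - 1))"
      show "s t * indicator {(1/2) ^ (k + 1)..<(1/2) ^ k} t \<le> ennreal M * indicator {a / 2..<a} t"
      proof (cases "t \<in> {a / 2..<a}")
        case True
        then have "s t \<le> ennreal (D * ln (1 / t) ^ (n - 1) * t ^ (n - 1))" using h a by auto
        also have "\<dots> \<le> ennreal M" using pt [OF True] by (rule ennreal_leI)
        finally show ?thesis using True by (simp add: indicator_def)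
      qed (use a in \<open>simp add: a_def [symmetric]\<close>)
    qed
    also have "\<dots> = ennreal M * ennreal (a / 2)" using a by (subst nn_integral_cmult) auto
    also have "\<dots> = ennreal (M * (a / 2))" using a by (subst ennreal_mult'') auto
    also have "\<dots> \<le> ennreal (dyadic_bound C n k)"
    proof (rule ennreal_leI)
      have "(1/2::real) ^ (k * n) = a * a ^ (n - 1)"
        using n by (cases n) (simp_all add: a_def power_add power_mult)
      then have "dyadic_bound C n k = M * a" by (simp add: C_def M_def power_mult_distrib)
      moreover have "M * (a / 2) \<le> M * a" using a by (intro mult_left_mono) (auto simp: M_def)
      ultimately show "M * (a / 2) \<le> dyadic_bound C n k" by simp
    qed
    finally show "dyadic_integral s k
      \<le> ennreal (dyadic_bound C n k)" .
  qed
qed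

text \<open>From one dyadic ball to the next the mean of \<open>Q\<close> increases by at most a
  constant, so it grows at most linearly in \<open>k\<close>. The integral over the k-th ball is
  then of order k 2^(-kn), and k is at most k^(n-1) because n is at least 2.\<close>

lemma fmo_ball_bound:
  fixes Q :: "'a::euclidean_space \<Rightarrow> real"
  assumes n: "DIM('a) \<ge> 2" and Q [measurable]: "Q \<in> borel_measurable lebesgue" and pos: "\<And>y. Q y \<ge> 0"
    and fmo: "fmo Q y0"
  obtains C K0 where "C \<ge> 0" "\<And>k. k \<ge> K0 \<Longrightarrow> (\<integral>\<^sup>+ y \<in> ball y0 ((1/2) ^ k). ennreal (Q y) \<partial>lebesgue)
      \<le> ennreal (dyadic_bound C DIM('a) k)"
proof -
  let ?n = "DIM('a)"
  have [measurable]: "ball y0 r \<in> sets lebesgue" for r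
    by simp
  define v where "v = unit_ball_vol (real ?n)"
  have v: "v > 0" by (simp add: v_def)
  define osc where "osc = (\<lambda>\<epsilon>. (\<integral>\<^sup>+ y \<in> ball y0 \<epsilon>. ennreal \<bar>Q y - ball_mean Q y0 \<epsilon>\<bar> \<partial>lebesgue))"
  have "Limsup (at_right 0) (\<lambda>\<epsilon>. osc \<epsilon> / ennreal (v * \<epsilon> ^ ?n)) < \<infinity>"
    using fmo by (simp add: fmo_def osc_def v_def)
  then obtain M' where M': "Limsup (at_right 0) (\<lambda>\<epsilon>. osc \<epsilon> / ennreal (v * \<epsilon> ^ ?n)) < M'" "M' < \<infinity>"
    using dense by blast
  then obtain M where M: "M' = ennreal M" "M \<ge> 0" by (cases M') auto
  have "\<forall>\<^sub>F \<epsilon> in at_right 0. osc \<epsilon> / ennreal (v * \<epsilon> ^ ?n) < M'" by (rule Limsup_lessD [OF M'(1)])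
  then obtain b where b: "b > 0" "\<And>\<epsilon>. 0 < \<epsilon> \<Longrightarrow> \<epsilon> < b \<Longrightarrow> osc \<epsilon> / ennreal (v * \<epsilon> ^ ?n) < M'"
    by (auto simp: eventually_at_right_field)
  have osc: "osc \<epsilon> \<le> ennreal (M * v * \<epsilon> ^ ?n)" if \<epsilon>: "0 < \<epsilon>" "\<epsilon> < b" for \<epsilon>
  proof -
    have c: "v * \<epsilon> ^ ?n > 0" using v \<epsilon> by simp
    have "osc \<epsilon> = osc \<epsilon> / ennreal (v * \<epsilon> ^ ?n) * ennreal (v * \<epsilon> ^ ?n)"
      using c v \<epsilon> by (auto simp: ennreal_divide_times divide_ennreal)
    also have "\<dots> \<le> ennreal M * ennreal (v * \<epsilon> ^ ?n)"
      using b(2) [OF \<epsilon>] M by (intro mult_right_mono) auto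
    also have "\<dots> = ennreal (M * v * \<epsilon> ^ ?n)"
      using c M by (simp add: ennreal_mult' [symmetric] mult.assoc)
    finally show ?thesis .
  qed
  define a where "a = (\<lambda>k::nat. (1/2::real) ^ k)"
  have a: "a k > 0" "a (Suc k) = a k / 2" "a (Suc k) \<le> a k" for k
    by (simp_all add: a_def)
  obtain k0 where k0: "a k0 < b" using real_arch_pow_inv [of b "1/2"] b by (auto simp: a_def)
  have ak: "a k < b" if "k \<ge> k0" for k
  proof -
    have "a k \<le> a k0" unfolding a_def using that by (intro power_decreasing) auto
    then show ?thesis using k0 by (rule order_le_less_trans)
  qed
  define \<mu> where "\<mu> = (\<lambda>k. ball_mean Q y0 (a k))"
  have \<mu>0: "\<mu> k \<ge> 0" for k
    unfolding \<mu>_def ball_mean_def set_lebesgue_integral_def using v a(1) [of k] pos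
    by (intro divide_nonneg_nonneg integral_nonneg_AE) (auto simp: v_def [symmetric])
  let ?B = "\<lambda>k. \<integral>\<^sup>+ y \<in> ball y0 (a k). ennreal (Q y) \<partial>lebesgue"
  \<comment> \<open>\<open>2 ^ ?n\<close> is the volume ratio of consecutive balls: the oscillation
    about the mean of the larger ball is measured against the volume of the smaller one.\<close>
  have step: "?B (Suc k) \<le> ennreal ((\<mu> k + 2 ^ ?n * M) * v * a (Suc k) ^ ?n)"
    if k: "k \<ge> k0" for k
  proof -
    have "?B (Suc k)
        \<le> (\<integral>\<^sup>+ y. ennreal (\<mu> k) * indicator (ball y0 (a (Suc k))) y +
            ennreal \<bar>Q y - \<mu> k\<bar> * indicator (ball y0 (a k)) y \<partial>lebesgue)"
    proof (rule nn_integral_mono)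
      fix y
      have "ennreal (Q y) \<le> ennreal (\<mu> k) + ennreal \<bar>Q y - \<mu> k\<bar>"
      proof -
        have "ennreal (Q y) \<le> ennreal (\<mu> k + \<bar>Q y - \<mu> k\<bar>)" by (rule ennreal_leI) linarith
        then show ?thesis using \<mu>0 by simp
      qed
      moreover have "ball y0 (a (Suc k)) \<subseteq> ball y0 (a k)" using a by (intro subset_ball) auto
      ultimately show "ennreal (Q y) * indicator (ball y0 (a (Suc k))) y \<le>
          ennreal (\<mu> k) * indicator (ball y0 (a (Suc k))) y + ennreal \<bar>Q y - \<mu> k\<bar> * indicator (ball y0 (a k)) y"
        by (auto simp: indicator_def)
    qed
    also have "\<dots> = ennreal (\<mu> k) * emeasure lebesgue (ball y0 (a (Suc k))) + osc (a k)"
      unfolding osc_def \<mu>_def by (subst nn_integral_add) (auto simp: nn_integral_cmult_indicator)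
    also have "\<dots> \<le> ennreal (\<mu> k) * ennreal (v * a (Suc k) ^ ?n) + ennreal (M * v * a k ^ ?n)"
      using osc [OF a(1) ak [OF k]] a(1) [of "Suc k"]
      by (intro add_mono) (auto simp: emeasure_ball v_def)
    also have "\<dots> = ennreal (\<mu> k * (v * a (Suc k) ^ ?n) + M * v * a k ^ ?n)"
      using \<mu>0 v a(1) M by (simp add: ennreal_mult' ennreal_plus less_imp_le)
    also have "\<mu> k * (v * a (Suc k) ^ ?n) + M * v * a k ^ ?n = (\<mu> k + 2 ^ ?n * M) * v * a (Suc k) ^ ?n"
      unfolding a(2) by (simp add: power_divide field_simps)
    finally show ?thesis .
  qed
  have mean: "\<mu> (Suc k) \<le> \<mu> k + 2 ^ ?n * M" if k: "k \<ge> k0" for k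
  proof -
    have c: "v * a (Suc k) ^ ?n > 0" using v a(1) by simp
    have "(LINT y:ball y0 (a (Suc k))|lebesgue. Q y) = enn2real (\<integral>\<^sup>+ y. ennreal (indicator (ball y0 (a (Suc k))) y *\<^sub>R Q y) \<partial>lebesgue)"
      unfolding set_lebesgue_integral_def using pos by (intro integral_eq_nn_integral) auto
    also have "(\<integral>\<^sup>+ y. ennreal (indicator (ball y0 (a (Suc k))) y *\<^sub>R Q y) \<partial>lebesgue)
        = ?B (Suc k)"
      by (intro nn_integral_cong) (auto simp: indicator_def)
    also have "enn2real \<dots> \<le> (\<mu> k + 2 ^ ?n * M) * v * a (Suc k) ^ ?n"
      using \<mu>0 [of k] M v a(1) [of "Suc k"] by (intro enn2real_leI step k) (auto intro!: mult_nonneg_nonneg)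
    finally have "\<mu> (Suc k) \<le> ((\<mu> k + 2 ^ ?n * M) * (v * a (Suc k) ^ ?n)) / (v * a (Suc k) ^ ?n)"
      unfolding \<mu>_def ball_mean_def v_def [symmetric] using c
      by (intro divide_right_mono) (auto simp: mult.assoc)
    also have "\<dots> = \<mu> k + 2 ^ ?n * M" by (rule nonzero_mult_div_cancel_right) (use c in linarith)
    finally show ?thesis .
  qed
  define L where "L = \<mu> k0 + 2 ^ ?n * M"
  have L: "L \<ge> 0" using \<mu>0 M by (simp add: L_def)
  have lin: "\<mu> (k0 + j) \<le> L * real (j + 1)" for j
  proof (induction j)
    case 0
    then show ?case using M by (simp add: L_def)
  next
    case (Suc j)
    have "\<mu> (k0 + Suc j) \<le> \<mu> (k0 + j) + 2 ^ ?n * M" using mean [of "k0 + j"] by simp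
    also have "\<dots> \<le> L * real (j + 1) + L" using Suc \<mu>0 [of k0] by (simp add: L_def)
    finally show ?case by (simp add: algebra_simps)
  qed
  define C where "C = 2 * L * v"
  show ?thesis
  proof
    show "C \<ge> 0" using L v by (simp add: C_def)
    fix k assume k: "k \<ge> k0 + 1"
    define j where "j = k - Suc k0"
    have j: "k = Suc (k0 + j)" using k by (simp add: j_def)
    have "\<mu> (k0 + j) + 2 ^ ?n * M \<le> L * real (j + 1) + L"
      using lin [of j] \<mu>0 [of k0] by (simp add: L_def)
    also have "\<dots> \<le> 2 * L * real k" using L j by (simp add: algebra_simps)
    also have "\<dots> \<le> 2 * L * real k ^ (?n - 1)"
      using L j n self_le_power [of "real k" "?n - 1"] by (intro mult_left_mono) auto
    finally have "(\<mu> (k0 + j) + 2 ^ ?n * M) * v * a k ^ ?n \<le> (2 * L * real k ^ (?n - 1)) * v * a k ^ ?n"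
      using v a(1) [of k] by (intro mult_right_mono) auto
    also have "\<dots> = dyadic_bound C ?n k" by (simp add: C_def a_def power_mult)
    finally have "ennreal ((\<mu> (k0 + j) + 2 ^ ?n * M) * v * a k ^ ?n) \<le> ennreal (dyadic_bound C ?n k)"
      by (rule ennreal_leI)
    with step [of "k0 + j"] show "(\<integral>\<^sup>+ y \<in> ball y0 ((1/2) ^ k). ennreal (Q y) \<partial>lebesgue)
      \<le> ennreal (dyadic_bound C ?n k)"
      unfolding j a_def by (meson order_trans le_add1)
  qed
qed

lemma small_weights_of_fmo:
  fixes Q :: "'a::euclidean_space \<Rightarrow> real"
  assumes n: "DIM('a) \<ge> 2" and p: "p > 1" "p \<le> real DIM('a)"
    and Q: "Q \<in> borel_measurable lebesgue" "\<And>y. Q y \<ge> 0"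
    and Q' [measurable]: "Q' \<in> borel_measurable borel" and eq: "AE y in lborel. Q y = Q' y"
    and fmo: "fmo Q y0" and r2: "r2 > 0"
  shows "small_weights (sphere_weight Q' y0) p r2"
proof -
  obtain C K0 where C: "C \<ge> 0" and bound: "\<And>k. k \<ge> K0 \<Longrightarrow> (\<integral>\<^sup>+ y \<in> ball y0 ((1/2) ^ k). ennreal (Q y) \<partial>lebesgue)
      \<le> ennreal (dyadic_bound C DIM('a) k)"
    using fmo_ball_bound [OF n Q fmo] by blast
  show ?thesis
  proof (rule small_weights_of_dyadic_bound [OF _ p C _ r2])
    fix k assume k: "k \<ge> K0"
    let ?\<phi> = "indicator {(1/2) ^ (k + 1)..<(1/2) ^ k} :: real \<Rightarrow> ennreal"
    have eq': "AE y in lebesgue. Q y = Q' y" using eq by (rule AE_completion)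
    have "0 < (1/2::real) ^ (k + 1)" by simp
    then have \<phi>: "?\<phi> t = 0" if "t \<le> 0" for t
      using that by (intro indicator_simps) auto
    have "dyadic_integral (sphere_weight Q' y0) k
        = (\<integral>\<^sup>+ y. ennreal (Q' y) * ?\<phi> (dist y y0) \<partial>lborel)"
      using \<phi> by (intro nn_integral_polar_radial [symmetric]) auto
    also have "\<dots> = (\<integral>\<^sup>+ y. ennreal (Q' y) * ?\<phi> (dist y y0) \<partial>lebesgue)"
      by (rule nn_integral_completion [symmetric]) measurable
    also have "\<dots> \<le> (\<integral>\<^sup>+ y \<in> ball y0 ((1/2) ^ k). ennreal (Q y) \<partial>lebesgue)"
      by (rule nn_integral_mono_AE, rule AE_mp [OF eq'], intro AE_I2 impI)
        (auto simp: indicator_def dist_commute)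
    also have "\<dots> \<le> ennreal (dyadic_bound C DIM('a) k)" by (rule bound [OF k])
    finally show "dyadic_integral (sphere_weight Q' y0) k
        \<le> ennreal (dyadic_bound C DIM('a) k)" .
  qed measurable
qed

lemma sphere_integral_eq_mean:
  fixes y0 :: "'a::euclidean_space"
  assumes "Q' \<in> borel_measurable borel" and t: "t > 0"
  shows "sphere_weight Q' y0 t
    = sphere_mean Q' y0 t * ennreal (unit_sphere_area TYPE('a) * t ^ (DIM('a) - 1))"
proof -
  have "unit_sphere_area TYPE('a) * t ^ (DIM('a) - 1) > 0"
    using t unit_sphere_area_pos [where 'a = 'a] by simp
  then show ?thesis
    using assms unit_sphere_area_pos [where 'a = 'a]
    by (simp add: sphere_mean_eq ennreal_divide_times divide_ennreal)
qed

lemma small_weights_of_log_mean: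
  fixes y0 :: "'a::euclidean_space"
  assumes p: "p > 1" "p \<le> real DIM('a)"
    and Q' [measurable]: "Q' \<in> borel_measurable borel" and eq: "AE y in lborel. Q y = Q' y"
    and mean: "\<forall>\<^sub>F r in at_right 0. sphere_mean Q y0 r \<le> ennreal (C * ln (1 / r) ^ (DIM('a) - 1))"
    and r2: "r2 > 0"
  shows "small_weights (sphere_weight Q' y0) p r2"
proof -
  let ?n = "DIM('a)"
  define w where "w = unit_sphere_area TYPE('a)"
  have w: "w > 0" by (simp add: w_def unit_sphere_area_pos)
  obtain b where b: "b > 0" "\<And>t. 0 < t \<Longrightarrow> t < b \<Longrightarrow> sphere_mean Q y0 t \<le> ennreal (C * ln (1 / t) ^ (?n - 1))"
    using mean by (auto simp: eventually_at_right_field)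
  have "AE t in lborel. 0 < t \<longrightarrow> t < b \<longrightarrow>
      sphere_weight Q' y0 t \<le> ennreal (w * C * ln (1 / t) ^ (?n - 1) * t ^ (?n - 1))"
  proof (rule AE_mp [OF sphere_mean_cong_AE [OF eq, of y0]], intro AE_I2 impI)
    fix t :: real
    assume t: "0 < t" "t < b" and "0 < t \<longrightarrow> sphere_mean Q y0 t = sphere_mean Q' y0 t"
    then have "sphere_weight Q' y0 t = sphere_mean Q y0 t * ennreal (w * t ^ (?n - 1))"
      by (simp add: sphere_integral_eq_mean w_def)
    also have "\<dots> \<le> ennreal (C * ln (1 / t) ^ (?n - 1)) * ennreal (w * t ^ (?n - 1))"
      using b t by (intro mult_right_mono) auto
    also have "\<dots> = ennreal ((C * ln (1 / t) ^ (?n - 1)) * (w * t ^ (?n - 1)))"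
      using w t by (intro ennreal_mult'' [symmetric]) auto
    finally show "sphere_weight Q' y0 t \<le> ennreal (w * C * ln (1 / t) ^ (?n - 1) * t ^ (?n - 1))"
      by (simp add: ac_simps)
  qed
  then obtain C' K0 where C': "C' \<ge> 0"
    and bound: "\<And>k. k \<ge> K0 \<Longrightarrow> dyadic_integral (sphere_weight Q' y0) k
      \<le> ennreal (dyadic_bound C' ?n k)"
    using dyadic_bound_of_log_mean [of b "sphere_weight Q' y0" "w * C" ?n] b(1)
    by (auto simp: Suc_le_eq)
  show ?thesis by (rule small_weights_of_dyadic_bound [OF _ p C' bound r2]) measurable
qed

text \<open>The integrand \<open>\<Psi>\<close> agrees almost everywhere with a Borel function built
  from \<open>Q'\<close>, to which the divergence criterion applies. Finiteness for small lower
  limits extends to all positive ones by monotonicity.\<close>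

lemma small_weights_of_divergent_mean:
  fixes y0 :: "'a::euclidean_space" and Q :: "'a \<Rightarrow> real"
  assumes p: "p > 1"
    and Q' [measurable]: "Q' \<in> borel_measurable borel" and eq: "AE y in lborel. Q y = Q' y"
  defines "\<Psi> \<equiv> \<lambda>t. extremal_weight (real DIM('a) - 1) p (sphere_mean Q y0 t) t"
  assumes fin: "\<forall>\<^sub>F \<epsilon> in at_right 0. (\<integral>\<^sup>+ t \<in> {\<epsilon><..<\<delta>}. \<Psi> t \<partial>lebesgue) < \<infinity>"
    and inf: "(\<integral>\<^sup>+ t \<in> {0<..<\<delta>}. \<Psi> t \<partial>lebesgue) = \<infinity>"
    and r2: "0 < r2" "r2 \<le> \<delta>"
  shows "small_weights (sphere_weight Q' y0) p r2"
proof -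
  define w where "w = unit_sphere_area TYPE('a)"
  have w: "w > 0" by (simp add: w_def unit_sphere_area_pos)
  define s where "s = sphere_weight Q' y0"
  have [measurable]: "s \<in> borel_measurable borel" unfolding s_def by measurable
  define b where "b = real DIM('a) - 1"
  define \<psi> where "\<psi> = (\<lambda>t. extremal_weight b p (s t / ennreal (w * t powr b)) t)"
  have [measurable]: "\<psi> \<in> borel_measurable borel" unfolding \<psi>_def by measurable
  have "AE t in lborel. t > 0 \<longrightarrow> \<Psi> t = \<psi> t"
  proof (rule AE_mp [OF sphere_mean_cong_AE [OF eq, of y0]], intro AE_I2 impI)
    fix t :: real
    assume t: "0 < t" and "0 < t \<longrightarrow> sphere_mean Q y0 t = sphere_mean Q' y0 t"
    moreover have "t powr b = t ^ (DIM('a) - 1)"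
      using t powr_realpow [of t "DIM('a) - 1"] by (simp add: b_def of_nat_diff)
    ultimately show "\<Psi> t = \<psi> t"
      by (simp add: \<Psi>_def \<psi>_def b_def [symmetric] s_def w_def sphere_mean_eq)
  qed
  then have AE: "AE t in lebesgue. t > 0 \<longrightarrow> \<Psi> t = \<psi> t" by (rule AE_completion)
  have int: "(\<integral>\<^sup>+ t \<in> {c<..<d}. \<Psi> t \<partial>lebesgue) = (\<integral>\<^sup>+ t \<in> {c<..<d}. \<psi> t \<partial>lborel)" if "c \<ge> 0" for c d
  proof -
    have "(\<integral>\<^sup>+ t \<in> {c<..<d}. \<Psi> t \<partial>lebesgue) = (\<integral>\<^sup>+ t \<in> {c<..<d}. \<psi> t \<partial>lebesgue)"
      by (rule nn_integral_cong_AE, rule AE_mp [OF AE], intro AE_I2 impI)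
        (use that in \<open>auto simp: indicator_def\<close>)
    also have "\<dots> = (\<integral>\<^sup>+ t \<in> {c<..<d}. \<psi> t \<partial>lborel)" by (rule nn_integral_completion) measurable
    finally show ?thesis .
  qed
  obtain e where e: "e > 0" "\<And>c. 0 < c \<Longrightarrow> c < e \<Longrightarrow> (\<integral>\<^sup>+ t \<in> {c<..<\<delta>}. \<Psi> t \<partial>lebesgue) < \<infinity>"
    using fin by (auto simp: eventually_at_right_field)
  have fin': "(\<integral>\<^sup>+ t \<in> {r<..<\<delta>}. \<psi> t \<partial>lborel) < \<infinity>" if r: "r > 0" for r
  proof -
    define c where "c = min r (e / 2)"
    have c: "0 < c" "c < e" "c \<le> r" using r e by (auto simp: c_def)
    have "(\<integral>\<^sup>+ t \<in> {r<..<\<delta>}. \<psi> t \<partial>lborel) \<le> (\<integral>\<^sup>+ t \<in> {c<..<\<delta>}. \<psi> t \<partial>lborel)"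
      using c by (intro nn_integral_mono mult_left_mono) (auto simp: indicator_def)
    also have "\<dots> < \<infinity>" using e(2) [OF c(1,2)] int [of c] c by simp
    finally show ?thesis .
  qed
  have "small_weights s p r2"
  proof (rule small_weights_of_divergence [where w = w and b = b])
    show "(\<integral>\<^sup>+ t \<in> {r<..<r2}. extremal_weight b p (s t / ennreal (w * t powr b)) t \<partial>lborel) < \<infinity>"
      if "0 < r" "r < r2" for r
    proof -
      have "(\<integral>\<^sup>+ t \<in> {r<..<r2}. \<psi> t \<partial>lborel) \<le> (\<integral>\<^sup>+ t \<in> {r<..<\<delta>}. \<psi> t \<partial>lborel)"
        using r2 by (intro nn_integral_mono mult_left_mono) (auto simp: indicator_def)
      also have "\<dots> < \<infinity>" by (rule fin' [OF that(1)])
      finally show ?thesis by (simp add: \<psi>_def)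
    qed
    \<comment> \<open>Divergence passes from \<open>\<delta>\<close> down to \<open>r2\<close>,
      because the integral beyond \<open>r2 / 2\<close> is finite; starting at \<open>r2 / 2\<close>
      also covers the point \<open>r2\<close> itself.\<close>
    have "\<infinity> = (\<integral>\<^sup>+ t \<in> {0<..<\<delta>}. \<psi> t \<partial>lborel)" using inf int [of 0] by simp
    also have "\<dots> \<le> (\<integral>\<^sup>+ t. \<psi> t * indicator {0<..<r2} t + \<psi> t * indicator {r2 / 2<..<\<delta>} t \<partial>lborel)"
      using r2 by (intro nn_integral_mono) (auto simp: indicator_def)
    also have "\<dots> = (\<integral>\<^sup>+ t \<in> {0<..<r2}. \<psi> t \<partial>lborel) + (\<integral>\<^sup>+ t \<in> {r2 / 2<..<\<delta>}. \<psi> t \<partial>lborel)"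
      by (rule nn_integral_add) measurable
    finally have "(\<integral>\<^sup>+ t \<in> {0<..<r2}. \<psi> t \<partial>lborel) = \<infinity>"
      using fin' [of "r2 / 2"] r2 by (auto simp: top_unique less_top)
    then show "(\<integral>\<^sup>+ t \<in> {0<..<r2}. extremal_weight b p (s t / ennreal (w * t powr b)) t \<partial>lborel) = \<infinity>"
      by (simp add: \<psi>_def)
  qed (use w p r2 in auto)
  then show ?thesis by (simp add: s_def)
qed

section \<open>From small weights to the theorem\<close>

text \<open>\<open>M\<close> stands for the modulus as a function of the inner radius. A Borel
  weight found for \<open>Q'\<close> is a legitimate test function in the inequality for
  \<open>Q\<close>, and \<open>annulus_integral_le\<close> bounds the outcome.\<close>

lemma modulus_small_of_small_weights:
  fixes y0 :: "'a::euclidean_space" and Q :: "'a \<Rightarrow> real"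
  assumes Q': "Q' \<in> borel_measurable borel" and eq: "AE y in lborel. Q y = Q' y"
    and small: "small_weights (sphere_weight Q' y0) p r2" and \<epsilon>: "\<epsilon> > 0"
    and bound: "\<And>r1 \<eta>. 0 < r1 \<Longrightarrow> r1 < r2 \<Longrightarrow> \<eta> \<in> borel_measurable (lebesgue_on {r1<..<r2}) \<Longrightarrow>
       (\<integral>\<^sup>+ r \<in> {r1<..<r2}. \<eta> r \<partial>lebesgue) \<ge> 1 \<Longrightarrow>
       M r1 \<le> (\<integral>\<^sup>+ y \<in> S \<inter> annulus r1 r2 y0. ennreal (Q y) * enn_powr (\<eta> (dist y y0)) p \<partial>lebesgue)"
  obtains r1 where "0 < r1" "r1 < r2" "M r1 \<le> ennreal \<epsilon>"
proof -
  obtain r1 \<eta> where r1: "0 < r1" "r1 < r2" and \<eta> [measurable]: "\<eta> \<in> borel_measurable borel"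
    and 1: "(\<integral>\<^sup>+ t \<in> {r1<..<r2}. \<eta> t \<partial>lborel) \<ge> 1"
    and le: "(\<integral>\<^sup>+ t \<in> {r1<..<r2}. sphere_weight Q' y0 t * enn_powr (\<eta> t) p \<partial>lborel) \<le> ennreal \<epsilon>"
    using small \<epsilon> unfolding small_weights_def by blast
  have "\<eta> \<in> borel_measurable (lebesgue_on {r1<..<r2})"
    by (intro measurable_restrict_space1 measurable_completion) simp
  moreover have "(\<integral>\<^sup>+ r \<in> {r1<..<r2}. \<eta> r \<partial>lebesgue) = (\<integral>\<^sup>+ r \<in> {r1<..<r2}. \<eta> r \<partial>lborel)"
    by (rule nn_integral_completion) measurable
  ultimately have "M r1 \<le> (\<integral>\<^sup>+ y \<in> S \<inter> annulus r1 r2 y0. ennreal (Q y) * enn_powr (\<eta> (dist y y0)) p \<partial>lebesgue)"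
    using r1 1 by (intro bound) auto
  also have "\<dots> \<le> (\<integral>\<^sup>+ t \<in> {r1<..<r2}. sphere_weight Q' y0 t * enn_powr (\<eta> t) p \<partial>lborel)"
    using r1 by (intro annulus_integral_le eq Q' \<eta>) simp
  also note le
  finally show ?thesis using that r1 by blast
qed

theorem theorem1p1:
  fixes D :: "(real ^ 'n) set" and f :: "real ^ 'n \<Rightarrow> real ^ 'n"
    and Q :: "real ^ 'n \<Rightarrow> real" and p :: real
  assumes n: "CARD('n) \<ge> 2"
    and D: "is_domain D"
    and p: "real CARD('n) - 1 < p" "p \<le> real CARD('n)"
    and f: "sense_preserving D f"
    and Q_meas: "Q \<in> borel_measurable lebesgue"
    and Q_pos: "\<forall>y \<in> f ` D. Q y > 0"
    and Q_zero: "\<forall>y. y \<notin> f ` D \<longrightarrow> Q y = 0"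
    and modulus_bound:
      "\<forall>y0 \<in> f ` D. \<forall>r1 r2. \<forall>\<eta> :: real \<Rightarrow> ennreal.
         0 < r1 \<and> r1 < r2 \<and> \<eta> \<in> borel_measurable (lebesgue_on {r1<..<r2}) \<and>
         (\<integral>\<^sup>+ r \<in> {r1<..<r2}. \<eta> r \<partial>lebesgue) \<ge> 1 \<longrightarrow>
         modulus p (lifted_paths D f y0 r1 r2)
           \<le> (\<integral>\<^sup>+ y \<in> f ` D \<inter> annulus r1 r2 y0.
                ennreal (Q y) * enn_powr (\<eta> (dist y y0)) p \<partial>lebesgue)"
    and Q_cond:
      "(\<forall>y0 \<in> f ` D. fmo Q y0) \<or>
       (\<forall>y0 \<in> f ` D. \<exists>C. \<forall>\<^sub>F r in at_right 0.
          sphere_mean Q y0 r \<le> ennreal (C * ln (1 / r) ^ (CARD('n) - 1))) \<or>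
       (\<forall>y0 \<in> f ` D. \<exists>\<delta>>0.
          (\<forall>\<^sub>F \<epsilon> in at_right 0.
            (\<integral>\<^sup>+ t \<in> {\<epsilon><..<\<delta>}. 1 / (ennreal (t powr ((real CARD('n) - 1) / (p - 1))) *
               enn_powr (sphere_mean Q y0 t) (1 / (p - 1))) \<partial>lebesgue) < \<infinity>) \<and>
          (\<integral>\<^sup>+ t \<in> {0<..<\<delta>}. 1 / (ennreal (t powr ((real CARD('n) - 1) / (p - 1))) *
             enn_powr (sphere_mean Q y0 t) (1 / (p - 1))) \<partial>lebesgue) = \<infinity>)"
  shows "discrete_map D f \<and> open_map (top_of_set D) euclidean f"
proof -
  have dim: "DIM(real ^ 'n) = CARD('n)" by simp
  have p1: "p > 1" using n p by linarith
  have Q0: "Q y \<ge> 0" for y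
    using Q_pos Q_zero by (cases "y \<in> f ` D") (auto intro: less_imp_le)
  have cont: "continuous_on D f" "\<not> f constant_on D" using f by (auto simp: sense_preserving_def)
  \<comment> \<open>Fubini and polar coordinates are applied to this Borel representative, while the
    hypotheses speak of the Lebesgue measurable \<open>Q\<close>.\<close>
  obtain Q' where Q': "Q' \<in> borel_measurable borel" and eq: "AE y in lborel. Q y = Q' y"
    using completion_ex_borel_measurable_real [OF Q_meas] by auto
  \<comment> \<open>All sufficiently small outer radii are required, because the radius is dictated
    later by the geometry of the fibre. In the first two cases every radius works and the threshold
    1 is arbitrary; in the third it is \<open>\<delta>\<close>.\<close>
  have weights: "\<exists>r0>0. \<forall>r2. 0 < r2 \<longrightarrow> r2 \<le> r0 \<longrightarrow>
      small_weights (sphere_weight Q' y0) p r2" if y0: "y0 \<in> f ` D" for y0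
    using Q_cond
  proof (elim disjE, goal_cases)
    case 1
    then have "small_weights (sphere_weight Q' y0) p r2" if "r2 > 0" for r2
      using y0 n p p1 that by (intro small_weights_of_fmo [OF _ _ _ Q_meas Q0 Q' eq]) auto
    then show ?thesis by (intro exI [of _ 1]) auto
  next
    case 2
    then obtain C where "\<forall>\<^sub>F r in at_right 0. sphere_mean Q y0 r \<le> ennreal (C * ln (1 / r) ^ (DIM(real ^ 'n) - 1))"
      using y0 dim by auto
    then have "small_weights (sphere_weight Q' y0) p r2" if "r2 > 0" for r2
      using p p1 that by (intro small_weights_of_log_mean [OF _ _ Q' eq]) auto
    then show ?thesis by (intro exI [of _ 1]) auto
  next
    case 3
    let ?\<Psi> = "\<lambda>t. 1 / (ennreal (t powr ((real DIM(real ^ 'n) - 1) / (p - 1))) *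
      enn_powr (sphere_mean Q y0 t) (1 / (p - 1)))"
    obtain \<delta> where "\<delta> > 0" and fin: "\<forall>\<^sub>F \<epsilon> in at_right 0. (\<integral>\<^sup>+ t \<in> {\<epsilon><..<\<delta>}. ?\<Psi> t \<partial>lebesgue) < \<infinity>"
      and inf: "(\<integral>\<^sup>+ t \<in> {0<..<\<delta>}. ?\<Psi> t \<partial>lebesgue) = \<infinity>"
      unfolding dim using 3 y0 by blast
    then show ?thesis using small_weights_of_divergent_mean [OF p1 Q' eq fin inf] by blast
  qed
  have light: "C = {x}" if C: "connected C" "C \<subseteq> {z \<in> D. f z = f x}" "x \<in> C" for C x
  proof -
    have y0: "f x \<in> f ` D" using C by blast
    obtain r0 where r0: "r0 > 0" "\<And>r2. 0 < r2 \<Longrightarrow> r2 \<le> r0 \<Longrightarrow>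
        small_weights (sphere_weight Q' (f x)) p r2"
      using weights [OF y0] by blast
    show ?thesis
    proof (rule fibre_totally_disconnected [OF _ _ D cont r0(1) _ C])
      show "DIM(real ^ 'n) \<ge> 2" "p > real DIM(real ^ 'n) - 1" using n p by simp_all
      fix r2 \<epsilon> :: real
      assume r2: "0 < r2" "r2 \<le> r0" and \<epsilon>: "0 < \<epsilon>"
      obtain r1 where "0 < r1" "r1 < r2" "modulus p (lifted_paths D f (f x) r1 r2) \<le> ennreal \<epsilon>"
        by (rule modulus_small_of_small_weights
            [OF Q' eq r0(2) [OF r2] \<epsilon>, of "\<lambda>r1. modulus p (lifted_paths D f (f x) r1 r2)" "f ` D"])
          (use modulus_bound y0 in blast)
      then show "\<exists>r1. 0 < r1 \<and> r1 < r2 \<and> modulus p (lifted_paths D f (f x) r1 r2) \<le> ennreal \<epsilon>"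
        by blast
    qed
  qed
  have "open D" using D by (simp add: is_domain_def)
  then show ?thesis using light by (intro light_sense_preserving_discrete_open f)
qed

end
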